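(* Let $M = \mathrm{Inv}\langle X \mid r_i(u_1, u_2, \ldots, u_k) = 1\ (i \in I)\rangle$ be a finitely presented special inverse monoid, where $u_1,\dots,u_k$ are words over $X\cup X^{-1}$, and suppose the factorisation into the $u_j$ is unital in $M$. Let $G =\mathrm{Gp}\langle X \mid r_i(u_1, u_2, \ldots, u_k) = 1\ (i \in I)\rangle$ be the maximal group image of $M$ and suppose it has decidable word problem. Finally, for $1 \le j \le \ell$, let there be letters $x_j, z_j \in X_j \subseteq X$, and put $Y_j = X_j \setminus \{x_j, z_j\}$, and let $W_j$ be a set of words over $Y_j \cup Y_j^{-1}$, such that the following hold: (1) the sets $X_{j_1}$ and $X_{j_2}$ are equal if and only if $j_1 = j_2$ and are disjoint otherwise; (2) $\{u_1, u_2, \ldots, u_k\} = \bigcup_{j=1}^{\ell} \{ x_j w z_j : w \in W_j\}$ (as sets of words); (3) the empty word belongs to $W_j$, for each $1 \le j \le \ell$; (4) for each $1\le j\le \ell$ and each $y \in Y_j$ there is some word $w_y$, a concatenation of words from $W_j$ and their inverses, such that $y \equiv \mathrm{red}(w_y)$. Then $G$ (with the given presentation) has decidable prefix membership problem and $M_{EU}$ has decidable word problem (in particular, $M$ has decidable word problem if it is E-unitary).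
   Context: $\mathrm{Inv}\langle X \mid R\rangle$ and $\mathrm{Gp}\langle X \mid R\rangle$ denote the inverse monoid, respectively group, with generators $X$ and defining relations $R$ between words over $X \cup X^{-1}$. The notation $r_i(u_1,\ldots,u_k)$ means that the word $r_i$ is given as a concatenation (in the free monoid, without cancellation) of the words $u_j$ and their formal inverses; by convention no proper subset of $\{u_1,\dots,u_k\}$ suffices to write all the $r_i$, so each $u_j$ occurs as $u_j$ or $u_j^{-1}$ in at least one $r_i$. The factorisation is unital in $M$ if each $u_j$ represents a unit of $M$. $\mathrm{red}(w)$ is the freely reduced form of the word $w$, and $\equiv$ is equality of words. The prefix monoid of $G$ (for this presentation) is the submonoid of $G$ generated by the elements represented by all prefixes of the words $r_i$; the prefix membership problem asks, given a word $w$ over $X\cup X^{-1}$, whether $w$ represents an element of the prefix monoid. The word problem asks, given two words over $X\cup X^{-1}$, whether they represent the same element. $M$ is E-unitary if only idempotents of $M$ map to $1$ in its maximal group image; $M_{EU}$ is the maximal E-unitary image of $M$, i.e. the largest homomorphic image (quotient) of $M$ that is E-unitary, generated by (the image of) $X$. *)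

theory Defs
  imports "HOL-Algebra.Group" "HOL-Library.Nat_Bijection" "HOL-Library.Sublist"
begin

section \<open>Words over an alphabet with formal inverses\<close>

text \<open>The letter \<open>(x, True)\<close> is the generator \<open>x\<close>, the letter \<open>(x, False)\<close> its formal inverse.\<close>

type_synonym 'x letter = "'x \<times> bool"
type_synonym 'x word = "'x letter list"

definition words :: "'x set \<Rightarrow> 'x word set" where
  "words X = lists (X \<times> UNIV)"

abbreviation gen :: "'x \<Rightarrow> 'x letter" where
  "gen x \<equiv> (x, True)"

definition inv_letter :: "'x letter \<Rightarrow> 'x letter" where
  "inv_letter a = (fst a, \<not> snd a)"

definition inv_word :: "'x word \<Rightarrow> 'x word" where
  "inv_word w = rev (map inv_letter w)"

fun red :: "'x word \<Rightarrow> 'x word" where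
  "red [] = []"
| "red (a # w) =
     (case red w of
        [] \<Rightarrow> [a]
      | b # v \<Rightarrow> if b = inv_letter a then v else a # b # v)"

definition concatenations :: "'x word set \<Rightarrow> 'x word set" where
  "concatenations U = concat ` lists (U \<union> inv_word ` U)"

text \<open>The family \<open>r\<close> of words can be written as concatenations of elements of \<open>U\<close> and their
  inverses, and no proper subset of \<open>U\<close> suffices for this.\<close>

definition factorisation :: "'x word set \<Rightarrow> 'i set \<Rightarrow> ('i \<Rightarrow> 'x word) \<Rightarrow> bool" where
  "factorisation U I r \<longleftrightarrow>
     (\<forall>i\<in>I. r i \<in> concatenations U) \<and>
     (\<forall>V. V \<subset> U \<longrightarrow> \<not> (\<forall>i\<in>I. r i \<in> concatenations V))"


section \<open>Congruences and quotients of monoids\<close>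

definition monoid_congruence :: "('a, 'm) monoid_scheme \<Rightarrow> ('a \<times> 'a) set \<Rightarrow> bool" where
  "monoid_congruence M s \<longleftrightarrow>
     equiv (carrier M) s \<and>
     (\<forall>a b c d. (a, b) \<in> s \<longrightarrow> (c, d) \<in> s \<longrightarrow> (a \<otimes>\<^bsub>M\<^esub> c, b \<otimes>\<^bsub>M\<^esub> d) \<in> s)"

definition congruence_generated ::
    "('a, 'm) monoid_scheme \<Rightarrow> ('a \<times> 'a) set \<Rightarrow> ('a \<times> 'a) set" where
  "congruence_generated M S = \<Inter> {s. monoid_congruence M s \<and> S \<subseteq> s}"

definition quotient_monoid :: "('a, 'm) monoid_scheme \<Rightarrow> ('a \<times> 'a) set \<Rightarrow> 'a set monoid" where
  "quotient_monoid M s =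
     \<lparr>carrier = carrier M // s,
      mult = (\<lambda>A B. \<Union>a\<in>A. \<Union>b\<in>B. s `` {a \<otimes>\<^bsub>M\<^esub> b}),
      one = s `` {\<one>\<^bsub>M\<^esub>}\<rparr>"

definition submonoid_generated :: "('a, 'm) monoid_scheme \<Rightarrow> 'a set \<Rightarrow> 'a set" where
  "submonoid_generated M S = \<Inter> {H. submonoid H M \<and> S \<subseteq> H}"


section \<open>Presentations of inverse monoids and groups\<close>

definition free_monoid :: "'x set \<Rightarrow> 'x word monoid" where
  "free_monoid X = \<lparr>carrier = words X, mult = (@), one = []\<rparr>"

text \<open>The relations of the free inverse monoid on \<open>X\<close> (Wagner's congruence).\<close>

definition wagner_relations :: "'x set \<Rightarrow> ('x word \<times> 'x word) set" where
  "wagner_relations X =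
     {(w, w @ inv_word w @ w) | w. w \<in> words X} \<union>
     {(w @ inv_word w @ v @ inv_word v, v @ inv_word v @ w @ inv_word w) | w v.
        w \<in> words X \<and> v \<in> words X}"

definition group_relations :: "'x set \<Rightarrow> ('x word \<times> 'x word) set" where
  "group_relations X = {([a, inv_letter a], []) | a. a \<in> X \<times> UNIV}"

definition Inv_cong :: "'x set \<Rightarrow> ('x word \<times> 'x word) set \<Rightarrow> ('x word \<times> 'x word) set" where
  "Inv_cong X R = congruence_generated (free_monoid X) (wagner_relations X \<union> R)"

definition Gp_cong :: "'x set \<Rightarrow> ('x word \<times> 'x word) set \<Rightarrow> ('x word \<times> 'x word) set" where
  "Gp_cong X R = congruence_generated (free_monoid X) (group_relations X \<union> R)"

definition Inv :: "'x set \<Rightarrow> ('x word \<times> 'x word) set \<Rightarrow> 'x word set monoid" where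
  "Inv X R = quotient_monoid (free_monoid X) (Inv_cong X R)"

definition Gp :: "'x set \<Rightarrow> ('x word \<times> 'x word) set \<Rightarrow> 'x word set monoid" where
  "Gp X R = quotient_monoid (free_monoid X) (Gp_cong X R)"

text \<open>The elements of \<open>Inv X R\<close> and \<open>Gp X R\<close> represented by a word.\<close>

definition Inv_val :: "'x set \<Rightarrow> ('x word \<times> 'x word) set \<Rightarrow> 'x word \<Rightarrow> 'x word set" where
  "Inv_val X R w = Inv_cong X R `` {w}"

definition Gp_val :: "'x set \<Rightarrow> ('x word \<times> 'x word) set \<Rightarrow> 'x word \<Rightarrow> 'x word set" where
  "Gp_val X R w = Gp_cong X R `` {w}"

definition prefix_monoid :: "'x set \<Rightarrow> 'i set \<Rightarrow> ('i \<Rightarrow> 'x word) \<Rightarrow> 'x word set set" where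
  "prefix_monoid X I r =
     (let R = (\<lambda>i. (r i, [])) ` I in
        submonoid_generated (Gp X R) (Gp_val X R ` {p. \<exists>i\<in>I. prefix p (r i)}))"


section \<open>E-unitary inverse monoids\<close>

text \<open>The notions of this section are meant for inverse monoids \<open>M\<close>.  All quotients of an inverse
  monoid are again inverse monoids, and both the congruences with group quotient and those with
  E-unitary quotient are then closed under intersection, so that the intersections below are the
  least such congruences.\<close>

definition min_group_cong :: "('a, 'm) monoid_scheme \<Rightarrow> ('a \<times> 'a) set" where
  "min_group_cong M = \<Inter> {s. monoid_congruence M s \<and> group (quotient_monoid M s)}"

definition max_group_image :: "('a, 'm) monoid_scheme \<Rightarrow> 'a set monoid" where
  "max_group_image M = quotient_monoid M (min_group_cong M)"

definition E_unitary :: "('a, 'm) monoid_scheme \<Rightarrow> bool" where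
  "E_unitary M \<longleftrightarrow>
     (\<forall>a\<in>carrier M. min_group_cong M `` {a} = \<one>\<^bsub>max_group_image M\<^esub> \<longrightarrow> a \<otimes>\<^bsub>M\<^esub> a = a)"

definition EU_cong :: "('a, 'm) monoid_scheme \<Rightarrow> ('a \<times> 'a) set" where
  "EU_cong M = \<Inter> {s. monoid_congruence M s \<and> E_unitary (quotient_monoid M s)}"

definition max_EU_image :: "('a, 'm) monoid_scheme \<Rightarrow> 'a set monoid" where
  "max_EU_image M = quotient_monoid M (EU_cong M)"

text \<open>The element of \<open>max_EU_image (Inv X R)\<close> represented by a word.\<close>

definition EU_val :: "'x set \<Rightarrow> ('x word \<times> 'x word) set \<Rightarrow> 'x word \<Rightarrow> 'x word set set" where
  "EU_val X R w = EU_cong (Inv X R) `` {Inv_val X R w}"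


section \<open>Decidability\<close>

text \<open>\<open>recursive n f\<close> says that \<open>f\<close>, restricted to argument lists of length \<open>n\<close>, is a (total)
  general recursive function of \<open>n\<close> arguments: minimisation is applied to regular functions
  only.  By Kleene's normal form theorem these are exactly the total computable functions.  The
  rule \<open>rec_cong\<close> makes the values of \<open>f\<close> on lists of other lengths irrelevant.\<close>

inductive recursive :: "nat \<Rightarrow> (nat list \<Rightarrow> nat) \<Rightarrow> bool" where
  rec_zero: "recursive n (\<lambda>xs. 0)"
| rec_succ: "recursive 1 (\<lambda>xs. Suc (xs ! 0))"
| rec_proj: "i < n \<Longrightarrow> recursive n (\<lambda>xs. xs ! i)"
| rec_comp: "recursive (length fs) g \<Longrightarrow> \<forall>f\<in>set fs. recursive n f \<Longrightarrow>
     recursive n (\<lambda>xs. g (map (\<lambda>f. f xs) fs))"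
| rec_prim: "recursive n f \<Longrightarrow> recursive (Suc (Suc n)) g \<Longrightarrow>
     recursive (Suc n) (\<lambda>xs. rec_nat (f (tl xs)) (\<lambda>m v. g (m # v # tl xs)) (hd xs))"
| rec_min: "recursive (Suc n) f \<Longrightarrow> \<forall>xs. length xs = n \<longrightarrow> (\<exists>m. f (m # xs) = 0) \<Longrightarrow>
     recursive n (\<lambda>xs. LEAST m. f (m # xs) = 0)"
| rec_cong: "recursive n f \<Longrightarrow> \<forall>xs. length xs = n \<longrightarrow> f xs = g xs \<Longrightarrow> recursive n g"

fun letter_code :: "('x \<Rightarrow> nat) \<Rightarrow> 'x letter \<Rightarrow> nat" where
  "letter_code e (x, b) = 2 * e x + (if b then 0 else 1)"

definition word_code :: "('x \<Rightarrow> nat) \<Rightarrow> 'x word \<Rightarrow> nat" where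
  "word_code e w = list_encode (map (letter_code e) w)"

text \<open>Words are coded by numbers along a numbering \<open>e\<close> of the generators.  For finite \<open>X\<close>, the
  only case of interest here, the choice of \<open>e\<close> is irrelevant, since any two numberings
  are related by a finite table.\<close>

definition decidable_word_problem :: "'x set \<Rightarrow> ('x word \<Rightarrow> 'a) \<Rightarrow> bool" where
  "decidable_word_problem X val \<longleftrightarrow>
     (\<exists>e f. inj_on e X \<and> recursive 2 f \<and>
        (\<forall>v\<in>words X. \<forall>w\<in>words X.
           f [word_code e v, word_code e w] = (if val v = val w then 1 else 0)))"

definition decidable_membership :: "'x set \<Rightarrow> ('x word \<Rightarrow> 'a) \<Rightarrow> 'a set \<Rightarrow> bool" where
  "decidable_membership X val A \<longleftrightarrow>
     (\<exists>e f. inj_on e X \<and> recursive 1 f \<and>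
        (\<forall>w\<in>words X. f [word_code e w] = (if val w \<in> A then 1 else 0)))"

end

theory Submission
  imports Defs
begin

text \<open>
  Since the pieces \<open>x w z\<close> represent units of \<open>M\<close>, they and their inverses lie in the prefix monoid
  \<open>P\<close>; because of conditions (3) and (4), so do \<open>x z\<close> and \<open>x y x\<^sup>-\<^sup>1\<close> for the other letters \<open>y\<close> of the
  same alphabet \<open>X\<^sub>j\<close>.  In these new generators the relators no longer involve the letters \<open>x\<close>, so \<open>G\<close>
  is a free product \<open>K * F\<close> where \<open>F\<close> is free on the letters \<open>x\<close> and those outside all \<open>X\<^sub>j\<close>, and \<open>P\<close> is
  generated by \<open>K\<close> and the letters \<open>x\<close>.  Hence an element belongs to \<open>P\<close> iff only positive powers of
  letters \<open>x\<close> occur in its normal form, and the normal form is computable from the word problem of \<open>G\<close>.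

  For the second part, attach to each word \<open>w\<close> the subgraph of the Cayley graph of \<open>G\<close> that arises from
  the path labelled \<open>w\<close> by adding all relator loops at all vertices.  Two words are equal in the maximal
  E-unitary image iff they are equal in \<open>G\<close> and their subgraphs coincide.  The vertices of the subgraph
  are the products of a prefix of \<open>w\<close> and an element of \<open>P\<close>, so this is decidable once membership in \<open>P\<close>
  is.
\<close>

section \<open>Recursive functions\<close>

text \<open>The decomposition is never built from a presentation of K. Rewriting old letters in the
  new generators gives a homomorphism from G to the free product of G itself with the free group on
  \<open>S\<close>; it exists because each relator is sent to its own value in the first factor,
  which is 1. Evaluation in G is a left inverse. So components of normal forms may be arbitrary
  elements of G, membership in K is never tested, and reducing a word only requires deciding whether
  a component equals 1 in G. That prefixes of unital pieces lie in P is proved with the subgraphs of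
  the second part: if u v = 1 in M, the path labelled u v stays in the subgraph of the empty word,
  whose vertices are P. Both halves thus rest on the same invariant of M. Condition (3) makes x z
  itself a piece, so that conjugates by x become quotients of pieces; condition (4) then passes from
  the words in \<open>W j\<close> to single letters. If \<open>x j = z j\<close>, the letter x turns
  out to be a unit of P, and no letter of \<open>Xs j\<close> is split off.\<close>

lemma recursive_const: "recursive n (\<lambda>_. c)"
proof (induction c)
  case 0 show ?case by (rule rec_zero)
next
  case (Suc c)
  have "recursive n (\<lambda>xs. (\<lambda>xs. Suc (xs ! 0)) (map (\<lambda>f. f xs) [\<lambda>_. c]))"
    by (rule rec_comp) (use Suc rec_succ in auto)
  then show ?case by simp
qed

lemma recursive_comp1:
  assumes "recursive (Suc 0) (\<lambda>xs. f (xs ! 0))" "recursive n F"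
  shows "recursive n (\<lambda>xs. f (F xs))"
proof -
  have "recursive n (\<lambda>xs. (\<lambda>xs. f (xs ! 0)) (map (\<lambda>f. f xs) [F]))"
    by (rule rec_comp) (use assms in auto)
  then show ?thesis by simp
qed

lemma recursive_comp2:
  assumes "recursive 2 (\<lambda>xs. f (xs ! 0) (xs ! 1))" "recursive n F" "recursive n G"
  shows "recursive n (\<lambda>xs. f (F xs) (G xs))"
proof -
  have "recursive n (\<lambda>xs. (\<lambda>xs. f (xs ! 0) (xs ! 1)) (map (\<lambda>f. f xs) [F, G]))"
    by (rule rec_comp) (use assms in \<open>auto simp: numeral_2_eq_2\<close>)
  then show ?thesis by simp
qed

lemma recursive_apply1:
  assumes "recursive 1 f" "recursive n F"
  shows "recursive n (\<lambda>xs. f [F xs])"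
  using rec_comp[of "[F]" f n] assms by auto

lemma recursive_apply2:
  assumes "recursive 2 f" "recursive n F" "recursive n G"
  shows "recursive n (\<lambda>xs. f [F xs, G xs])"
  using rec_comp[of "[F, G]" f n] assms by (auto simp: numeral_2_eq_2)

lemma map_nth_projections: "length xs = n \<Longrightarrow> map (\<lambda>f. f xs) (map (\<lambda>i xs. xs ! i) [0..<n]) = xs"
  by (auto intro: nth_equalityI)

lemma recursive_cons_arg:
  assumes "recursive (Suc n) f" "recursive n F"
  shows "recursive n (\<lambda>xs. f (F xs # xs))"
proof -
  have "recursive n (\<lambda>xs. f (map (\<lambda>f. f xs) (F # map (\<lambda>i xs. xs ! i) [0..<n])))"
    by (rule rec_comp) (use assms rec_proj in auto)
  then show ?thesis
    by (rule rec_cong) (simp add: map_nth_projections del: map_map)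
qed

text \<open>\<open>rec_prim\<close> takes the number of rounds from the first argument; consing
  \<open>N xs\<close> in front of \<open>xs\<close> allows any recursive bound.\<close>

lemma recursive_rec_nat:
  assumes "recursive (Suc (Suc n)) S" "recursive n B" "recursive n N"
  shows "recursive n (\<lambda>xs. rec_nat (B xs) (\<lambda>m v. S (m # v # xs)) (N xs))"
  using recursive_cons_arg[OF rec_prim[OF assms(2,1)] assms(3)] by simp

lemma recursive_LEAST:
  assumes "recursive (Suc n) (\<lambda>xs. of_bool (\<not> P (xs ! 0) (tl xs)))" "\<And>xs. length xs = n \<Longrightarrow> \<exists>m. P m xs"
  shows "recursive n (\<lambda>xs. LEAST m. P m xs)"
  using rec_min[OF assms(1)] assms(2) by simp

lemma recursive_Suc: "recursive n F \<Longrightarrow> recursive n (\<lambda>xs. Suc (F xs))"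
  using recursive_comp1[of Suc] rec_succ by simp

lemma recursive_proj0: "0 < n \<Longrightarrow> recursive n (\<lambda>xs. xs ! 0)"
  and recursive_proj1: "1 < n \<Longrightarrow> recursive n (\<lambda>xs. xs ! Suc 0)"
  by (auto intro: rec_proj)

lemma recursive_add:
  assumes "recursive n F" "recursive n G"
  shows "recursive n (\<lambda>xs. F xs + G xs)"
proof -
  have "rec_nat b (\<lambda>m v. Suc v) a = a + b" for a b by (induction a) auto
  then show ?thesis
    using recursive_rec_nat[OF recursive_Suc[OF recursive_proj1, of "Suc (Suc n)"] assms(2,1)] by simp
qed

lemma recursive_mult:
  assumes "recursive n F" "recursive n G"
  shows "recursive n (\<lambda>xs. F xs * G xs)"
proof -
  have "rec_nat 0 (\<lambda>m v. v + b) a = a * b" for a b by (induction a) auto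
  moreover have "recursive 2 (\<lambda>xs. rec_nat 0 (\<lambda>m v. (\<lambda>ys. ys ! 1 + ys ! 3) (m # v # xs)) (xs ! 0))"
    by (rule recursive_rec_nat) (intro recursive_add rec_proj recursive_const; simp)+
  ultimately show ?thesis
    using recursive_comp2[OF _ assms, of "\<lambda>a b. a * b"] by simp
qed

lemma recursive_pred:
  assumes "recursive n F"
  shows "recursive n (\<lambda>xs. F xs - Suc 0)"
proof -
  have "rec_nat 0 (\<lambda>m v. m) a = a - Suc 0" for a by (induction a) auto
  then show ?thesis
    using recursive_rec_nat[OF recursive_proj0[of "Suc (Suc n)"] recursive_const assms, of 0] by simp
qed

lemma recursive_diff:
  assumes "recursive n F" "recursive n G"
  shows "recursive n (\<lambda>xs. F xs - G xs)"
proof -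
  have "rec_nat b (\<lambda>m v. v - Suc 0) a = b - a" for a b :: nat by (induction a) auto
  then show ?thesis
    using recursive_rec_nat[OF recursive_pred[OF recursive_proj1, of "Suc (Suc n)"] assms] by simp
qed

lemma recursive_not:
  assumes "recursive n (\<lambda>xs. of_bool (P xs))"
  shows "recursive n (\<lambda>xs. of_bool (\<not> P xs))"
proof -
  have "1 - of_bool b = (of_bool (\<not> b) :: nat)" for b by simp
  then show ?thesis using recursive_diff[OF recursive_const[of n 1] assms] by (simp only:)
qed

lemma recursive_conj:
  assumes "recursive n (\<lambda>xs. of_bool (P xs))" "recursive n (\<lambda>xs. of_bool (Q xs))"
  shows "recursive n (\<lambda>xs. of_bool (P xs \<and> Q xs))"
  using recursive_mult[OF assms] by (simp add: of_bool_conj)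

lemma recursive_disj:
  assumes "recursive n (\<lambda>xs. of_bool (P xs))" "recursive n (\<lambda>xs. of_bool (Q xs))"
  shows "recursive n (\<lambda>xs. of_bool (P xs \<or> Q xs))"
  using recursive_not[OF recursive_conj[OF recursive_not[OF assms(1)] recursive_not[OF assms(2)]]] by simp

lemma recursive_le:
  assumes "recursive n F" "recursive n G"
  shows "recursive n (\<lambda>xs. of_bool (F xs \<le> G xs))"
proof -
  have "1 - (a - b) = of_bool (a \<le> b)" for a b :: nat by auto
  with recursive_diff[OF recursive_const[of n 1] recursive_diff[OF assms]] show ?thesis by simp
qed

lemma recursive_less:
  assumes "recursive n F" "recursive n G"
  shows "recursive n (\<lambda>xs. of_bool (F xs < G xs))"
  using recursive_not[OF recursive_le[OF assms(2,1)]] by (simp add: not_le)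

lemma recursive_eq:
  assumes "recursive n F" "recursive n G"
  shows "recursive n (\<lambda>xs. of_bool (F xs = G xs))"
  using recursive_conj[OF recursive_le[OF assms] recursive_le[OF assms(2,1)]]
  by (simp add: order_eq_iff[symmetric])

lemma recursive_if:
  assumes "recursive n (\<lambda>xs. of_bool (P xs))" "recursive n F" "recursive n G"
  shows "recursive n (\<lambda>xs. if P xs then F xs else G xs)"
proof -
  have "of_bool (P xs) * F xs + of_bool (\<not> P xs) * G xs = (if P xs then F xs else G xs)" for xs
    by simp
  moreover have "recursive n (\<lambda>xs. of_bool (P xs) * F xs + of_bool (\<not> P xs) * G xs)"
    by (intro recursive_add recursive_mult recursive_not assms)
  ultimately show ?thesis by simp
qed

lemmas recursive_basic = recursive_const recursive_Suc recursive_add recursive_mult recursive_pred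
  recursive_diff recursive_not recursive_conj recursive_disj recursive_le recursive_less recursive_eq
  recursive_if rec_proj

section \<open>Pairs, lists and finite tables in terms of numbers\<close>

lemma recursive_triangle:
  assumes "recursive n F"
  shows "recursive n (\<lambda>xs. triangle (F xs))"
proof -
  have "rec_nat 0 (\<lambda>m v. v + Suc m) a = triangle a" for a by (induction a) auto
  moreover have "recursive n (\<lambda>xs. rec_nat 0 (\<lambda>m v. (\<lambda>ys. ys ! 1 + Suc (ys ! 0)) (m # v # xs)) (F xs))"
    by (rule recursive_rec_nat) (intro recursive_basic assms; simp)+
  ultimately show ?thesis by simp
qed

lemma recursive_prod_encode:
  assumes "recursive n F" "recursive n G"
  shows "recursive n (\<lambda>xs. prod_encode (F xs, G xs))"
  unfolding prod_encode_def by (simp, intro recursive_basic recursive_triangle assms)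

lemma triangle_mono: "m \<le> n \<Longrightarrow> triangle m \<le> triangle n"
  by (induction n rule: nat_induct) (auto simp: le_Suc_eq)

text \<open>The code of (a, b) is \<open>triangle (a + b) + a\<close>, which is below
  \<open>triangle (Suc (a + b))\<close>. So a + b is found by a regular minimisation and the
  components by subtraction.\<close>

lemma prod_decode_LEAST:
  fixes c :: nat
  defines "k \<equiv> LEAST k. c < triangle (Suc k)"
  shows "fst (prod_decode c) = c - triangle k" "snd (prod_decode c) = k - (c - triangle k)"
proof -
  obtain a b where ab: "prod_decode c = (a, b)" by fastforce
  then have c: "c = triangle (a + b) + a"
    using prod_decode_inverse[of c] by (simp add: prod_encode_def)
  have "k = a + b"
    unfolding k_def
  proof (rule Least_equality)
    show "a + b \<le> y" if "c < triangle (Suc y)" for y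
      using that c triangle_mono[of "Suc y" "a + b"] by (cases "Suc y \<le> a + b") linarith+
  qed (use c in simp)
  then show "fst (prod_decode c) = c - triangle k" "snd (prod_decode c) = k - (c - triangle k)"
    using ab c by auto
qed

lemma recursive_triangle_root: "recursive (Suc 0) (\<lambda>xs. LEAST k. xs ! 0 < triangle (Suc k))"
proof (rule recursive_LEAST)
  have "recursive (Suc (Suc 0)) (\<lambda>xs. of_bool (\<not> xs ! 1 < triangle (Suc (xs ! 0))))"
    by (intro recursive_basic recursive_triangle; simp)
  then show "recursive (Suc (Suc 0)) (\<lambda>xs. of_bool (\<not> tl xs ! 0 < triangle (Suc (xs ! 0))))"
    by (rule rec_cong) (auto simp: nth_tl)
  show "\<exists>m. xs ! 0 < triangle (Suc m)" for xs :: "nat list"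
    by (rule exI[of _ "xs ! 0"]) simp
qed

lemma recursive_fst_decode: "recursive n F \<Longrightarrow> recursive n (\<lambda>xs. fst (prod_decode (F xs)))"
  by (rule recursive_comp1[where f = "\<lambda>c. fst (prod_decode c)"])
    (unfold prod_decode_LEAST, intro recursive_basic recursive_triangle recursive_triangle_root; simp)

lemma recursive_snd_decode: "recursive n F \<Longrightarrow> recursive n (\<lambda>xs. snd (prod_decode (F xs)))"
  by (rule recursive_comp1[where f = "\<lambda>c. snd (prod_decode c)"])
    (unfold prod_decode_LEAST, intro recursive_basic recursive_triangle recursive_triangle_root; simp)

lemma length_list_decode_le: "length (list_decode c) \<le> c"
proof (induction c rule: less_induct)
  case (less c)
  show ?case
  proof (cases c)
    case (Suc d)
    obtain a b where ab: "prod_decode d = (a, b)" by fastforce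
    then have "b \<le> d" by (metis le_prod_encode_2 prod_decode_inverse)
    with less[of b] Suc ab show ?thesis by auto
  qed simp
qed

text \<open>The step of a fold receives two arguments of its own, followed by the parameters. This
  allows a function of the same shape to be evaluated inside it at two other values, with the
  parameters unchanged.\<close>

lemma recursive_replace2:
  assumes S: "recursive (Suc (Suc n)) S" and F: "recursive (Suc (Suc n)) F" and G: "recursive (Suc (Suc n)) G"
  shows "recursive (Suc (Suc n)) (\<lambda>ys. S (F ys # G ys # drop 2 ys))"
proof -
  have "recursive (Suc (Suc n)) (\<lambda>ys. S (map (\<lambda>f. f ys) (F # G # map (\<lambda>i xs. xs ! i) [2..<Suc (Suc n)])))"
  proof (rule rec_comp)
    have "length [2..<Suc (Suc n)] = n" by (simp del: upt_Suc)
    then show "recursive (length (F # G # map (\<lambda>i xs. xs ! i) [2..<Suc (Suc n)])) S"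
      using S by (simp del: upt_Suc)
  qed (use F G rec_proj in auto)
  then show ?thesis
    by (rule rec_cong) (auto intro!: arg_cong[of _ _ S] nth_equalityI simp del: upt_Suc)
qed

lemma recursive_foldl:
  assumes S: "recursive (Suc (Suc n)) S" and "recursive n A" "recursive n L"
  shows "recursive n (\<lambda>xs. foldl (\<lambda>v a. S (v # a # xs)) (A xs) (list_decode (L xs)))"
proof -
  define st where "st xs s = (if fst (prod_decode s) = 0 then s else
     prod_encode (snd (prod_decode (fst (prod_decode s) - Suc 0)),
       S (snd (prod_decode s) # fst (prod_decode (fst (prod_decode s) - Suc 0)) # xs)))" for xs s
  have iter: "rec_nat (prod_encode (list_encode l, a)) (\<lambda>m v. st xs v) (length l + d)
      = prod_encode (0, foldl (\<lambda>v a. S (v # a # xs)) a l)" for l a xs d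
  proof -
    have shift: "rec_nat s (\<lambda>m v. st xs v) (Suc n) = rec_nat (st xs s) (\<lambda>m v. st xs v) n" for s n
      by (induction n) auto
    have base: "rec_nat (prod_encode (0, a)) (\<lambda>m v. st xs v) d = prod_encode (0, a)" for a
      by (induction d) (auto simp: st_def)
    show ?thesis
    proof (induction l arbitrary: a)
      case (Cons b l)
      have "st xs (prod_encode (list_encode (b # l), a)) = prod_encode (list_encode l, S (a # b # xs))"
        by (simp add: st_def)
      then show ?case using Cons shift by (simp del: nat.rec)
    qed (use base in simp)
  qed
  have "recursive n (\<lambda>xs. rec_nat (prod_encode (L xs, A xs)) (\<lambda>m v. (\<lambda>ys. st (drop 2 ys) (ys ! 1)) (m # v # xs)) (L xs))"
    by (rule recursive_rec_nat) (unfold st_def, (intro recursive_basic recursive_prod_encode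
      recursive_fst_decode recursive_snd_decode recursive_replace2 assms; simp)+)
  then have "recursive n (\<lambda>xs. snd (prod_decode (rec_nat (prod_encode (L xs, A xs)) (\<lambda>m v. st xs v) (L xs))))"
    by (intro recursive_snd_decode) simp
  then show ?thesis
  proof (rule rec_cong, intro allI impI)
    fix xs :: "nat list"
    let ?l = "list_decode (L xs)"
    have "length ?l + (L xs - length ?l) = L xs" using length_list_decode_le[of "L xs"] by simp
    with iter[of ?l "A xs" xs "L xs - length ?l"]
    show "snd (prod_decode (rec_nat (prod_encode (L xs, A xs)) (\<lambda>m v. st xs v) (L xs)))
        = foldl (\<lambda>v a. S (v # a # xs)) (A xs) ?l" by simp
  qed
qed

text \<open>Nested conditionals implement any finite family \<open>H\<close>, however it depends on
  its index. Outside \<open>A\<close> the value is left open.\<close>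

lemma recursive_finite_cases:
  assumes "finite A" "\<And>a. a \<in> A \<Longrightarrow> recursive n (H a)" "recursive n F"
  obtains K where "recursive n K" "\<And>xs. F xs \<in> A \<Longrightarrow> K xs = H (F xs) xs"
proof -
  have "\<exists>K. recursive n K \<and> (\<forall>xs. F xs \<in> A \<longrightarrow> K xs = H (F xs) xs)"
    using assms(1,2)
  proof (induction A)
    case empty
    show ?case using rec_zero by blast
  next
    case (insert a A)
    then obtain K where K: "recursive n K" "\<forall>xs. F xs \<in> A \<longrightarrow> K xs = H (F xs) xs" by auto
    have "recursive n (\<lambda>xs. if F xs = a then H a xs else K xs)"
      by (intro recursive_basic assms K insert) simp
    with K show ?case by (intro exI[of _ "\<lambda>xs. if F xs = a then H a xs else K xs"]) auto
  qed
  with that show thesis by blast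
qed

section \<open>Words, congruences and quotients\<close>

lemma words_Nil: "[] \<in> words X"
  and words_Cons: "a # w \<in> words X \<longleftrightarrow> fst a \<in> X \<and> w \<in> words X"
  and words_append: "v @ w \<in> words X \<longleftrightarrow> v \<in> words X \<and> w \<in> words X"
  by (auto simp: words_def mem_Times_iff)

lemma inv_letter_inv_letter: "inv_letter (inv_letter a) = a"
  and fst_inv_letter: "fst (inv_letter a) = fst a"
  by (simp_all add: inv_letter_def)

lemma inv_word_Nil: "inv_word [] = []"
  and inv_word_Cons: "inv_word (a # w) = inv_word w @ [inv_letter a]"
  and inv_word_append: "inv_word (v @ w) = inv_word w @ inv_word v"
  and inv_word_inv_word: "inv_word (inv_word w) = w"
  by (simp_all add: inv_word_def rev_map o_def inv_letter_inv_letter)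

lemma words_inv_word: "inv_word w \<in> words X \<longleftrightarrow> w \<in> words X"
  by (induction w) (auto simp: inv_word_Nil inv_word_Cons words_append words_Cons words_Nil fst_inv_letter)

lemmas words_simps [simp] = words_Nil words_Cons words_append words_inv_word fst_inv_letter
  inv_letter_inv_letter inv_word_Nil inv_word_Cons inv_word_append inv_word_inv_word

lemma words_prefix: "prefix p w \<Longrightarrow> w \<in> words X \<Longrightarrow> p \<in> words X"
  by (auto simp: prefix_def)

lemma monoid_free_monoid: "monoid (free_monoid X)"
  by (unfold_locales) (auto simp: free_monoid_def)

lemma free_monoid_simps [simp]:
  "carrier (free_monoid X) = words X" "v \<otimes>\<^bsub>free_monoid X\<^esub> w = v @ w" "\<one>\<^bsub>free_monoid X\<^esub> = []"
  by (simp_all add: free_monoid_def)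

lemma monoid_congruenceI:
  assumes "s \<subseteq> carrier M \<times> carrier M" "\<And>a. a \<in> carrier M \<Longrightarrow> (a, a) \<in> s"
    "\<And>a b. (a, b) \<in> s \<Longrightarrow> (b, a) \<in> s" "\<And>a b c. (a, b) \<in> s \<Longrightarrow> (b, c) \<in> s \<Longrightarrow> (a, c) \<in> s"
    "\<And>a b c d. (a, b) \<in> s \<Longrightarrow> (c, d) \<in> s \<Longrightarrow> (a \<otimes>\<^bsub>M\<^esub> c, b \<otimes>\<^bsub>M\<^esub> d) \<in> s"
  shows "monoid_congruence M s"
proof -
  have "refl_on (carrier M) s" "sym s" "trans s"
    using assms(2) by (blast intro: refl_onI symI transI assms(3,4))+
  then show ?thesis using assms(1,5) by (simp add: monoid_congruence_def equiv_def)
qed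

lemma monoid_congruenceD:
  assumes "monoid_congruence M s"
  shows "equiv (carrier M) s" "s \<subseteq> carrier M \<times> carrier M" "a \<in> carrier M \<Longrightarrow> (a, a) \<in> s"
    "(a, b) \<in> s \<Longrightarrow> (b, a) \<in> s" "(a, b) \<in> s \<Longrightarrow> (b, c) \<in> s \<Longrightarrow> (a, c) \<in> s"
    "(a, b) \<in> s \<Longrightarrow> (c, d) \<in> s \<Longrightarrow> (a \<otimes>\<^bsub>M\<^esub> c, b \<otimes>\<^bsub>M\<^esub> d) \<in> s"
  using assms unfolding monoid_congruence_def equiv_def refl_on_def sym_def trans_def by blast+

lemma monoid_congruence_full: "monoid M \<Longrightarrow> monoid_congruence M (carrier M \<times> carrier M)"
  by (rule monoid_congruenceI) (auto simp: monoid.m_closed)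

lemma monoid_congruence_Inter:
  assumes "\<And>s. s \<in> T \<Longrightarrow> monoid_congruence M s" "T \<noteq> {}"
  shows "monoid_congruence M (\<Inter> T)"
proof (rule monoid_congruenceI)
  show "\<Inter> T \<subseteq> carrier M \<times> carrier M"
    using assms(2) monoid_congruenceD(2)[OF assms(1)] by blast
qed (use monoid_congruenceD(3-)[OF assms(1)] in blast)+

lemma congruence_generated:
  assumes "monoid M" "S \<subseteq> carrier M \<times> carrier M"
  shows "monoid_congruence M (congruence_generated M S)" "S \<subseteq> congruence_generated M S"
    and "\<And>s. monoid_congruence M s \<Longrightarrow> S \<subseteq> s \<Longrightarrow> congruence_generated M S \<subseteq> s"
  unfolding congruence_generated_def
  using monoid_congruence_full[OF assms(1)] assms(2) by (auto intro!: monoid_congruence_Inter)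

lemma quotient_monoid_simps:
  "carrier (quotient_monoid M s) = (\<lambda>a. s `` {a}) ` carrier M"
  "\<one>\<^bsub>quotient_monoid M s\<^esub> = s `` {\<one>\<^bsub>M\<^esub>}"
  by (auto simp: quotient_monoid_def quotient_def)

lemma monoid_congruence_class_eq:
  "monoid_congruence M s \<Longrightarrow> a \<in> carrier M \<Longrightarrow> b \<in> carrier M \<Longrightarrow> s `` {a} = s `` {b} \<longleftrightarrow> (a, b) \<in> s"
  by (meson eq_equiv_class_iff monoid_congruenceD(1))

lemma quotient_monoid_mult:
  assumes s: "monoid_congruence M s" and ab: "a \<in> carrier M" "b \<in> carrier M"
  shows "(s `` {a}) \<otimes>\<^bsub>quotient_monoid M s\<^esub> (s `` {b}) = s `` {a \<otimes>\<^bsub>M\<^esub> b}"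
proof -
  have "s `` {c \<otimes>\<^bsub>M\<^esub> d} = s `` {a \<otimes>\<^bsub>M\<^esub> b}" if "(a, c) \<in> s" "(b, d) \<in> s" for c d
    using equiv_class_eq[OF monoid_congruenceD(1)[OF s] monoid_congruenceD(6)[OF s that]] by simp
  moreover have "a \<in> s `` {a}" "b \<in> s `` {b}" using monoid_congruenceD(3)[OF s] ab by auto
  ultimately have "(\<Union>c\<in>s `` {a}. \<Union>d\<in>s `` {b}. s `` {c \<otimes>\<^bsub>M\<^esub> d}) = s `` {a \<otimes>\<^bsub>M\<^esub> b}"
    by (intro equalityI UN_least) blast+
  then show ?thesis by (simp add: quotient_monoid_def)
qed

lemma monoid_quotient_monoid:
  assumes "monoid M" "monoid_congruence M s"
  shows "monoid (quotient_monoid M s)"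
proof -
  interpret monoid M by fact
  show ?thesis
    by unfold_locales
      (auto simp: quotient_monoid_simps quotient_monoid_mult[OF assms(2)] m_assoc)
qed

text \<open>\<open>Gp\<close>, \<open>Inv\<close> and their quotients are all surjective images of
  the words over \<open>X\<close>, so that arguments about them can be carried out on representing
  words.\<close>

locale word_hom = N: monoid N for N (structure) +
  fixes X :: "'x set" and h :: "'x word \<Rightarrow> 'a"
  assumes carrier_eq: "carrier N = h ` words X"
    and h_Nil [simp]: "h [] = \<one>"
    and h_append: "v \<in> words X \<Longrightarrow> w \<in> words X \<Longrightarrow> h (v @ w) = h v \<otimes> h w"
begin

lemma h_closed [simp]: "w \<in> words X \<Longrightarrow> h w \<in> carrier N"
  by (simp add: carrier_eq)

lemma quotient_word_hom:
  assumes "monoid_congruence N s"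
  shows "word_hom (quotient_monoid N s) X (\<lambda>w. s `` {h w})"
proof -
  interpret Q: monoid "quotient_monoid N s" by (rule monoid_quotient_monoid) (use assms N.monoid_axioms in auto)
  show ?thesis
    by unfold_locales
      (auto simp: quotient_monoid_simps carrier_eq quotient_monoid_mult[OF assms] h_append)
qed

end

lemma word_hom_quotient_free:
  assumes "monoid_congruence (free_monoid X) s"
  shows "word_hom (quotient_monoid (free_monoid X) s) X (\<lambda>w. s `` {w})"
proof -
  interpret word_hom "free_monoid X" X "\<lambda>w. w"
    using monoid_free_monoid by (auto intro!: word_hom.intro word_hom_axioms.intro)
  show ?thesis by (rule quotient_word_hom) fact
qed


section \<open>The group and the inverse monoid of a special presentation\<close>

locale special_presentation =
  fixes X :: "'x set" and I :: "'i set" and r :: "'i \<Rightarrow> 'x word"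
  assumes relator_words: "i \<in> I \<Longrightarrow> r i \<in> words X"
begin

definition relations :: "('x word \<times> 'x word) set" where "relations = (\<lambda>i. (r i, [])) ` I"

abbreviation G where "G \<equiv> Gp X relations"
abbreviation val where "val \<equiv> Gp_val X relations"
abbreviation mval where "mval \<equiv> Inv_val X relations"

lemma group_relations_words: "group_relations X \<union> relations \<subseteq> words X \<times> words X"
  using relator_words by (auto simp: group_relations_def relations_def)

lemma wagner_relations_words: "wagner_relations X \<union> relations \<subseteq> words X \<times> words X"
  using relator_words by (auto simp: wagner_relations_def relations_def)

lemma Gp_cong:
  shows Gp_cong_congruence: "monoid_congruence (free_monoid X) (Gp_cong X relations)"
    and Gp_cong_relations: "group_relations X \<union> relations \<subseteq> Gp_cong X relations"
    and Gp_cong_least: "\<And>s. monoid_congruence (free_monoid X) s \<Longrightarrow>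
      group_relations X \<union> relations \<subseteq> s \<Longrightarrow> Gp_cong X relations \<subseteq> s"
  unfolding Gp_cong_def
  using congruence_generated[OF monoid_free_monoid, of "group_relations X \<union> relations" X]
    group_relations_words by auto

lemma Inv_cong:
  shows Inv_cong_congruence: "monoid_congruence (free_monoid X) (Inv_cong X relations)"
    and Inv_cong_relations: "wagner_relations X \<union> relations \<subseteq> Inv_cong X relations"
    and Inv_cong_least: "\<And>s. monoid_congruence (free_monoid X) s \<Longrightarrow>
      wagner_relations X \<union> relations \<subseteq> s \<Longrightarrow> Inv_cong X relations \<subseteq> s"
  unfolding Inv_cong_def
  using congruence_generated[OF monoid_free_monoid, of "wagner_relations X \<union> relations" X]
    wagner_relations_words by auto

sublocale val: word_hom G X val
  unfolding Gp_def Gp_val_def by (rule word_hom_quotient_free) (rule Gp_cong)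

sublocale mval: word_hom "Inv X relations" X mval
  unfolding Inv_def Inv_val_def by (rule word_hom_quotient_free) (rule Inv_cong)

lemma val_eq_iff: "v \<in> words X \<Longrightarrow> w \<in> words X \<Longrightarrow> val v = val w \<longleftrightarrow> (v, w) \<in> Gp_cong X relations"
  unfolding Gp_val_def using monoid_congruence_class_eq[OF Gp_cong_congruence] by simp

lemma mval_eq_iff: "v \<in> words X \<Longrightarrow> w \<in> words X \<Longrightarrow> mval v = mval w \<longleftrightarrow> (v, w) \<in> Inv_cong X relations"
  unfolding Inv_val_def using monoid_congruence_class_eq[OF Inv_cong_congruence] by simp

lemma val_letter_inv: "fst a \<in> X \<Longrightarrow> val [a] \<otimes>\<^bsub>G\<^esub> val [inv_letter a] = \<one>\<^bsub>G\<^esub>"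
proof -
  assume a: "fst a \<in> X"
  then have "([a, inv_letter a], []) \<in> group_relations X"
    unfolding group_relations_def by (cases a) auto
  with a Gp_cong_relations have "val [a, inv_letter a] = val []" by (subst val_eq_iff) auto
  with a show ?thesis using val.h_append[of "[a]" "[inv_letter a]"] by simp
qed

lemma val_mult_inv_word: "w \<in> words X \<Longrightarrow> val w \<otimes>\<^bsub>G\<^esub> val (inv_word w) = \<one>\<^bsub>G\<^esub>"
proof (induction w)
  case (Cons a w)
  then have w: "w \<in> words X" "fst a \<in> X" by auto
  have "val (a # w) \<otimes>\<^bsub>G\<^esub> val (inv_word (a # w))
      = val [a] \<otimes>\<^bsub>G\<^esub> ((val w \<otimes>\<^bsub>G\<^esub> val (inv_word w)) \<otimes>\<^bsub>G\<^esub> val [inv_letter a])"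
    using w val.h_append[of "[a]" w] by (simp add: val.h_append val.N.m_assoc)
  with Cons w show ?case by (simp add: val_letter_inv)
qed simp

sublocale G: group G
proof (rule val.N.group_l_invI)
  fix g assume "g \<in> carrier G"
  then obtain w where "w \<in> words X" "g = val w" by (auto simp: val.carrier_eq)
  then show "\<exists>y\<in>carrier G. y \<otimes>\<^bsub>G\<^esub> g = \<one>\<^bsub>G\<^esub>"
    using val_mult_inv_word[of "inv_word w"] by (intro bexI[of _ "val (inv_word w)"]) auto
qed

lemma val_inv_word: "w \<in> words X \<Longrightarrow> val (inv_word w) = inv\<^bsub>G\<^esub> (val w)"
  using val_mult_inv_word by (metis G.inv_equality G.inv_inv val.h_closed words_inv_word)

lemma val_relator: "i \<in> I \<Longrightarrow> val (r i) = \<one>\<^bsub>G\<^esub>"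
proof -
  assume "i \<in> I"
  then have "val (r i) = val []"
    using Gp_cong_relations relator_words by (subst val_eq_iff) (auto simp: relations_def)
  then show ?thesis by simp
qed

lemma val_Cons: "a # w \<in> words X \<Longrightarrow> val (a # w) = val [a] \<otimes>\<^bsub>G\<^esub> val w"
  using val.h_append[of "[a]" w] by simp

lemma mval_wagner: "w \<in> words X \<Longrightarrow> mval (w @ inv_word w @ w) = mval w"
  using Inv_cong_relations by (intro sym[of "mval w"], subst mval_eq_iff) (auto simp: wagner_relations_def)

lemma mval_wagner_commute: "v \<in> words X \<Longrightarrow> w \<in> words X \<Longrightarrow>
    mval (w @ inv_word w @ v @ inv_word v) = mval (v @ inv_word v @ w @ inv_word w)"
  using Inv_cong_relations by (subst mval_eq_iff) (auto simp: wagner_relations_def)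

lemma mval_relator: "i \<in> I \<Longrightarrow> mval (r i) = mval []"
  using Inv_cong_relations relator_words by (subst mval_eq_iff) (auto simp: relations_def)

lemma Inv_cong_subset_Gp_cong: "Inv_cong X relations \<subseteq> Gp_cong X relations"
proof (rule Inv_cong_least[OF Gp_cong_congruence])
  have "val w = val (w @ inv_word w @ w)" "val (w @ inv_word w @ v @ inv_word v) = val (v @ inv_word v @ w @ inv_word w)"
    if "w \<in> words X" "v \<in> words X" for v w
    using that by (simp_all add: val.h_append val_inv_word val.N.m_assoc[symmetric])
  then show "wagner_relations X \<union> relations \<subseteq> Gp_cong X relations"
    using Gp_cong_relations val_eq_iff by (auto simp: wagner_relations_def)
qed

end

section \<open>The E-unitary congruence\<close>

text \<open>\<open>cells w\<close> is the subgraph of the Cayley graph of \<open>G\<close> obtained from the path labelled \<open>w\<close>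
  from 1 by attaching a loop for each relator at all vertices, repeatedly.  A vertex \<open>g\<close> is encoded
  as \<open>(g, None)\<close>; the edge labelled \<open>a\<close> starting in \<open>g\<close> as \<open>(g, Some a)\<close>, each edge being present
  in both directions.\<close>

context special_presentation
begin

section \<open>The prefix monoid as the values of concatenated relator prefixes\<close>

definition prefix_products :: "'x word set" where
  "prefix_products = concat ` lists {p. \<exists>i\<in>I. prefix p (r i)}"

abbreviation P where "P \<equiv> prefix_monoid X I r"

lemma prefix_products_words: "prefix_products \<subseteq> words X"
proof -
  have "concat ps \<in> words X" if "ps \<in> lists {p. \<exists>i\<in>I. prefix p (r i)}" for ps
    using that by (induction ps) (auto dest: words_prefix relator_words)
  then show ?thesis by (auto simp: prefix_products_def)
qed

lemma prefix_products_append: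
  assumes "v \<in> prefix_products" "w \<in> prefix_products"
  shows "v @ w \<in> prefix_products"
  using assms unfolding prefix_products_def by (auto intro!: image_eqI[of _ _ "_ @ _"])

lemma prefix_monoid_eq: "P = val ` prefix_products"
proof -
  let ?S = "{p. \<exists>i\<in>I. prefix p (r i)}"
  have words: "?S \<subseteq> words X" using words_prefix relator_words by blast
  have P: "P = submonoid_generated G (val ` ?S)"
    by (simp add: prefix_monoid_def relations_def Let_def)
  have "val (concat ps) \<in> H" if "submonoid H G" "val ` ?S \<subseteq> H" "ps \<in> lists ?S" for ps H
    using that(3)
  proof (induction ps)
    case Nil
    show ?case using submonoid.one_closed[OF that(1)] by simp
  next
    case (Cons p ps)
    then have "concat ps \<in> prefix_products" by (auto simp: prefix_products_def)
    then have "concat ps \<in> words X" "p \<in> words X" using prefix_products_words words Cons by auto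
    then show ?case using Cons that(2) submonoid.m_closed[OF that(1)] by (auto simp: val.h_append)
  qed
  then have 1: "val ` prefix_products \<subseteq> P"
    unfolding P submonoid_generated_def prefix_products_def by blast
  have "submonoid (val ` prefix_products) G"
  proof
    show "val ` prefix_products \<subseteq> carrier G" using prefix_products_words by auto
    show "\<one>\<^bsub>G\<^esub> \<in> val ` prefix_products"
      by (rule image_eqI[of _ _ "[]"]) (auto simp: prefix_products_def intro: image_eqI[of _ _ "[]"])
    fix x y assume "x \<in> val ` prefix_products" "y \<in> val ` prefix_products"
    then obtain v w where vw: "x = val v" "v \<in> prefix_products" "y = val w" "w \<in> prefix_products" by auto
    then have "v @ w \<in> prefix_products" by (intro prefix_products_append)
    with vw show "x \<otimes>\<^bsub>G\<^esub> y \<in> val ` prefix_products"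
      using prefix_products_words by (auto simp: val.h_append subset_iff intro!: image_eqI[of _ _ "v @ w"])
  qed
  moreover have "val ` ?S \<subseteq> val ` prefix_products"
  proof (rule image_mono, rule subsetI)
    fix p assume "p \<in> ?S"
    then show "p \<in> prefix_products"
      by (auto simp: prefix_products_def intro!: image_eqI[of _ _ "[p]"])
  qed
  ultimately have "P \<subseteq> val ` prefix_products"
    unfolding P submonoid_generated_def by blast
  with 1 show ?thesis by blast
qed

lemma P_closed: "P \<subseteq> carrier G"
  using prefix_products_words by (auto simp: prefix_monoid_eq)

lemma P_one: "\<one>\<^bsub>G\<^esub> \<in> P"
  unfolding prefix_monoid_eq
  by (rule image_eqI[of _ _ "[]"]) (auto simp: prefix_products_def intro: image_eqI[of _ _ "[]"])

lemma P_mult: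
  assumes "g \<in> P" "h \<in> P"
  shows "g \<otimes>\<^bsub>G\<^esub> h \<in> P"
proof -
  obtain v w where vw: "g = val v" "v \<in> prefix_products" "h = val w" "w \<in> prefix_products"
    using assms by (auto simp: prefix_monoid_eq)
  then have "g \<otimes>\<^bsub>G\<^esub> h = val (v @ w)"
    using prefix_products_words by (simp add: val.h_append subset_iff)
  with prefix_products_append vw show ?thesis by (auto simp: prefix_monoid_eq)
qed

lemma val_prefix_P: "i \<in> I \<Longrightarrow> prefix p (r i) \<Longrightarrow> val p \<in> P"
  unfolding prefix_monoid_eq prefix_products_def
  by (rule imageI, rule image_eqI[of _ _ "[p]"]) auto

section \<open>Subgraphs of the Cayley graph under concatenation, inversion and relators\<close>

definition shift :: "'x word set \<Rightarrow> ('x word set \<times> 'x letter option) set \<Rightarrow> ('x word set \<times> 'x letter option) set" where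
  "shift g S = (\<lambda>c. (g \<otimes>\<^bsub>G\<^esub> fst c, snd c)) ` S"

lemma shift_Un: "shift g (S \<union> T) = shift g S \<union> shift g T"
  and shift_UN: "shift g (\<Union>x\<in>A. F x) = (\<Union>x\<in>A. shift g (F x))"
  and shift_insert: "shift g (insert c S) = insert (g \<otimes>\<^bsub>G\<^esub> fst c, snd c) (shift g S)"
  and shift_empty: "shift g {} = {}"
  by (auto simp: shift_def)

lemma shift_shift:
  assumes "fst ` S \<subseteq> carrier G" "g \<in> carrier G" "h \<in> carrier G"
  shows "shift g (shift h S) = shift (g \<otimes>\<^bsub>G\<^esub> h) S"
proof -
  have "g \<otimes>\<^bsub>G\<^esub> (h \<otimes>\<^bsub>G\<^esub> fst c) = g \<otimes>\<^bsub>G\<^esub> h \<otimes>\<^bsub>G\<^esub> fst c" if "c \<in> S" for c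
    using that assms by (intro val.N.m_assoc[symmetric]) auto
  then show ?thesis unfolding shift_def image_image by (intro image_cong) auto
qed

lemma shift_one: "fst ` S \<subseteq> carrier G \<Longrightarrow> shift \<one>\<^bsub>G\<^esub> S = S"
  by (force simp: shift_def)

definition step_edges :: "'x letter \<Rightarrow> ('x word set \<times> 'x letter option) set" where
  "step_edges a = {(\<one>\<^bsub>G\<^esub>, Some a), (val [a], Some (inv_letter a))}"

text \<open>Attaching loops repeatedly, starting at 1, reaches exactly the vertices of
  \<open>P\<close>, since reading a relator prefix multiplies the vertex by a generator of
  \<open>P\<close>. Hence the closure is given in one step, by loops at all elements of
  \<open>P\<close>.\<close>

definition base_cells :: "('x word set \<times> 'x letter option) set" where
  "base_cells = (\<lambda>g. (g, None)) ` P \<union>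
     (\<Union>g\<in>P. \<Union>i\<in>I. \<Union>t. \<Union>b\<in>{b. prefix (t @ [b]) (r i)}. shift (g \<otimes>\<^bsub>G\<^esub> val t) (step_edges b))"

fun cells :: "'x word \<Rightarrow> ('x word set \<times> 'x letter option) set" where
  "cells [] = base_cells"
| "cells (a # w) = base_cells \<union> step_edges a \<union> shift (val [a]) (cells w)"

lemma step_edges_closed: "fst a \<in> X \<Longrightarrow> fst ` step_edges a \<subseteq> carrier G"
  by (auto simp: step_edges_def)

lemma shift_closed: "g \<in> carrier G \<Longrightarrow> fst ` S \<subseteq> carrier G \<Longrightarrow> fst ` shift g S \<subseteq> carrier G"
  by (auto simp: shift_def)

lemma relator_prefixD: 
  assumes "prefix (t @ [b]) (r i)" "i \<in> I"
  shows "t \<in> words X" "fst b \<in> X"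
  using words_prefix[OF assms(1) relator_words[OF assms(2)]] by auto

lemma base_cells_closed: "fst ` base_cells \<subseteq> carrier G"
proof -
  have "fst ` shift (g \<otimes>\<^bsub>G\<^esub> val t) (step_edges b) \<subseteq> carrier G"
    if "g \<in> P" "i \<in> I" "prefix (t @ [b]) (r i)" for g i t b
    using that relator_prefixD[OF that(3,2)] P_closed by (intro shift_closed step_edges_closed) auto
  moreover have "fst ` (\<lambda>g. (g, None)) ` P \<subseteq> carrier G" using P_closed by auto
  ultimately show ?thesis
    unfolding base_cells_def image_Un image_UN by (intro Un_least UN_least) blast+
qed

lemma cells_closed: "w \<in> words X \<Longrightarrow> fst ` cells w \<subseteq> carrier G"
  by (induction w) (simp_all add: image_Un base_cells_closed step_edges_closed shift_closed)

lemma shift_base_cells: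
  assumes "g \<in> P"
  shows "shift g base_cells \<subseteq> base_cells"
proof -
  have "shift g (shift (h \<otimes>\<^bsub>G\<^esub> val t) (step_edges b)) \<subseteq> base_cells"
    if "h \<in> P" "i \<in> I" "prefix (t @ [b]) (r i)" for h i t b
  proof -
    have "g \<in> carrier G" "h \<in> carrier G" "t \<in> words X" "fst b \<in> X"
      using that assms P_closed relator_prefixD[OF that(3,2)] by auto
    then have "shift g (shift (h \<otimes>\<^bsub>G\<^esub> val t) (step_edges b)) = shift ((g \<otimes>\<^bsub>G\<^esub> h) \<otimes>\<^bsub>G\<^esub> val t) (step_edges b)"
      by (subst shift_shift) (use step_edges_closed in \<open>auto simp: val.N.m_assoc\<close>)
    also have "\<dots> \<subseteq> base_cells"
      unfolding base_cells_def using P_mult[OF assms that(1)] that(2,3) by blast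
    finally show ?thesis .
  qed
  moreover have "shift g ((\<lambda>g. (g, None)) ` P) \<subseteq> base_cells"
    using P_mult[OF assms] by (auto simp: shift_def base_cells_def)
  ultimately show ?thesis
    by (subst base_cells_def, unfold shift_Un shift_UN, intro Un_least UN_least) blast+
qed

lemma cells_base: "base_cells \<subseteq> cells w"
  by (cases w) auto

lemma cells_append:
  "v \<in> words X \<Longrightarrow> w \<in> words X \<Longrightarrow> cells (v @ w) = cells v \<union> shift (val v) (cells w)"
proof (induction v)
  case Nil
  then show ?case using cells_base[of w] cells_closed by (auto simp: shift_one)
next
  case (Cons a v)
  then have "shift (val [a]) (shift (val v) (cells w)) = shift (val (a # v)) (cells w)"
    using cells_closed val_Cons[of a v] by (subst shift_shift) auto
  with Cons show ?case by (auto simp: shift_Un)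
qed

lemma cells_shift_base: "w \<in> words X \<Longrightarrow> shift (val w) base_cells \<subseteq> cells w"
  using cells_append[of w "[]"] by auto

lemma shift_step_edges_inv:
  assumes "fst a \<in> X"
  shows "shift (val [inv_letter a]) (step_edges a) = step_edges (inv_letter a)"
  using val_letter_inv[of "inv_letter a"] assms by (auto simp: shift_insert shift_empty step_edges_def)

text \<open>The path labelled w^-1 from 1 is the path labelled w, translated so as to end in 1 and
  traversed backwards. Edges are stored in both directions, so the orientation leaves no
  trace.\<close>

lemma cells_inv_word: "w \<in> words X \<Longrightarrow> cells (inv_word w) = shift (val (inv_word w)) (cells w)"
proof (induction w)
  case Nil
  then show ?case using base_cells_closed by (simp add: shift_one)
next
  case (Cons a w)
  let ?w = "val (inv_word w)" and ?a = "val [inv_letter a]"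
  have w: "w \<in> words X" "fst a \<in> X" using Cons by auto
  have a: "?a \<otimes>\<^bsub>G\<^esub> val [a] = \<one>\<^bsub>G\<^esub>" using val_letter_inv[of "inv_letter a"] w by simp
  have "shift (?w \<otimes>\<^bsub>G\<^esub> ?a) (shift (val [a]) (cells w)) = shift ?w (cells w)"
    using w a cells_closed by (subst shift_shift) (auto simp: val.N.m_assoc)
  moreover have "shift (?w \<otimes>\<^bsub>G\<^esub> ?a) (step_edges a) = shift ?w (step_edges (inv_letter a))"
    using w by (subst shift_step_edges_inv[symmetric]) (simp_all add: shift_shift step_edges_closed)
  moreover have "shift (?w \<otimes>\<^bsub>G\<^esub> ?a) base_cells = shift ?w (shift ?a base_cells)"
    using w base_cells_closed by (intro shift_shift[symmetric]) auto
  moreover have "shift ?w base_cells \<subseteq> cells (inv_word w)" using w by (intro cells_shift_base) auto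
  ultimately show ?case
    using w Cons by (auto simp: cells_append val.h_append shift_Un)
qed

lemma cells_append_inv_word: "w \<in> words X \<Longrightarrow> cells (w @ inv_word w) = cells w"
  using val_mult_inv_word cells_closed
  by (simp add: cells_append cells_inv_word shift_shift shift_one)

text \<open>Each prefix of a relator ends at a vertex of \<open>P\<close>, by which translation maps
  \<open>base_cells\<close> into itself, and the edges passed belong to the loop at 1.\<close>

lemma cells_relator:
  assumes "i \<in> I"
  shows "cells (r i) = base_cells"
proof -
  have "cells p \<subseteq> base_cells" if "prefix p (r i)" for p
    using that
  proof (induction p rule: rev_induct)
    case (snoc b p)
    have p: "prefix p (r i)" using snoc.prems by (auto simp: prefix_def)
    have pb: "p \<in> words X" "fst b \<in> X" using relator_prefixD[OF snoc.prems assms] by auto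
    have "shift (val p) (step_edges b) = shift (\<one>\<^bsub>G\<^esub> \<otimes>\<^bsub>G\<^esub> val p) (step_edges b)" using pb by simp
    also have "\<dots> \<subseteq> base_cells" unfolding base_cells_def using P_one assms snoc.prems by blast
    finally have 1: "shift (val p) (step_edges b) \<subseteq> base_cells" .
    have "shift (val p) (shift (val [b]) base_cells) = shift (val (p @ [b])) base_cells"
      using pb base_cells_closed by (subst shift_shift) (auto simp: val.h_append)
    also have "\<dots> \<subseteq> base_cells" by (rule shift_base_cells) (rule val_prefix_P[OF assms snoc.prems])
    finally have 2: "shift (val p) (shift (val [b]) base_cells) \<subseteq> base_cells" .
    show ?case
      using snoc.IH[OF p] 1 2 shift_base_cells[OF val_prefix_P[OF assms p]] pb
      by (auto simp: cells_append shift_Un)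
  qed simp
  from this[of "r i"] cells_base[of "r i"] show ?thesis by auto
qed

definition cell_cong :: "('x word \<times> 'x word) set" where
  "cell_cong = {(v, w). v \<in> words X \<and> w \<in> words X \<and> val v = val w \<and> cells v = cells w}"

lemma cell_cong_congruence: "monoid_congruence (free_monoid X) cell_cong"
  by (rule monoid_congruenceI) (auto simp: cell_cong_def val.h_append cells_append)

text \<open>The word w w^-1 has value 1 and the cells of w, and words of value 1 multiply by union
  of their cells. Both kinds of Wagner's relations follow.\<close>

lemma Inv_cong_subset_cell_cong: "Inv_cong X relations \<subseteq> cell_cong"
proof (rule Inv_cong_least[OF cell_cong_congruence])
  have val: "val v = val w" if "(v, w) \<in> wagner_relations X \<union> relations" for v w
    using that Inv_cong_relations Inv_cong_subset_Gp_cong wagner_relations_words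
    by (subst val_eq_iff) blast+
  have "cells v = cells w" if "(v, w) \<in> wagner_relations X \<union> relations" for v w
  proof -
    have 1: "cells (w @ inv_word w @ w) = cells w" if "w \<in> words X" for w
      using that cells_append[of "w @ inv_word w" w] cells_closed[of w]
      by (simp add: cells_append_inv_word val.h_append val_mult_inv_word shift_one)
    have 2: "cells (w @ inv_word w @ v @ inv_word v) = cells w \<union> cells v"
      if "w \<in> words X" "v \<in> words X" for v w
      using that cells_append[of "w @ inv_word w" "v @ inv_word v"] cells_closed[of v]
      by (simp add: cells_append_inv_word val.h_append val_mult_inv_word shift_one)
    show ?thesis
      using that 1 2 cells_relator unfolding wagner_relations_def relations_def
      by (elim UnE CollectE exE conjE imageE) (simp_all add: Un_commute)
  qed
  with val show "wagner_relations X \<union> relations \<subseteq> cell_cong"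
    using wagner_relations_words unfolding cell_cong_def by blast
qed

lemma val_in_cells: "w \<in> words X \<Longrightarrow> (val w, None) \<in> cells w"
  using cells_shift_base[of w] P_one
  by (force simp: base_cells_def shift_def image_Un)

lemma edge_in_cells:
  assumes "v \<in> words X" "prefix (q @ [a]) v"
  shows "(val q, Some a) \<in> cells v"
proof -
  obtain s where v: "v = q @ a # s" using assms(2) by (auto simp: prefix_def)
  have "shift (val q) (step_edges a) \<subseteq> cells v" using assms unfolding v by (simp add: cells_append shift_Un) blast
  then show ?thesis using assms v by (auto simp: step_edges_def shift_insert)
qed

lemma vertex_base_cells: "(g, None) \<in> base_cells \<longleftrightarrow> g \<in> P"
  by (auto simp: base_cells_def shift_def step_edges_def)

text \<open>If w inverts u in M, then u w and w u have the cells of the empty word, whose vertices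
  are \<open>P\<close>. The first path visits the end of every prefix of u, the second one the value
  of w, which is that of u^-1 in G.\<close>

lemma unit_prefix_P:
  assumes u: "u \<in> words X" "mval u \<in> Units (Inv X relations)" and "prefix p u"
  shows "val p \<in> P" "val (inv_word u) \<in> P"
proof -
  obtain w where w: "w \<in> words X" "mval (u @ w) = mval []" "mval (w @ u) = mval []"
    using u by (auto simp: Units_def mval.carrier_eq mval.h_append)
  then have uw: "(u @ w, []) \<in> cell_cong" "(w @ u, []) \<in> cell_cong"
    using u Inv_cong_subset_cell_cong mval_eq_iff[of _ "[]"] by auto
  obtain s where s: "u = p @ s" using assms(3) by (auto simp: prefix_def)
  have "(val p, None) \<in> cells (p @ s @ w)"
    using val_in_cells[of p] u w by (simp add: s cells_append)
  with uw s show "val p \<in> P" by (auto simp: cell_cong_def vertex_base_cells)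
  have "(val w, None) \<in> cells (w @ u)" using val_in_cells[of w] u w by (simp add: cells_append)
  with uw have "val w \<in> P" by (auto simp: cell_cong_def vertex_base_cells)
  moreover have "val w \<otimes>\<^bsub>G\<^esub> val u = \<one>\<^bsub>G\<^esub>" using uw u w by (simp add: cell_cong_def val.h_append)
  then have "val w = val (inv_word u)"
    using u w by (simp add: val_inv_word G.inv_equality)
  ultimately show "val (inv_word u) \<in> P" by simp
qed

end

section \<open>Idempotents in images that satisfy Wagner's relations\<close>

locale inverse_word_hom = word_hom +
  assumes h_wagner: "w \<in> words X \<Longrightarrow> h (w @ inv_word w @ w) = h w"
    and h_wagner_commute: "v \<in> words X \<Longrightarrow> w \<in> words X \<Longrightarrow>
      h (w @ inv_word w @ v @ inv_word v) = h (v @ inv_word v @ w @ inv_word w)"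
begin

text \<open>The idempotent w w^-1. That e lies below it in the natural order is written
  \<open>e \<otimes> D w = e\<close> in what follows.\<close>

definition D where "D w = h w \<otimes> h (inv_word w)"

lemma D_closed [simp]: "w \<in> words X \<Longrightarrow> D w \<in> carrier N"
  by (simp add: D_def)

lemma D_commute: "v \<in> words X \<Longrightarrow> w \<in> words X \<Longrightarrow> D v \<otimes> D w = D w \<otimes> D v"
  using h_wagner_commute[of w v] by (simp add: D_def h_append N.m_assoc)

lemma D_h: "w \<in> words X \<Longrightarrow> D w \<otimes> h w = h w"
  using h_wagner[of w] by (simp add: D_def h_append N.m_assoc)

lemma h_inv_D: "w \<in> words X \<Longrightarrow> h (inv_word w) \<otimes> D w = h (inv_word w)"
  using h_wagner[of "inv_word w"] by (simp add: D_def h_append N.m_assoc)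

lemma D_idem: "w \<in> words X \<Longrightarrow> D w \<otimes> D w = D w"
  using D_h[of w] by (simp add: D_def N.m_assoc[symmetric])

lemma D_append:
  assumes "v \<in> words X" "w \<in> words X"
  shows "D (v @ w) = h v \<otimes> D w \<otimes> h (inv_word v)"
  using assms by (simp add: D_def h_append N.m_assoc)

lemma h_D: "w \<in> words X \<Longrightarrow> h w \<otimes> D (inv_word w) = h w"
  using h_inv_D[of "inv_word w"] by simp

lemma D_append_D:
  assumes "v \<in> words X" "w \<in> words X"
  shows "D (v @ w) \<otimes> D v = D (v @ w)"
  using assms h_inv_D[of v] by (simp add: D_append N.m_assoc)

text \<open>Wagner's relations only state that idempotents of the form w w^-1 commute. Writing other
  idempotents as products of these extends commutation to them.\<close>

lemma idempotent_eq_D: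
  assumes t: "t \<in> words X" and "h t \<otimes> h t = h t" "h (inv_word t) \<otimes> h (inv_word t) = h (inv_word t)"
  shows "h t = D t \<otimes> D (inv_word t)"
proof -
  have "D t \<otimes> D (inv_word t) = h t \<otimes> (h (inv_word t) \<otimes> h (inv_word t)) \<otimes> h t"
    using t by (simp add: D_def N.m_assoc)
  also have "\<dots> = h t" using assms h_wagner[of t] by (simp add: h_append N.m_assoc)
  finally show ?thesis by simp
qed

lemma idempotents_commute:
  assumes t: "t \<in> words X" "h t = D t \<otimes> D (inv_word t)"
    and u: "u \<in> words X" "h u = D u \<otimes> D (inv_word u)"
  shows "h t \<otimes> h u = h u \<otimes> h t"
proof -
  have *: "D v \<otimes> (D u \<otimes> D (inv_word u)) = (D u \<otimes> D (inv_word u)) \<otimes> D v" if "v \<in> words X" for v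
  proof -
    have "D v \<otimes> (D u \<otimes> D (inv_word u)) = D u \<otimes> (D v \<otimes> D (inv_word u))"
      using that u D_commute[of u v] by (simp add: N.m_assoc[symmetric])
    also have "\<dots> = D u \<otimes> (D (inv_word u) \<otimes> D v)"
      using that u D_commute[of v "inv_word u"] by simp
    finally show ?thesis using that u by (simp add: N.m_assoc)
  qed
  let ?u = "D u \<otimes> D (inv_word u)" and ?t = "D t" and ?t' = "D (inv_word t)"
  have c: "?u \<in> carrier N" "?t \<in> carrier N" "?t' \<in> carrier N" using t u by auto
  have "?t \<otimes> ?t' \<otimes> ?u = ?t \<otimes> (?u \<otimes> ?t')" using *[of "inv_word t"] t c by (simp only: N.m_assoc words_inv_word)
  also have "\<dots> = ?u \<otimes> (?t \<otimes> ?t')" using *[of t] t c by (simp only: N.m_assoc[symmetric])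
  finally show ?thesis by (simp only: t(2) u(2))
qed

end

text \<open>If all words representing 1 in \<open>G\<close> are idempotent in the quotient, then a word is
  determined there, below a given idempotent, by its value in \<open>G\<close>.\<close>

locale E_unitary_word_hom = inverse_word_hom + special_presentation X I r
  for I :: "'i set" and r +
  assumes h_relator: "i \<in> I \<Longrightarrow> h (r i) = \<one>"
    and h_idempotent: "t \<in> words X \<Longrightarrow> val t = \<one>\<^bsub>Gp X relations\<^esub> \<Longrightarrow> h t \<otimes> h t = h t"
begin

lemma h_val_1:
  assumes "t \<in> words X" "val t = \<one>\<^bsub>Gp X relations\<^esub>"
  shows "h t = D t \<otimes> D (inv_word t)"
  using assms by (intro idempotent_eq_D h_idempotent) (auto simp: val_inv_word)

text \<open>With f = q^-1 p and f' = p^-1 q, multiplication by f turns e q into e p, and f' turns it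
  back. Both have value 1 in G, so they are commuting idempotents, and commuting idempotents that
  move two elements to each other force these to be equal.\<close>

lemma h_eq_below:
  assumes e: "e \<in> carrier N" and p: "p \<in> words X" "e \<otimes> D p = e" and q: "q \<in> words X" "e \<otimes> D q = e"
    and pq: "val p = val q"
  shows "e \<otimes> h p = e \<otimes> h q"
proof -
  have le: "e \<otimes> h v \<otimes> h (inv_word v @ w) = e \<otimes> h w" if "v \<in> words X" "w \<in> words X" "e \<otimes> D v = e" for v w
  proof -
    have "e \<otimes> h v \<otimes> h (inv_word v @ w) = e \<otimes> D v \<otimes> h w"
      using that(1,2) e by (simp add: D_def h_append N.m_assoc)
    with that show ?thesis by simp
  qed
  define f f' where "f = h (inv_word q @ p)" and "f' = h (inv_word p @ q)"
  have f: "f \<in> carrier N" "f' \<in> carrier N" using p q by (auto simp: f_def f'_def)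
  have v1: "val (inv_word q @ p) = \<one>\<^bsub>Gp X relations\<^esub>" "val (inv_word p @ q) = \<one>\<^bsub>Gp X relations\<^esub>"
    using p q pq by (simp_all add: val.h_append val_inv_word)
  then have ff: "f \<otimes> f = f" "f \<otimes> f' = f' \<otimes> f"
    unfolding f_def f'_def using p q
    by (auto intro!: h_idempotent idempotents_commute h_val_1)
  let ?a = "e \<otimes> h p" and ?b = "e \<otimes> h q"
  have c: "?a \<in> carrier N" "?b \<in> carrier N" using e p q by auto
  have 1: "?b \<otimes> f = ?a" "?a \<otimes> f' = ?b" using le p q by (auto simp: f_def f'_def)
  have "?a = ?b \<otimes> f" using 1 by simp
  also have "\<dots> = ?a \<otimes> f' \<otimes> f" using 1 by simp
  also have "\<dots> = ?a \<otimes> f \<otimes> f'" using ff c f by (simp add: N.m_assoc)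
  also have "?a \<otimes> f = ?a" using 1 ff c f by (metis N.m_assoc)
  finally show ?thesis using 1 by simp
qed

lemma D_le_append:
  assumes "e \<in> carrier N" "p \<in> words X" "w \<in> words X" "e \<otimes> D (p @ w) = e"
  shows "e \<otimes> D p = e"
  using assms D_append_D[of p w] by (metis D_closed N.m_assoc words_append)

text \<open>Whether w can be read below e depends only on the vertex from which it is read, not on
  the path leading there.\<close>

lemma D_extend:
  assumes e: "e \<in> carrier N" and p: "p \<in> words X" "w \<in> words X" "e \<otimes> D (p @ w) = e"
    and q: "q \<in> words X" "e \<otimes> D q = e" and pq: "val p = val q"
  shows "e \<otimes> D (q @ w) = e"
proof -
  have ep: "e \<otimes> D p = e" using D_le_append[OF e p] .
  have eq: "e \<otimes> h p = e \<otimes> h q" by (rule h_eq_below) (use assms ep in auto)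
  let ?p = "h p" and ?p' = "h (inv_word p)" and ?q = "h q" and ?q' = "h (inv_word q)"
  have c: "?p \<in> carrier N" "?p' \<in> carrier N" "?q \<in> carrier N" "?q' \<in> carrier N" "D w \<in> carrier N"
    using p q by auto
  have "e \<otimes> D (q @ w) = e \<otimes> ?q \<otimes> D w \<otimes> ?q'" using e p q by (simp add: D_append N.m_assoc)
  also have "\<dots> = e \<otimes> ?p \<otimes> D w \<otimes> ?q'" using eq by simp
  \<comment> \<open>Inserting p^-1 p behind p and moving it past \<open>D w\<close> restores the
    full conjugate \<open>D (p @ w)\<close>, which e absorbs.\<close>
  also have "\<dots> = e \<otimes> (?p \<otimes> D (inv_word p)) \<otimes> D w \<otimes> ?q'" using h_D p by simp
  also have "\<dots> = e \<otimes> ?p \<otimes> (D (inv_word p) \<otimes> D w) \<otimes> ?q'" using e c p by (simp add: N.m_assoc)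
  also have "D (inv_word p) \<otimes> D w = D w \<otimes> D (inv_word p)" by (rule D_commute) (use p in auto)
  also have "e \<otimes> ?p \<otimes> (D w \<otimes> D (inv_word p)) \<otimes> ?q' = e \<otimes> D (p @ w) \<otimes> ?p \<otimes> ?q'"
    using e c p(1,2) by (simp add: D_def[of "inv_word p"] D_append N.m_assoc)
  also have "\<dots> = e \<otimes> ?q \<otimes> ?q'" using p eq by simp
  also have "\<dots> = e" using q e by (simp add: D_def N.m_assoc)
  finally show ?thesis .
qed

text \<open>A relator prefix p has the rest s of the relator as a right inverse. Since p p^-1 fixes
  p, it fixes p s = 1.\<close>

lemma D_prefix_product: "w \<in> prefix_products \<Longrightarrow> D w = \<one>"
proof -
  have "D (concat ps) = \<one>" if "ps \<in> lists {p. \<exists>i\<in>I. prefix p (r i)}" for ps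
    using that
  proof (induction ps)
    case Nil
    show ?case by (simp add: D_def)
  next
    case (Cons p ps)
    then obtain i s where i: "i \<in> I" "r i = p @ s" by (auto simp: prefix_def)
    have ps: "p \<in> words X" "s \<in> words X" using relator_words[OF i(1)] i(2) by auto
    have "concat ps \<in> words X"
      using Cons prefix_products_words by (auto simp: prefix_products_def)
    moreover have "D p = \<one>"
    proof -
      have 1: "h p \<otimes> h s = \<one>" using h_relator[OF i(1)] i ps by (simp add: h_append)
      have "D p = D p \<otimes> (h p \<otimes> h s)" using 1 ps by simp
      also have "\<dots> = D p \<otimes> h p \<otimes> h s" using ps by (simp add: N.m_assoc)
      finally show ?thesis using 1 ps D_h by simp
    qed
    ultimately show ?case using Cons.IH ps by (simp add: D_append) (simp add: D_def)
  qed
  then show "w \<in> prefix_products \<Longrightarrow> D w = \<one>" by (auto simp: prefix_products_def)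
qed

text \<open>The cells on paths from 1 whose label \<open>p\<close> satisfies \<open>e \<le> p p\<^sup>-\<^sup>1\<close> in the natural order.\<close>

definition real_cells where
  "real_cells e = {(val p, None) | p. p \<in> words X \<and> e \<otimes> D p = e} \<union>
     {(val p, Some a) | p a. p @ [a] \<in> words X \<and> e \<otimes> D (p @ [a]) = e}"

lemma D_append_inv_word: "w \<in> words X \<Longrightarrow> D (w @ inv_word w) = D w"
  using D_idem[of w] by (simp add: D_append) (simp add: D_def N.m_assoc)

lemma step_edges_real:
  assumes "q @ [b] \<in> words X" "e \<otimes> D (q @ [b]) = e"
  shows "shift (val q) (step_edges b) \<subseteq> real_cells e"
proof -
  have "D (q @ [b] @ inv_word [b]) = D (q @ [b])"
    using assms D_append_inv_word[of "[b]"] D_append[of q "[b] @ inv_word [b]"] D_append[of q "[b]"] by simp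
  then have "e \<otimes> D ((q @ [b]) @ [inv_letter b]) = e" using assms by simp
  moreover have "(q @ [b]) @ [inv_letter b] \<in> words X" using assms by simp
  ultimately have "(val (q @ [b]), Some (inv_letter b)) \<in> real_cells e" "(val q, Some b) \<in> real_cells e"
    using assms unfolding real_cells_def by blast+
  with assms show ?thesis by (simp add: step_edges_def shift_insert shift_empty val.h_append)
qed

text \<open>By \<open>D_prefix_product\<close>, prolonging p by a prefix product does not change
  \<open>D p\<close>, so the loops attached at \<open>val p\<close> can be read below e as
  well.\<close>

lemma base_cells_real:
  assumes "e \<in> carrier N" "p \<in> words X" "e \<otimes> D p = e"
  shows "shift (val p) base_cells \<subseteq> real_cells e"
proof -
  have D: "s \<in> words X" "e \<otimes> D (p @ s) = e" if "s \<in> prefix_products" for s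
  proof -
    show s: "s \<in> words X" using that prefix_products_words by blast
    have "D (p @ s) = D p"
      using D_append[of p s] D_prefix_product[OF that] s assms by (simp add: D_def)
    with assms show "e \<otimes> D (p @ s) = e" by simp
  qed
  have "shift (val p) ((\<lambda>g. (g, None)) ` P) \<subseteq> real_cells e"
  proof -
    have "(val p \<otimes>\<^bsub>Gp X relations\<^esub> val s, None) \<in> real_cells e" if "s \<in> prefix_products" for s
    proof -
      have "(val (p @ s), None) \<in> real_cells e" using D[OF that] assms unfolding real_cells_def by auto
      with D[OF that] assms show ?thesis by (simp add: val.h_append)
    qed
    then show ?thesis by (auto simp: shift_def prefix_monoid_eq)
  qed
  moreover have "shift (val p) (shift (g \<otimes>\<^bsub>Gp X relations\<^esub> val t) (step_edges b)) \<subseteq> real_cells e"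
    if g: "g \<in> P" and b: "i \<in> I" "b \<in> {b. prefix (t @ [b]) (r i)}" for g i t b
  proof -
    obtain s where s: "s \<in> prefix_products" "g = val s" using g by (auto simp: prefix_monoid_eq)
    have "t @ [b] \<in> prefix_products"
      using b unfolding prefix_products_def by (intro image_eqI[of _ _ "[t @ [b]]"]) auto
    with s have st: "s @ t @ [b] \<in> prefix_products" by (rule_tac prefix_products_append)
    have w: "s \<in> words X" "t \<in> words X" "fst b \<in> X" using D(1)[OF st] by auto
    have "shift (val p) (shift (g \<otimes>\<^bsub>Gp X relations\<^esub> val t) (step_edges b)) = shift (val (p @ s @ t)) (step_edges b)"
      using w assms step_edges_closed by (subst shift_shift) (simp_all add: s val.h_append val.N.m_assoc)
    also have "\<dots> \<subseteq> real_cells e" using D[OF st] w assms by (intro step_edges_real) auto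
    finally show ?thesis .
  qed
  ultimately show ?thesis
    unfolding base_cells_def shift_Un shift_UN by (intro Un_least UN_least) blast+
qed

lemma cells_real:
  assumes "e \<in> carrier N"
  shows "p \<in> words X \<Longrightarrow> w \<in> words X \<Longrightarrow> e \<otimes> D (p @ w) = e \<Longrightarrow> shift (val p) (cells w) \<subseteq> real_cells e"
proof (induction w arbitrary: p)
  case Nil
  then show ?case using base_cells_real[OF assms] by simp
next
  case (Cons a w)
  then have pa: "(p @ [a]) @ w \<in> words X" "e \<otimes> D ((p @ [a]) @ w) = e" by auto
  then have 1: "e \<otimes> D (p @ [a]) = e" by (intro D_le_append[OF assms, of "p @ [a]" w]) auto
  then have 2: "e \<otimes> D p = e" using pa by (intro D_le_append[OF assms, of p "[a]"]) auto
  have "shift (val p) (shift (val [a]) (cells w)) = shift (val (p @ [a])) (cells w)"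
    using pa cells_closed[of w] by (subst shift_shift) (auto simp: val.h_append)
  also have "\<dots> \<subseteq> real_cells e" using Cons.IH[of "p @ [a]"] pa by simp
  finally show ?case
    using step_edges_real[OF _ 1] base_cells_real[OF assms _ 2] Cons.prems by (simp add: shift_Un)
qed

text \<open>The prefix is followed edge by edge. An edge in \<open>cells w\<close> can be read below
  \<open>D w\<close> after some word with the same value as q, and \<open>D_extend\<close> transfers
  this to q.\<close>

lemma D_le_prefix:
  assumes vw: "v \<in> words X" "w \<in> words X"
    and edges: "\<And>q a. prefix (q @ [a]) v \<Longrightarrow> (val q, Some a) \<in> cells w" and "prefix q v"
  shows "D w \<otimes> D q = D w"
  using assms(4)
proof (induction q rule: rev_induct)
  case Nil
  show ?case using vw by (simp add: D_def[of "[]"])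
next
  case (snoc a q)
  have q: "q @ [a] \<in> words X" using words_prefix[OF snoc.prems vw(1)] .
  have pq: "prefix q v" using snoc.prems by (auto simp: prefix_def)
  have "shift (val []) (cells w) \<subseteq> real_cells (D w)"
    using vw D_idem[of w] by (intro cells_real) auto
  then have "cells w \<subseteq> real_cells (D w)" using cells_closed[of w] vw by (simp add: shift_one)
  then have "(val q, Some a) \<in> real_cells (D w)" using edges[OF snoc.prems] by blast
  then obtain p where p: "val p = val q" "p @ [a] \<in> words X" "D w \<otimes> D (p @ [a]) = D w"
    by (auto simp: real_cells_def)
  show ?case by (rule D_extend[of "D w" p]) (use p q vw snoc.IH[OF pq] in auto)
qed

text \<open>Each path can be read below the idempotent of the other, so \<open>D v\<close> and
  \<open>D w\<close> agree; below this common idempotent the value in G decides.\<close>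

lemma h_eq_if_edges:
  assumes vw: "v \<in> words X" "w \<in> words X" "val v = val w"
    and edges: "\<And>q a. prefix (q @ [a]) v \<Longrightarrow> (val q, Some a) \<in> cells w"
      "\<And>q a. prefix (q @ [a]) w \<Longrightarrow> (val q, Some a) \<in> cells v"
  shows "h v = h w"
proof -
  have 1: "D w \<otimes> D v = D w" "D v \<otimes> D w = D v"
    by (rule D_le_prefix[OF vw(1,2) edges(1)], auto) (rule D_le_prefix[OF vw(2,1) edges(2)], auto)
  then have "D w \<otimes> h v = D w \<otimes> h w"
    by (intro h_eq_below) (use vw D_idem in auto)
  moreover have "D w = D v" using 1 D_commute[of v w] vw by simp
  ultimately show ?thesis using D_h[of v] D_h[of w] vw by simp
qed

lemma cell_cong_h:
  assumes "(v, w) \<in> cell_cong"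
  shows "h v = h w"
  by (rule h_eq_if_edges) (use assms edge_in_cells[of v] edge_in_cells[of w] in \<open>auto simp: cell_cong_def\<close>)

end


section \<open>Transport of congruences between words and their images\<close>

context word_hom
begin

lemma pullback_congruence:
  assumes "monoid_congruence N s"
  shows "monoid_congruence (free_monoid X) {(v, w). v \<in> words X \<and> w \<in> words X \<and> (h v, h w) \<in> s}"
  by (rule monoid_congruenceI)
    (auto simp: h_append monoid_congruenceD(3)[OF assms]
      intro: monoid_congruenceD(4)[OF assms] dest: monoid_congruenceD(6)[OF assms] monoid_congruenceD(5)[OF assms])

text \<open>As t contains the kernel of h, membership in t does not depend on the words chosen to
  represent two elements.\<close>

lemma pushforward_congruence:
  assumes t: "monoid_congruence (free_monoid X) t"
    and ker: "\<And>v w. v \<in> words X \<Longrightarrow> w \<in> words X \<Longrightarrow> h v = h w \<Longrightarrow> (v, w) \<in> t"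
  defines "s \<equiv> (\<lambda>(v, w). (h v, h w)) ` t"
  shows "monoid_congruence N s"
    and "\<And>v w. v \<in> words X \<Longrightarrow> w \<in> words X \<Longrightarrow> (h v, h w) \<in> s \<longleftrightarrow> (v, w) \<in> t"
proof -
  note tD = monoid_congruenceD[OF t, simplified]
  show iff: "(h v, h w) \<in> s \<longleftrightarrow> (v, w) \<in> t" if "v \<in> words X" "w \<in> words X" for v w
  proof
    assume "(h v, h w) \<in> s"
    then obtain v' w' where vw': "h v = h v'" "h w = h w'" "(v', w') \<in> t" by (auto simp: s_def)
    then have "v' \<in> words X" "w' \<in> words X" using tD(2) by auto
    then have "(v, v') \<in> t" "(w', w) \<in> t" using ker vw' that by auto
    with vw' tD(5) show "(v, w) \<in> t" by blast
  qed (auto simp: s_def)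
  have ex: "\<exists>v w. v \<in> words X \<and> w \<in> words X \<and> a = h v \<and> b = h w \<and> (v, w) \<in> t" if ab: "(a, b) \<in> s" for a b
  proof -
    obtain v w where "(v, w) \<in> t" "a = h v" "b = h w" using ab by (auto simp: s_def)
    with tD(2) show ?thesis by blast
  qed
  show "monoid_congruence N s"
  proof (rule monoid_congruenceI)
    show "s \<subseteq> carrier N \<times> carrier N" using tD(2) by (auto simp: s_def)
    show "(a, a) \<in> s" if "a \<in> carrier N" for a using that iff tD(3) by (auto simp: carrier_eq)
    show "(b, a) \<in> s" if "(a, b) \<in> s" for a b using ex[OF that] iff tD(4) by blast
    show "(a, c) \<in> s" if ab: "(a, b) \<in> s" and bc: "(b, c) \<in> s" for a b c
    proof -
      obtain u v where 1: "u \<in> words X" "v \<in> words X" "a = h u" "b = h v" "(u, v) \<in> t" using ex[OF ab] by blast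
      obtain v' w where 2: "v' \<in> words X" "w \<in> words X" "b = h v'" "c = h w" "(v', w) \<in> t" using ex[OF bc] by blast
      have "(v, v') \<in> t" using ker 1 2 by auto
      with 1 2 tD(5) have "(u, w) \<in> t" by blast
      with 1 2 iff show ?thesis by blast
    qed
    show "(a \<otimes> c, b \<otimes> d) \<in> s" if ab: "(a, b) \<in> s" and cd: "(c, d) \<in> s" for a b c d
    proof -
      obtain u v where 1: "u \<in> words X" "v \<in> words X" "a = h u" "b = h v" "(u, v) \<in> t" using ex[OF ab] by blast
      obtain u' v' where 2: "u' \<in> words X" "v' \<in> words X" "c = h u'" "d = h v'" "(u', v') \<in> t" using ex[OF cd] by blast
      have "(u @ u', v @ v') \<in> t" using tD(6) 1 2 by blast
      then have "(h (u @ u'), h (v @ v')) \<in> s" using iff 1 2 by simp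
      with 1 2 show ?thesis by (simp add: h_append)
    qed
  qed
qed

end

section \<open>E-unitary quotients and the congruence of equal values and cells\<close>

context special_presentation
begin

text \<open>In a group quotient of N the relation a a^-1 a = a cancels to a a^-1 = 1, so each such
  quotient is a quotient of G too. A word trivial in G is therefore mapped to 1 in the maximal group
  image.\<close>

lemma E_unitary_idempotent:
  assumes "inverse_word_hom N X h" "\<And>i. i \<in> I \<Longrightarrow> h (r i) = \<one>\<^bsub>N\<^esub>" "E_unitary N"
    and t: "t \<in> words X" "val t = \<one>\<^bsub>G\<^esub>"
  shows "h t \<otimes>\<^bsub>N\<^esub> h t = h t"
proof -
  interpret N: inverse_word_hom N X h by fact
  have rel: "(h t, \<one>\<^bsub>N\<^esub>) \<in> s" if s: "monoid_congruence N s" "group (quotient_monoid N s)" for s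
  proof -
    let ?t = "{(v, w). v \<in> words X \<and> w \<in> words X \<and> (h v, h w) \<in> s}"
    interpret Q: group "quotient_monoid N s" by fact
    interpret k: word_hom "quotient_monoid N s" X "\<lambda>w. s `` {h w}" by (rule N.quotient_word_hom) fact
    have "(h [a, inv_letter a], h []) \<in> s" if "fst a \<in> X" for a
    proof -
      let ?k = "\<lambda>w. s `` {h w}"
      have "?k ([a] @ [inv_letter a] @ [a]) = ?k [a]" using that N.h_wagner[of "[a]"] by simp
      then have "?k [a, inv_letter a] \<otimes>\<^bsub>quotient_monoid N s\<^esub> ?k [a] = \<one>\<^bsub>quotient_monoid N s\<^esub> \<otimes>\<^bsub>quotient_monoid N s\<^esub> ?k [a]"
        using that k.h_append[of "[a, inv_letter a]" "[a]"] k.h_closed[of "[a]"] by (simp del: k.h_closed)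
      moreover have "?k [a, inv_letter a] \<in> carrier (quotient_monoid N s)" "?k [a] \<in> carrier (quotient_monoid N s)"
        using that k.h_closed[of "[a]"] k.h_closed[of "[a, inv_letter a]"] by simp_all
      ultimately have "?k [a, inv_letter a] = ?k []"
        unfolding k.h_Nil by (simp only: Q.right_cancel Q.one_closed)
      then show ?thesis using monoid_congruence_class_eq[OF s(1)] that N.h_closed[of "[]"] by simp
    qed
    then have "Gp_cong X relations \<subseteq> ?t"
      using relator_words assms(2) monoid_congruenceD(3)[OF s(1)] N.N.one_closed
      by (intro Gp_cong_least N.pullback_congruence s) (auto simp: group_relations_def relations_def)
    moreover have "(t, []) \<in> Gp_cong X relations" using t val_eq_iff[of t "[]"] by simp
    ultimately show ?thesis by auto
  qed
  have "(h t, c) \<in> s \<longleftrightarrow> (\<one>\<^bsub>N\<^esub>, c) \<in> s"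
    if s: "monoid_congruence N s" "group (quotient_monoid N s)" for s c
    using rel[OF s] monoid_congruenceD(4)[OF s(1)] monoid_congruenceD(5)[OF s(1)] by blast
  then have "min_group_cong N `` {h t} = min_group_cong N `` {\<one>\<^bsub>N\<^esub>}"
    by (auto simp: min_group_cong_def)
  then show ?thesis
    using assms(3) t by (simp add: E_unitary_def max_group_image_def quotient_monoid_simps)
qed

text \<open>G is a group quotient of N, so an element mapped to 1 in the maximal group image is
  represented by a word w of value 1; the second factor of w w then covers the same cells as the
  first.\<close>

lemma E_unitary_if_kernel_cell_cong:
  assumes "word_hom N X h" and ker: "\<And>v w. v \<in> words X \<Longrightarrow> w \<in> words X \<Longrightarrow> h v = h w \<longleftrightarrow> (v, w) \<in> cell_cong"
  shows "E_unitary N"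
proof -
  interpret N: word_hom N X h by fact
  define s where "s = (\<lambda>(v, w). (h v, h w)) ` Gp_cong X relations"
  have ker': "(v, w) \<in> Gp_cong X relations" if "v \<in> words X" "w \<in> words X" "h v = h w" for v w
    using that ker val_eq_iff by (auto simp: cell_cong_def)
  have s: "monoid_congruence N s"
    and s_iff: "\<And>v w. v \<in> words X \<Longrightarrow> w \<in> words X \<Longrightarrow> (h v, h w) \<in> s \<longleftrightarrow> (v, w) \<in> Gp_cong X relations"
    unfolding s_def by (rule N.pushforward_congruence[OF Gp_cong_congruence ker']; assumption)+
  interpret k: word_hom "quotient_monoid N s" X "\<lambda>w. s `` {h w}" by (rule N.quotient_word_hom) fact
  have "group (quotient_monoid N s)"
  proof (rule k.N.group_l_invI)
    fix a assume "a \<in> carrier (quotient_monoid N s)"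
    then obtain w where w: "w \<in> words X" "a = s `` {h w}" by (auto simp: k.carrier_eq)
    have "(h (inv_word w @ w), h []) \<in> s"
      using w s_iff val_eq_iff[of "inv_word w @ w" "[]"] by (simp add: val.h_append val_inv_word del: N.h_Nil)
    then have "s `` {h (inv_word w @ w)} = s `` {h []}"
      by (rule equiv_class_eq[OF monoid_congruenceD(1)[OF s]])
    then have "s `` {h (inv_word w)} \<otimes>\<^bsub>quotient_monoid N s\<^esub> a = \<one>\<^bsub>quotient_monoid N s\<^esub>"
      using w k.h_append[of "inv_word w" w] k.h_Nil by simp
    then show "\<exists>y\<in>carrier (quotient_monoid N s). y \<otimes>\<^bsub>quotient_monoid N s\<^esub> a = \<one>\<^bsub>quotient_monoid N s\<^esub>"
      using w k.h_closed[of "inv_word w"] by auto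
  qed
  with s have min: "min_group_cong N \<subseteq> s" by (auto simp: min_group_cong_def)
  show ?thesis
    unfolding E_unitary_def
  proof (intro ballI impI)
    fix a assume a: "a \<in> carrier N" "min_group_cong N `` {a} = \<one>\<^bsub>max_group_image N\<^esub>"
    then obtain w where w: "w \<in> words X" "a = h w" by (auto simp: N.carrier_eq)
    have "(\<one>\<^bsub>N\<^esub>, \<one>\<^bsub>N\<^esub>) \<in> min_group_cong N"
      by (auto simp: min_group_cong_def intro: monoid_congruenceD(3))
    then have "(a, \<one>\<^bsub>N\<^esub>) \<in> min_group_cong N"
      using a(2) by (auto simp: max_group_image_def quotient_monoid_simps)
    then have "(h w, h []) \<in> s" using min w by auto
    then have 1: "val w = \<one>\<^bsub>G\<^esub>" using s_iff[of w "[]"] val_eq_iff[of w "[]"] w by simp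
    then have "cells (w @ w) = cells w" using w cells_closed by (simp add: cells_append shift_one)
    then have "(w @ w, w) \<in> cell_cong" using w 1 by (simp add: cell_cong_def val.h_append)
    then show "a \<otimes>\<^bsub>N\<^esub> a = a" using w ker[of "w @ w" w] by (simp add: N.h_append)
  qed
qed

sublocale mval: inverse_word_hom "Inv X relations" X mval
  by unfold_locales (simp_all add: mval_wagner mval_wagner_commute)

lemma mval_eq_iff_cell_cong:
  assumes "E_unitary (Inv X relations)" "v \<in> words X" "w \<in> words X"
  shows "mval v = mval w \<longleftrightarrow> (v, w) \<in> cell_cong"
proof
  interpret E_unitary_word_hom "Inv X relations" X mval I r
    by unfold_locales
      (use mval_relator E_unitary_idempotent[OF mval.inverse_word_hom_axioms _ assms(1)] in auto)
  show "(v, w) \<in> cell_cong \<Longrightarrow> mval v = mval w" by (rule cell_cong_h)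
qed (use assms mval_eq_iff Inv_cong_subset_cell_cong in blast)

text \<open>One direction holds because \<open>cell_cong\<close> induces an E-unitary quotient of M,
  the other because every E-unitary quotient of M identifies words with equal value and equal
  cells.\<close>

lemma EU_val_eq_iff_cell_cong:
  assumes vw: "v \<in> words X" "w \<in> words X"
  shows "EU_val X relations v = EU_val X relations w \<longleftrightarrow> (v, w) \<in> cell_cong"
proof -
  let ?M = "Inv X relations"
  define s where "s = (\<lambda>(v, w). (mval v, mval w)) ` cell_cong"
  have ker: "(v, w) \<in> cell_cong" if "v \<in> words X" "w \<in> words X" "mval v = mval w" for v w
    using that mval_eq_iff Inv_cong_subset_cell_cong by blast
  have s: "monoid_congruence ?M s"
    and s_iff: "\<And>v w. v \<in> words X \<Longrightarrow> w \<in> words X \<Longrightarrow> (mval v, mval w) \<in> s \<longleftrightarrow> (v, w) \<in> cell_cong"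
    unfolding s_def by (rule mval.pushforward_congruence[OF cell_cong_congruence ker]; assumption)+
  have "E_unitary (quotient_monoid ?M s)"
    by (rule E_unitary_if_kernel_cell_cong[OF mval.quotient_word_hom[OF s]])
      (simp add: s_iff monoid_congruence_class_eq[OF s])
  with s have s_mem: "s \<in> {s. monoid_congruence ?M s \<and> E_unitary (quotient_monoid ?M s)}" by simp
  have EU: "monoid_congruence ?M (EU_cong ?M)"
    unfolding EU_cong_def by (rule monoid_congruence_Inter) (use s_mem in auto)
  have "(mval v, mval w) \<in> EU_cong ?M" if "(v, w) \<in> cell_cong"
    unfolding EU_cong_def
  proof (rule InterI, clarify)
    fix s' assume s': "monoid_congruence ?M s'" "E_unitary (quotient_monoid ?M s')"
    interpret k: word_hom "quotient_monoid ?M s'" X "\<lambda>w. s' `` {mval w}" by (rule mval.quotient_word_hom) fact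
    have inv: "inverse_word_hom (quotient_monoid ?M s') X (\<lambda>w. s' `` {mval w})"
      by unfold_locales (simp_all add: mval_wagner mval_wagner_commute)
    have rel: "s' `` {mval (r i)} = \<one>\<^bsub>quotient_monoid ?M s'\<^esub>" if "i \<in> I" for i
      using mval_relator[OF that] k.h_Nil by simp
    interpret E_unitary_word_hom "quotient_monoid ?M s'" X "\<lambda>w. s' `` {mval w}" I r
      using inv special_presentation_axioms rel E_unitary_idempotent[OF inv rel s'(2)]
      by (auto simp: E_unitary_word_hom_def E_unitary_word_hom_axioms_def)
    have "s' `` {mval v} = s' `` {mval w}" by (rule cell_cong_h) fact
    then show "(mval v, mval w) \<in> s'" using vw monoid_congruence_class_eq[OF s'(1)] by simp
  qed
  moreover have "EU_cong ?M \<subseteq> s" using s_mem unfolding EU_cong_def by blast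
  ultimately show ?thesis
    unfolding EU_val_def using vw s_iff monoid_congruence_class_eq[OF EU] by auto
qed

text \<open>The sets of cells may be infinite, but it suffices to test the finitely many edges of
  the two paths. This is \<open>h_eq_if_edges\<close> for the quotient by \<open>cell_cong\<close>
  itself, which is E-unitary.\<close>

lemma cell_cong_iff_edges:
  assumes vw: "v \<in> words X" "w \<in> words X"
  shows "(v, w) \<in> cell_cong \<longleftrightarrow> val v = val w \<and>
    (\<forall>q a. prefix (q @ [a]) v \<longrightarrow> (val q, Some a) \<in> cells w) \<and>
    (\<forall>q a. prefix (q @ [a]) w \<longrightarrow> (val q, Some a) \<in> cells v)" (is "_ \<longleftrightarrow> ?R")
proof
  show "(v, w) \<in> cell_cong \<Longrightarrow> ?R" using edge_in_cells[of v] edge_in_cells[of w] by (auto simp: cell_cong_def)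
  let ?Q = "quotient_monoid (free_monoid X) cell_cong"
  let ?h = "\<lambda>w. cell_cong `` {w}"
  interpret Q: word_hom ?Q X ?h by (rule word_hom_quotient_free) (rule cell_cong_congruence)
  have eq: "?h v = ?h w \<longleftrightarrow> (v, w) \<in> cell_cong" if "v \<in> words X" "w \<in> words X" for v w
    using monoid_congruence_class_eq[OF cell_cong_congruence] that by simp
  have mval: "?h v = ?h w" if "v \<in> words X" "w \<in> words X" "mval v = mval w" for v w
    using that Inv_cong_subset_cell_cong mval_eq_iff eq by blast
  have inv: "inverse_word_hom ?Q X ?h"
    by unfold_locales (rule mval; simp add: mval_wagner mval_wagner_commute)+
  have rel: "?h (r i) = \<one>\<^bsub>?Q\<^esub>" if "i \<in> I" for i
    using mval[OF relator_words[OF that] words_Nil mval_relator[OF that]] by simp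
  have EU: "E_unitary ?Q" by (rule E_unitary_if_kernel_cell_cong[OF Q.word_hom_axioms eq])
  interpret E_unitary_word_hom ?Q X ?h I r
    using inv special_presentation_axioms rel E_unitary_idempotent[OF inv rel EU]
    by (auto simp: E_unitary_word_hom_def E_unitary_word_hom_axioms_def)
  assume ?R
  then have "?h v = ?h w" by (intro h_eq_if_edges vw) auto
  then show "(v, w) \<in> cell_cong" using eq vw by simp
qed

end

section \<open>Splitting off a free factor\<close>

text \<open>New generators are introduced: \<open>psi\<close> writes them as words in the old ones and \<open>qsi\<close> the old
  ones as words in the new ones.  With respect to these, \<open>G\<close> is the free product of the subgroup
  \<open>K\<close> generated by the new generators outside \<open>S\<close> and the free group on \<open>S\<close>; the elements of \<open>T\<close>
  are those in \<open>S\<close> that lie in the prefix monoid.  A state \<open>(g, [(s\<^sub>1, h\<^sub>1), \<dots>])\<close> stands for the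
  normal form \<open>g s\<^sub>1 h\<^sub>1 \<dots>\<close> with \<open>g, h\<^sub>1, \<dots> \<in> K\<close>.  As in van der Waerden's proof, uniqueness of the
  normal forms comes from an action of \<open>G\<close> on them.\<close>

locale free_factor = special_presentation X I r
  for X :: "'x set" and I :: "'i set" and r :: "'i \<Rightarrow> 'x word" +
  fixes S T :: "'x set" and A B :: "'x \<Rightarrow> 'x word"
  assumes S_X: "S \<subseteq> X" and T_S: "T \<subseteq> S"
    and A_cases: "y \<in> X \<Longrightarrow> A y = [] \<or> (\<exists>s\<in>T. A y = [gen s])"
    and B_cases: "y \<in> X \<Longrightarrow> B y = [] \<or> (\<exists>s\<in>T. B y = [gen s])"
    and A_S: "s \<in> S \<Longrightarrow> A s = []" and B_S: "s \<in> S \<Longrightarrow> B s = []"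
begin

text \<open>The new generator named y stands for \<open>A y\<close> y \<open>B y\<close>^-1. Letters
  of \<open>S\<close> keep their meaning and \<open>A y\<close>, \<open>B y\<close> consist of such
  letters, so solving for y gives \<open>qsi\<close>.\<close>

definition psi :: "'x letter \<Rightarrow> 'x word" where
  "psi a = (let w = A (fst a) @ [gen (fst a)] @ inv_word (B (fst a)) in if snd a then w else inv_word w)"

definition qsi :: "'x letter \<Rightarrow> 'x word" where
  "qsi a = (let w = inv_word (A (fst a)) @ [gen (fst a)] @ B (fst a) in if snd a then w else inv_word w)"

lemma psi_inv_letter: "psi (inv_letter a) = inv_word (psi a)"
  and qsi_inv_letter: "qsi (inv_letter a) = inv_word (qsi a)"
  by (simp_all add: psi_def qsi_def Let_def inv_letter_def)

lemma gen_cases: "a = gen (fst a) \<or> a = inv_letter (gen (fst a))"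
  by (cases a) (auto simp: inv_letter_def)

lemma psi_S: "fst a \<in> S \<Longrightarrow> psi a = [a]"
  by (cases a) (simp add: psi_def Let_def A_S B_S inv_letter_def)

lemma A_words: "y \<in> X \<Longrightarrow> A y \<in> words X" and B_words: "y \<in> X \<Longrightarrow> B y \<in> words X"
  using A_cases[of y] B_cases[of y] S_X T_S by auto

lemma psi_words: "fst a \<in> X \<Longrightarrow> psi a \<in> words X" and qsi_words: "fst a \<in> X \<Longrightarrow> qsi a \<in> words X"
  using A_words[of "fst a"] B_words[of "fst a"] by (auto simp: psi_def qsi_def Let_def)

text \<open>Left multiplication of a normal form by a new generator: a letter of \<open>S\<close>
  opens a syllable or cancels the first one, any other generator is absorbed by the front
  component.\<close>

definition step :: "'x letter \<Rightarrow> 'x word set \<times> ('x letter \<times> 'x word set) list \<Rightarrow>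
    'x word set \<times> ('x letter \<times> 'x word set) list" where
  "step a st = (if fst a \<in> S then
       (case snd st of
          [] \<Rightarrow> (\<one>\<^bsub>G\<^esub>, [(a, fst st)])
        | (s, h) # l \<Rightarrow> if s = inv_letter a \<and> fst st = \<one>\<^bsub>G\<^esub> then (h, l) else (\<one>\<^bsub>G\<^esub>, (a, fst st) # snd st))
     else (val (psi a) \<otimes>\<^bsub>G\<^esub> fst st, snd st))"

fun reduced :: "('x letter \<times> 'x word set) list \<Rightarrow> bool" where
  "reduced [] = True"
| "reduced ((s, h) # l) \<longleftrightarrow> fst s \<in> S \<and> h \<in> carrier G \<and> reduced l \<and>
     (case l of [] \<Rightarrow> True | (s', h') # l' \<Rightarrow> \<not> (s' = inv_letter s \<and> h = \<one>\<^bsub>G\<^esub>))"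

text \<open>Components range over all of G instead of K: states are the normal forms of the free
  product of G with the free group on \<open>S\<close>.\<close>

definition state where "state st \<longleftrightarrow> fst st \<in> carrier G \<and> reduced (snd st)"

definition pos where "pos st \<longleftrightarrow> (\<forall>(s, h)\<in>set (snd st). fst s \<in> T \<and> snd s)"

lemma state_step: "fst a \<in> X \<Longrightarrow> state st \<Longrightarrow> state (step a st)"
proof -
  assume a: "fst a \<in> X" and st: "state st"
  obtain g l where gl: "st = (g, l)" by fastforce
  show ?thesis
  proof (cases l)
    case Nil
    then show ?thesis using a st gl psi_words[OF a] by (simp add: step_def state_def)
  next
    case (Cons c l')
    obtain s h where "c = (s, h)" by fastforce
    then show ?thesis using a st gl Cons psi_words[OF a] by (auto simp: step_def state_def split: list.splits)
  qed
qed

text \<open>After a cancellation the inverse letter must not cancel once more; the clause of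
  \<open>reduced\<close> that excludes s 1 s^-1 ensures this.\<close>

lemma step_inv_letter:
  assumes "fst a \<in> X" "state st"
  shows "step (inv_letter a) (step a st) = st"
proof (cases "fst a \<in> S")
  case True
  then show ?thesis
    using assms by (cases st) (auto simp: step_def state_def split: list.splits)
next
  case False
  then show ?thesis
    using assms psi_words[of a]
    by (cases st) (simp add: step_def state_def psi_inv_letter val_inv_word val.N.m_assoc[symmetric])
qed

definition act where "act v = foldr step v"

lemma act_simps [simp]: "act [] st = st" "act (a # v) st = step a (act v st)" "act (v @ w) st = act v (act w st)"
  by (simp_all add: act_def)

lemma state_act: "v \<in> words X \<Longrightarrow> state st \<Longrightarrow> state (act v st)"
  by (induction v) (auto intro: state_step)

lemma act_inv_word: "v \<in> words X \<Longrightarrow> state st \<Longrightarrow> act (inv_word v) (act v st) = st"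
  by (induction v) (auto simp: step_inv_letter state_act)

lemma act_inv_word': "v \<in> words X \<Longrightarrow> state st \<Longrightarrow> act v (act (inv_word v) st) = st"
  using act_inv_word[of "inv_word v" st] by simp

definition qact where "qact w = act (concat (map qsi w))"

lemma qact_simps [simp]: "qact [] st = st" "qact (a # v) st = act (qsi a) (qact v st)" "qact (v @ w) st = qact v (qact w st)"
  by (simp_all add: qact_def)

lemma state_qact: "v \<in> words X \<Longrightarrow> state st \<Longrightarrow> state (qact v st)"
  by (induction v) (auto intro: state_act qsi_words)

lemma qact_inv_word: "v \<in> words X \<Longrightarrow> state st \<Longrightarrow> qact (inv_word v) (qact v st) = st"
  by (induction v) (auto simp: qsi_inv_letter act_inv_word state_qact qsi_words)

fun list_val :: "('x letter \<times> 'x word set) list \<Rightarrow> 'x word set" where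
  "list_val [] = \<one>\<^bsub>G\<^esub>"
| "list_val ((s, h) # l) = val [s] \<otimes>\<^bsub>G\<^esub> (h \<otimes>\<^bsub>G\<^esub> list_val l)"

text \<open>Evaluation of a normal form in G. Applied to the normal form computed from w it returns
  \<open>val w\<close>, so normal forms determine elements of G.\<close>

definition state_val where "state_val st = fst st \<otimes>\<^bsub>G\<^esub> list_val (snd st)"

lemma list_val_closed: "reduced l \<Longrightarrow> list_val l \<in> carrier G"
  using S_X by (induction l rule: list_val.induct) auto

lemma state_val_closed: "state st \<Longrightarrow> state_val st \<in> carrier G"
  by (auto simp: state_val_def state_def list_val_closed)

lemma state_val_step:
  assumes a: "fst a \<in> X" and st: "state st"
  shows "state_val (step a st) = val (psi a) \<otimes>\<^bsub>G\<^esub> state_val st"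
proof (cases "fst a \<in> S")
  case True
  obtain g l where gl: "st = (g, l)" by fastforce
  have g: "g \<in> carrier G" "reduced l" "list_val l \<in> carrier G" using st gl by (auto simp: state_def list_val_closed)
  show ?thesis
  proof (cases "\<exists>h l'. l = (inv_letter a, h) # l' \<and> g = \<one>\<^bsub>G\<^esub>")
    case True': True
    then obtain h l' where l: "l = (inv_letter a, h) # l'" "g = \<one>\<^bsub>G\<^esub>" by blast
    have h: "h \<in> carrier G" "list_val l' \<in> carrier G" using g l by (auto simp: list_val_closed)
    have "val [a] \<otimes>\<^bsub>G\<^esub> (val [inv_letter a] \<otimes>\<^bsub>G\<^esub> (h \<otimes>\<^bsub>G\<^esub> list_val l')) = h \<otimes>\<^bsub>G\<^esub> list_val l'"
      using val_letter_inv[OF a] a h by (simp add: val.N.m_assoc[symmetric])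
    then show ?thesis using True gl l h a by (simp add: step_def state_val_def psi_S)
  next
    case False
    then have "step a st = (\<one>\<^bsub>G\<^esub>, (a, g) # l)" using True gl by (auto simp: step_def split: list.splits)
    then show ?thesis using True gl g a by (simp add: state_val_def psi_S)
  qed
next
  case False
  then show ?thesis
    using a st psi_words[OF a] by (simp add: step_def state_val_def state_def list_val_closed val.N.m_assoc)
qed

lemma state_val_act_S: "v \<in> words S \<Longrightarrow> state st \<Longrightarrow> state_val (act v st) = val v \<otimes>\<^bsub>G\<^esub> state_val st"
proof (induction v)
  case (Cons a v)
  then have v: "v \<in> words X" "fst a \<in> X" using S_X by (auto simp: words_def)
  with Cons show ?case
    using val_Cons[of a v] by (simp add: state_val_step state_act psi_S val.N.m_assoc state_val_closed)
qed (simp add: state_val_closed)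

lemma AB_S: "y \<in> X \<Longrightarrow> A y \<in> words S" "y \<in> X \<Longrightarrow> B y \<in> words S"
  using A_cases[of y] B_cases[of y] T_S by auto

lemma state_val_act_qsi_gen:
  assumes "y \<in> X" and st: "state st"
  shows "state_val (act (qsi (gen y)) st) = val [gen y] \<otimes>\<^bsub>G\<^esub> state_val st"
proof -
  let ?A = "val (A y)" and ?B = "val (B y)" and ?y = "val [gen y]"
  have B: "state (act (B y) st)" by (rule state_act) (use assms B_words in auto)
  then have yB: "state (step (gen y) (act (B y) st))" by (rule state_step[rotated]) (use assms in auto)
  have c: "?A \<in> carrier G" "?B \<in> carrier G" "?y \<in> carrier G" "state_val st \<in> carrier G"
    using assms A_words B_words state_val_closed by auto
  have "state_val (act (qsi (gen y)) st) = inv\<^bsub>G\<^esub> ?A \<otimes>\<^bsub>G\<^esub> (val (psi (gen y)) \<otimes>\<^bsub>G\<^esub> (?B \<otimes>\<^bsub>G\<^esub> state_val st))"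
    using assms AB_S[of y] A_words[of y] B yB
    by (simp add: qsi_def state_val_act_S state_val_step val_inv_word)
  also have "val (psi (gen y)) = ?A \<otimes>\<^bsub>G\<^esub> (?y \<otimes>\<^bsub>G\<^esub> inv\<^bsub>G\<^esub> ?B)"
    using assms A_words[of y] B_words[of y] val_Cons[of "gen y" "inv_word (B y)"]
    by (simp add: psi_def val.h_append val_inv_word)
  also have "inv\<^bsub>G\<^esub> ?A \<otimes>\<^bsub>G\<^esub> (?A \<otimes>\<^bsub>G\<^esub> (?y \<otimes>\<^bsub>G\<^esub> inv\<^bsub>G\<^esub> ?B) \<otimes>\<^bsub>G\<^esub> (?B \<otimes>\<^bsub>G\<^esub> state_val st)) = ?y \<otimes>\<^bsub>G\<^esub> state_val st"
    using c by (simp add: val.N.m_assoc G.inv_solve_left')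
  finally show ?thesis .
qed

lemma state_val_act_qsi:
  assumes "fst a \<in> X" and st: "state st"
  shows "state_val (act (qsi a) st) = val [a] \<otimes>\<^bsub>G\<^esub> state_val st"
  using gen_cases[of a]
proof
  assume "a = gen (fst a)"
  with assms state_val_act_qsi_gen[of "fst a" st] show ?thesis by metis
next
  assume a: "a = inv_letter (gen (fst a))"
  define y where "y = fst a"
  let ?st = "act (qsi a) st"
  have y: "a = inv_letter (gen y)" "y \<in> X" using a assms by (auto simp: y_def)
  have s: "state ?st" using assms by (intro state_act qsi_words) auto
  \<comment> \<open>The case of a generator is applied to the state reached after a, which the
    generator takes back to \<open>st\<close>.\<close>
  have "state_val st = state_val (act (qsi (gen y)) ?st)"
    using y st act_inv_word'[of "qsi (gen y)" st] by (simp add: qsi_inv_letter qsi_words)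
  also have "\<dots> = val [gen y] \<otimes>\<^bsub>G\<^esub> state_val ?st" using y s by (intro state_val_act_qsi_gen) auto
  finally have "val [a] \<otimes>\<^bsub>G\<^esub> state_val st = val [a] \<otimes>\<^bsub>G\<^esub> val [gen y] \<otimes>\<^bsub>G\<^esub> state_val ?st"
    using y s by (simp add: val.N.m_assoc state_val_closed)
  also have "val [a] \<otimes>\<^bsub>G\<^esub> val [gen y] = \<one>\<^bsub>G\<^esub>" using val_letter_inv[of a] y by simp
  finally show ?thesis using s by (simp add: state_val_closed)
qed

lemma state_val_qact: "w \<in> words X \<Longrightarrow> state st \<Longrightarrow> state_val (qact w st) = val w \<otimes>\<^bsub>G\<^esub> state_val st"
proof (induction w)
  case (Cons a w)
  then show ?case
    using val_Cons[of a w] by (simp add: state_val_act_qsi state_qact val.N.m_assoc state_val_closed)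
qed (simp add: state_val_closed)

text \<open>Two properties wanted of relators: the image in the free product is the value in the
  first factor, and prefixes keep positive states positive. Both pass to concatenations, so they
  need to be checked only for the pieces and their inverses.\<close>

definition block :: "'x word \<Rightarrow> bool" where
  "block u \<longleftrightarrow> u \<in> words X \<and> (\<forall>st. state st \<longrightarrow> qact u st = (val u \<otimes>\<^bsub>G\<^esub> fst st, snd st)) \<and>
     (\<forall>p st. prefix p u \<longrightarrow> state st \<longrightarrow> pos st \<longrightarrow> pos (qact p st))"

lemma blockD:
  assumes "block u"
  shows "u \<in> words X" "state st \<Longrightarrow> qact u st = (val u \<otimes>\<^bsub>G\<^esub> fst st, snd st)"
    "prefix p u \<Longrightarrow> state st \<Longrightarrow> pos st \<Longrightarrow> pos (qact p st)"
  using assms unfolding block_def by blast+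

lemma block_concat:
  assumes "\<forall>u\<in>set us. block u"
  shows "block (concat us)"
  using assms
proof (induction us)
  case Nil
  show ?case by (auto simp: block_def state_def)
next
  case (Cons u us)
  then have u: "block u" and us: "block (concat us)" by auto
  let ?w = "concat us"
  have words: "u \<in> words X" "?w \<in> words X" using u us by (auto simp: block_def)
  have "qact (u @ ?w) st = (val (u @ ?w) \<otimes>\<^bsub>G\<^esub> fst st, snd st)" if "state st" for st
  proof -
    have "qact u (qact ?w st) = (val u \<otimes>\<^bsub>G\<^esub> fst (qact ?w st), snd (qact ?w st))"
      using blockD(2)[OF u state_qact[OF words(2) that]] .
    moreover have "qact ?w st = (val ?w \<otimes>\<^bsub>G\<^esub> fst st, snd st)" using blockD(2)[OF us that] .
    ultimately show ?thesis using words that by (simp add: val.h_append val.N.m_assoc state_def)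
  qed
  moreover have "pos (qact p st)" if "prefix p (u @ ?w)" "state st" "pos st" for p st
    using that(1)[unfolded prefix_append]
  proof
    assume "prefix p u"
    with that show ?thesis by (intro blockD(3)[OF u])
  next
    assume "\<exists>us. p = u @ us \<and> prefix us ?w"
    then obtain p' where p': "p = u @ p'" "prefix p' ?w" by blast
    have "state (qact p' st)" using that words_prefix[OF p'(2) words(2)] state_qact by blast
    moreover have "pos (qact p' st)" using p' that by (intro blockD(3)[OF us])
    ultimately show ?thesis using p' blockD(3)[OF u, of u] by simp
  qed
  ultimately show ?case using words by (simp add: block_def)
qed

end

section \<open>Membership in the prefix monoid read off the normal form\<close>

locale free_factor_blocks = free_factor +
  assumes block_relator: "i \<in> I \<Longrightarrow> block (r i)"
    and psi_P: "fst a \<in> X - S \<Longrightarrow> val (psi a) \<in> P"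
    and T_P: "s \<in> T \<Longrightarrow> val [gen s] \<in> P"
begin

text \<open>Relators are blocks of value 1 and so act trivially; hence the action of words factors
  through G.\<close>

lemma qact_val_eq:
  assumes "v \<in> words X" "w \<in> words X" "val v = val w" "state st"
  shows "qact v st = qact w st"
proof -
  let ?t = "{(v, w). v \<in> words X \<and> w \<in> words X \<and> (\<forall>st. state st \<longrightarrow> qact v st = qact w st)}"
  have "qact [a, inv_letter a] st = st" if "fst a \<in> X" "state st" for a st
    using that by (simp add: qsi_inv_letter act_inv_word' qsi_words)
  moreover have "qact (r i) st = st" if "i \<in> I" "state st" for i st
    using blockD(2)[OF block_relator[OF that(1)] that(2)] that val_relator by (simp add: state_def)
  ultimately have "group_relations X \<union> relations \<subseteq> ?t"
    using relator_words by (auto simp: group_relations_def relations_def simp del: qact_simps(2))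
  moreover have "monoid_congruence (free_monoid X) ?t"
    by (rule monoid_congruenceI) (auto simp: state_qact simp del: split_paired_All)
  ultimately have "Gp_cong X relations \<subseteq> ?t" by (rule Gp_cong_least[rotated])
  with assms val_eq_iff show ?thesis by blast
qed

lemma pos_prefix_products: "w \<in> prefix_products \<Longrightarrow> state st \<Longrightarrow> pos st \<Longrightarrow> pos (qact w st)"
proof -
  have "pos (qact (concat ps) st)" if "ps \<in> lists {p. \<exists>i\<in>I. prefix p (r i)}" "state st" "pos st" for ps
    using that
  proof (induction ps)
    case (Cons p ps)
    then obtain i where i: "i \<in> I" "prefix p (r i)" by auto
    have "concat ps \<in> words X" using Cons prefix_products_words by (auto simp: prefix_products_def)
    then have "state (qact (concat ps) st)" using Cons state_qact by auto
    then show ?case using Cons by (simp add: blockD(3)[OF block_relator[OF i(1)] i(2)])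
  qed simp
  then show "w \<in> prefix_products \<Longrightarrow> state st \<Longrightarrow> pos st \<Longrightarrow> pos (qact w st)"
    by (auto simp: prefix_products_def)
qed

text \<open>Components are products of new generators outside \<open>S\<close>, all of which lie in
  \<open>P\<close>. So only the letters of \<open>S\<close> can keep a value out of
  \<open>P\<close>.\<close>

definition P_state where "P_state st \<longleftrightarrow> fst st \<in> P \<and> (\<forall>(s, h)\<in>set (snd st). h \<in> P)"

lemma P_state_step:
  assumes "fst a \<in> X" "P_state st"
  shows "P_state (step a st)"
proof (cases "fst a \<in> S")
  case True
  with assms P_one show ?thesis
    by (cases "snd st") (auto simp: P_state_def step_def split: if_splits)
next
  case False
  with assms psi_P[of a] P_mult show ?thesis by (simp add: P_state_def step_def)
qed

lemma P_state_qact: "w \<in> words X \<Longrightarrow> P_state st \<Longrightarrow> P_state (qact w st)"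
proof -
  have act: "P_state (act v st)" if "v \<in> words X" "P_state st" for v st
    using that by (induction v) (auto intro: P_state_step)
  show "w \<in> words X \<Longrightarrow> P_state st \<Longrightarrow> P_state (qact w st)"
    by (induction w) (auto intro: act qsi_words)
qed

lemma list_val_P: "\<forall>(s, h)\<in>set l. h \<in> P \<and> fst s \<in> T \<and> snd s \<Longrightarrow> list_val l \<in> P"
proof (induction l)
  case (Cons c l)
  obtain y h where "c = (gen y, h)" using Cons by (cases c) auto
  with Cons show ?case by (auto intro!: P_mult T_P)
qed (simp add: P_one)

theorem val_in_P_iff_pos:
  assumes "w \<in> words X"
  shows "val w \<in> P \<longleftrightarrow> pos (qact w (\<one>\<^bsub>G\<^esub>, []))"
proof
  have st: "state (\<one>\<^bsub>G\<^esub>, [])" "pos (\<one>\<^bsub>G\<^esub>, [])" by (auto simp: state_def pos_def)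
  assume "val w \<in> P"
  then obtain v where v: "v \<in> prefix_products" "val w = val v" by (auto simp: prefix_monoid_eq)
  then have "v \<in> words X" using prefix_products_words by blast
  then show "pos (qact w (\<one>\<^bsub>G\<^esub>, []))"
    using pos_prefix_products[OF v(1) st] qact_val_eq[OF assms _ v(2) st(1)] by simp
next
  let ?st = "qact w (\<one>\<^bsub>G\<^esub>, [])"
  assume pos: "pos ?st"
  have "P_state ?st" using assms P_one by (intro P_state_qact) (auto simp: P_state_def)
  with pos have "state_val ?st \<in> P"
    unfolding state_val_def by (intro P_mult list_val_P) (auto simp: P_state_def pos_def)
  then show "val w \<in> P"
    using assms state_val_qact[of w "(\<one>\<^bsub>G\<^esub>, [])"] by (simp add: state_def state_val_def)
qed

end

section \<open>Factors of the form x w z\<close>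

locale marked_factorisation = special_presentation X I r
  for X :: "'x set" and I :: "'i set" and r :: "'i \<Rightarrow> 'x word" +
  fixes U :: "'x word set" and l :: nat and Xs Y :: "nat \<Rightarrow> 'x set" and x z :: "nat \<Rightarrow> 'x"
    and W :: "nat \<Rightarrow> 'x word set"
  assumes U_words: "U \<subseteq> words X"
    and relator_concatenation: "i \<in> I \<Longrightarrow> r i \<in> concatenations U"
    and unital: "u \<in> U \<Longrightarrow> mval u \<in> Units (Inv X relations)"
    and Xs: "j \<in> {1..l} \<Longrightarrow> Xs j \<subseteq> X \<and> x j \<in> Xs j \<and> z j \<in> Xs j"
    and Y: "j \<in> {1..l} \<Longrightarrow> Y j = Xs j - {x j, z j}"
    and W: "j \<in> {1..l} \<Longrightarrow> W j \<subseteq> words (Y j)"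
    and Xs_disjoint: "j \<in> {1..l} \<Longrightarrow> j' \<in> {1..l} \<Longrightarrow> j \<noteq> j' \<Longrightarrow> Xs j \<inter> Xs j' = {}"
    and U: "U = (\<Union>j\<in>{1..l}. {[gen (x j)] @ w @ [gen (z j)] | w. w \<in> W j})"
    and W_Nil: "j \<in> {1..l} \<Longrightarrow> [] \<in> W j"
    and W_red: "j \<in> {1..l} \<Longrightarrow> y \<in> Y j \<Longrightarrow> \<exists>w\<in>concatenations (W j). [gen y] = red w"
begin

text \<open>If \<open>x j \<noteq> z j\<close>, the new generators belonging to \<open>X\<^sub>j\<close> are \<open>x\<close>, \<open>x z\<close> and \<open>x y x\<^sup>-\<^sup>1\<close> for \<open>y \<in> Y\<^sub>j\<close>,
  so that \<open>x w z\<close> no longer involves \<open>x\<close>.  If \<open>x j = z j\<close>, all letters of \<open>X\<^sub>j\<close> already represent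
  units of the prefix monoid and are kept.  For \<open>y\<close> outside all \<open>X\<^sub>j\<close> the value of \<open>idx y\<close> is junk,
  but \<open>A y\<close> and \<open>B y\<close> are empty anyway.\<close>

definition idx :: "'x \<Rightarrow> nat" where "idx y = (THE j. j \<in> {1..l} \<and> y \<in> Xs j)"
definition T :: "'x set" where "T = x ` {j \<in> {1..l}. x j \<noteq> z j}"
text \<open>Letters outside all \<open>Xs j\<close> occur in no relator. They are free like those in
  \<open>T\<close>, but do not belong to the prefix monoid, which is why the two sets are kept
  apart.\<close>

definition S :: "'x set" where "S = {y \<in> X. \<forall>j\<in>{1..l}. y \<notin> Xs j} \<union> T"
definition A :: "'x \<Rightarrow> 'x word" where
  "A y = (if \<exists>j\<in>{1..l}. y \<in> Xs j \<and> x j \<noteq> z j \<and> y \<noteq> x j then [gen (x (idx y))] else [])"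
definition B :: "'x \<Rightarrow> 'x word" where
  "B y = (if y = z (idx y) then [] else A y)"

lemma idx_eq: "j \<in> {1..l} \<Longrightarrow> y \<in> Xs j \<Longrightarrow> idx y = j"
  unfolding idx_def using Xs_disjoint by (intro the_equality) blast+

lemma Xs_unique: "i \<in> {1..l} \<Longrightarrow> j \<in> {1..l} \<Longrightarrow> y \<in> Xs i \<Longrightarrow> y \<in> Xs j \<Longrightarrow> i = j"
  using Xs_disjoint by blast

lemma A_eq:
  assumes "j \<in> {1..l}" "y \<in> Xs j"
  shows "A y = (if x j \<noteq> z j \<and> y \<noteq> x j then [gen (x j)] else [])"
    and "B y = (if x j \<noteq> z j \<and> y \<noteq> x j \<and> y \<noteq> z j then [gen (x j)] else [])"
proof -
  show A: "A y = (if x j \<noteq> z j \<and> y \<noteq> x j then [gen (x j)] else [])"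
  proof -
    have "(\<exists>j\<in>{1..l}. y \<in> Xs j \<and> x j \<noteq> z j \<and> y \<noteq> x j) \<longleftrightarrow> x j \<noteq> z j \<and> y \<noteq> x j"
      using assms Xs_unique[OF assms(1) _ assms(2)] by blast
    then show ?thesis using idx_eq[OF assms] by (simp add: A_def)
  qed
  show "B y = (if x j \<noteq> z j \<and> y \<noteq> x j \<and> y \<noteq> z j then [gen (x j)] else [])"
    using idx_eq[OF assms] unfolding B_def A by simp
qed

lemma S_iff:
  assumes "j \<in> {1..l}" "y \<in> Xs j"
  shows "y \<in> S \<longleftrightarrow> y = x j \<and> x j \<noteq> z j"
proof -
  have "x i \<in> Xs i" if "i \<in> {1..l}" for i using Xs[OF that] by simp
  then show ?thesis using assms Xs_unique[OF assms(1) _ assms(2)] unfolding S_def T_def by blast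
qed

sublocale free_factor X I r S T A B
proof
  show "S \<subseteq> X" "T \<subseteq> S" using Xs by (auto simp: S_def T_def)
  show A: "A y = [] \<or> (\<exists>s\<in>T. A y = [gen s])" if "y \<in> X" for y
    using idx_eq[of _ y] by (auto simp: A_def T_def)
  show "B y = [] \<or> (\<exists>s\<in>T. B y = [gen s])" if "y \<in> X" for y
    using A[OF that] by (auto simp: B_def)
  show A0: "A s = []" if "s \<in> S" for s
    using that S_iff by (auto simp: A_def)
  show "B s = []" if "s \<in> S" for s
    using A0[OF that] by (auto simp: B_def)
qed

section \<open>The pieces and their inverses are blocks\<close>

lemma pos_step_T: "s \<in> T \<Longrightarrow> pos st \<Longrightarrow> pos (step (gen s) st)"
proof -
  assume s: "s \<in> T" and st: "pos st"
  have "set (snd (step (gen s) st)) \<subseteq> insert (gen s, fst st) (set (snd st))"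
    using s T_S by (cases "snd st") (auto simp: step_def split: if_splits)
  moreover have "\<forall>c\<in>insert (gen s, fst st) (set (snd st)). case c of (s, h) \<Rightarrow> fst s \<in> T \<and> snd s"
    using s st by (simp add: pos_def)
  ultimately show ?thesis unfolding pos_def by blast
qed

lemma act_non_S: "v \<in> words (X - S) \<Longrightarrow> snd (act v st) = snd st"
  by (induction v) (auto simp: step_def)

lemma pos_act_non_S: "v \<in> words (X - S) \<Longrightarrow> pos (act v st) \<longleftrightarrow> pos st"
  by (simp add: pos_def act_non_S)

lemma Y_S: "j \<in> {1..l} \<Longrightarrow> Y j \<subseteq> X - S"
  using Y Xs S_iff by blast

lemma words_mono: "w \<in> words C \<Longrightarrow> C \<subseteq> D \<Longrightarrow> w \<in> words D"
  by (auto simp: words_def)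

lemma block_inv_word_val:
  assumes u: "u \<in> words X" and "\<And>st. state st \<Longrightarrow> qact u st = (val u \<otimes>\<^bsub>G\<^esub> fst st, snd st)" and st: "state st"
  shows "qact (inv_word u) st = (val (inv_word u) \<otimes>\<^bsub>G\<^esub> fst st, snd st)"
proof -
  let ?st = "(val (inv_word u) \<otimes>\<^bsub>G\<^esub> fst st, snd st)"
  have s: "state ?st" using u st by (simp add: state_def)
  have "qact u ?st = st"
    using assms(2)[OF s] u st by (simp add: state_def val_inv_word val.N.m_assoc[symmetric])
  with qact_inv_word[OF u s] show ?thesis by simp
qed

text \<open>If \<open>x j = z j\<close>, no letter of \<open>Xs j\<close> is in \<open>S\<close>,
  and \<open>A\<close> and \<open>B\<close> are empty there, so old and new generators coincide on
  \<open>Xs j\<close>.\<close>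

lemma val_psi_id:
  assumes "j \<in> {1..l}" "x j = z j"
  shows "v \<in> words (Xs j) \<Longrightarrow> state st \<Longrightarrow> qact v st = (val v \<otimes>\<^bsub>G\<^esub> fst st, snd st)"
proof (induction v)
  case (Cons a v)
  then have a: "fst a \<in> Xs j" "fst a \<notin> S" "fst a \<in> X" using S_iff[OF assms(1)] assms Xs by auto
  have id: "psi a = [a]" "qsi a = [a]"
    using A_eq[OF assms(1) a(1)] assms(2) by (cases a; simp add: psi_def qsi_def Let_def inv_letter_def)+
  have v: "v \<in> words X" using Cons.prems Xs[OF assms(1)] words_mono by auto
  with Cons id a show ?case
    using val_Cons[of a v] by (simp add: step_def state_def val.N.m_assoc)
qed (simp add: state_def)

lemma block_Xs:
  assumes "j \<in> {1..l}" "x j = z j" "v \<in> words (Xs j)"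
  shows "block v"
  using assms val_psi_id[OF assms(1,2)] words_prefix[OF _ assms(3)] words_mono[OF assms(3)] Xs[OF assms(1)]
  unfolding block_def by (auto simp: pos_def simp del: split_paired_All)

context
  fixes j assumes j: "j \<in> {1..l}" "x j \<noteq> z j"
begin

lemma xz_simps: "x j \<in> X" "z j \<in> X" "x j \<in> T" "x j \<in> S" "z j \<notin> S"
    "A (x j) = []" "B (x j) = []" "A (z j) = [gen (x j)]" "B (z j) = []"
  using Xs[OF j(1)] A_eq[OF j(1)] S_iff[OF j(1)] j by (auto simp: T_def)

lemma Y_simps:
  assumes "fst a \<in> Y j"
  shows "fst a \<in> X" "fst a \<notin> S" "psi a = [gen (x j), a, inv_letter (gen (x j))]" 
    "qsi a = [inv_letter (gen (x j)), a, gen (x j)]"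
proof -
  show "fst a \<in> X" "fst a \<notin> S" using assms Y_S[OF j(1)] by auto
  have "A (fst a) = [gen (x j)]" "B (fst a) = [gen (x j)]"
    using assms Y[OF j(1)] A_eq[OF j(1), of "fst a"] j by auto
  then show "psi a = [gen (x j), a, inv_letter (gen (x j))]" "qsi a = [inv_letter (gen (x j)), a, gen (x j)]"
    by (cases a; simp add: psi_def qsi_def Let_def inv_letter_def)+
qed

lemma step_x: "state st \<Longrightarrow> step (inv_letter (gen (x j))) (step (gen (x j)) st) = st"
    "state st \<Longrightarrow> step (gen (x j)) (step (inv_letter (gen (x j))) st) = st"
  using step_inv_letter[of "gen (x j)" st] step_inv_letter[of "inv_letter (gen (x j))" st] xz_simps by auto

text \<open>Each y is x^-1 y' x in terms of the new generator y', and in a product the inner factors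
  x x^-1 cancel.\<close>

lemma qact_Y: "v \<in> words (Y j) \<Longrightarrow> state st \<Longrightarrow>
    qact v st = step (inv_letter (gen (x j))) (act v (step (gen (x j)) st))"
proof (induction v)
  case (Cons a v)
  then have a: "fst a \<in> Y j" and v: "v \<in> words (Y j)" by auto
  have "v \<in> words X" using words_mono[OF v] Y_S[OF j(1)] by blast
  then have "state (act v (step (gen (x j)) st))" using Cons.prems xz_simps by (intro state_act state_step) simp_all
  with Cons.IH[OF v Cons.prems(2)] show ?case by (simp add: Y_simps[OF a] step_x)
qed (simp add: step_x)

lemma val_conj_Cons:
  assumes "a # v \<in> words X"
  shows "val ([gen (x j)] @ (a # v) @ [inv_letter (gen (x j))])
    = val [gen (x j), a, inv_letter (gen (x j))] \<otimes>\<^bsub>G\<^esub> val ([gen (x j)] @ v @ [inv_letter (gen (x j))])"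
proof -
  let ?x = "[gen (x j)]" and ?x' = "[inv_letter (gen (x j))]"
  have words: "?x \<in> words X" "?x' \<in> words X" "[a] \<in> words X" "v \<in> words X" using assms xz_simps by auto
  have "val (?x @ [a] @ ?x') \<otimes>\<^bsub>G\<^esub> val (?x @ v @ ?x')
      = val ?x \<otimes>\<^bsub>G\<^esub> (val [a] \<otimes>\<^bsub>G\<^esub> ((val ?x' \<otimes>\<^bsub>G\<^esub> val ?x) \<otimes>\<^bsub>G\<^esub> (val v \<otimes>\<^bsub>G\<^esub> val ?x')))"
    using words by (simp only: val.h_append words_append val.N.m_assoc val.h_closed val.N.m_closed)
  also have "val ?x' \<otimes>\<^bsub>G\<^esub> val ?x = \<one>\<^bsub>G\<^esub>"
    using val_letter_inv[of "inv_letter (gen (x j))"] xz_simps by simp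
  also have "val ?x \<otimes>\<^bsub>G\<^esub> (val [a] \<otimes>\<^bsub>G\<^esub> (\<one>\<^bsub>G\<^esub> \<otimes>\<^bsub>G\<^esub> (val v \<otimes>\<^bsub>G\<^esub> val ?x'))) = val (?x @ [a] @ v @ ?x')"
    using words by (simp only: val.h_append words_append val.N.l_one val.h_closed val.N.m_closed)
  finally show ?thesis by simp
qed

lemma act_Y: "v \<in> words (Y j) \<Longrightarrow> state st \<Longrightarrow>
    act v st = (val ([gen (x j)] @ v @ [inv_letter (gen (x j))]) \<otimes>\<^bsub>G\<^esub> fst st, snd st)"
proof (induction v)
  case Nil
  then show ?case
    using val_letter_inv[of "gen (x j)"] val.h_append[of "[gen (x j)]" "[inv_letter (gen (x j))]"] xz_simps
    by (simp add: state_def)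
next
  case (Cons a v)
  then have a: "fst a \<in> Y j" and v: "v \<in> words (Y j)" by auto
  have "v \<in> words X" using words_mono[OF v] Y_S[OF j(1)] by blast
  then have words: "[gen (x j)] @ v @ [inv_letter (gen (x j))] \<in> words X" "a # v \<in> words X"
    "[gen (x j), a, inv_letter (gen (x j))] \<in> words X"
    using xz_simps Y_simps[OF a] by auto
  have "act (a # v) st = (val (psi a) \<otimes>\<^bsub>G\<^esub> (val ([gen (x j)] @ v @ [inv_letter (gen (x j))]) \<otimes>\<^bsub>G\<^esub> fst st), snd st)"
    using Cons.IH[OF v Cons.prems(2)] Y_simps[OF a] by (simp add: step_def)
  then show ?case
    using words Cons.prems(2) unfolding val_conj_Cons[OF words(2)]
    by (simp add: Y_simps[OF a] val.N.m_assoc state_def)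
qed

lemma qsi_z: "qsi (gen (z j)) = [inv_letter (gen (x j)), gen (z j)]"
    "psi (gen (z j)) = [gen (x j), gen (z j)]"
    "qsi (inv_letter (gen (z j))) = [inv_letter (gen (z j)), gen (x j)]"
    "qsi (gen (x j)) = [gen (x j)]" "qsi (inv_letter (gen (x j))) = [inv_letter (gen (x j))]"
  using xz_simps by (simp_all add: qsi_def psi_def Let_def inv_letter_def)

text \<open>In new generators x w z becomes x (x^-1 w' x) (x^-1 z') = w' z', from which x has
  disappeared; w' has the value of x w x^-1 and z' that of x z.\<close>

lemma qact_u:
  assumes w: "w \<in> words (Y j)" and st: "state st"
  shows "qact ([gen (x j)] @ w @ [gen (z j)]) st = (val ([gen (x j)] @ w @ [gen (z j)]) \<otimes>\<^bsub>G\<^esub> fst st, snd st)"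
proof -
  let ?x = "[gen (x j)]" and ?x' = "[inv_letter (gen (x j))]" and ?z = "[gen (z j)]"
  have words: "?x \<in> words X" "?x' \<in> words X" "?z \<in> words X" "w \<in> words X"
    using xz_simps words_mono[OF w] Y_S[OF j(1)] by auto
  have s: "state (step (gen (z j)) st)" using st xz_simps by (auto intro: state_step)
  then have "state (act w (step (gen (z j)) st))" "state (step (inv_letter (gen (x j))) (step (gen (z j)) st))"
    using words xz_simps by (auto intro: state_act state_step)
  then have "qact (?x @ w @ ?z) st = act w (step (gen (z j)) st)"
    using w s by (simp add: qsi_z qact_Y step_x)
  also have "\<dots> = (val (?x @ w @ ?x') \<otimes>\<^bsub>G\<^esub> (val (?x @ ?z) \<otimes>\<^bsub>G\<^esub> fst st), snd st)"
    using act_Y[OF w s] xz_simps by (simp add: step_def qsi_z)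
  also have "val (?x @ w @ ?x') \<otimes>\<^bsub>G\<^esub> (val (?x @ ?z) \<otimes>\<^bsub>G\<^esub> fst st)
     = val ?x \<otimes>\<^bsub>G\<^esub> (val w \<otimes>\<^bsub>G\<^esub> ((val ?x' \<otimes>\<^bsub>G\<^esub> val ?x) \<otimes>\<^bsub>G\<^esub> (val ?z \<otimes>\<^bsub>G\<^esub> fst st)))"
    using words st unfolding state_def
    by (simp only: val.h_append words_append val.N.m_assoc val.h_closed val.N.m_closed)
  also have "val ?x' \<otimes>\<^bsub>G\<^esub> val ?x = \<one>\<^bsub>G\<^esub>"
    using val_letter_inv[of "inv_letter (gen (x j))"] xz_simps by simp
  also have "val ?x \<otimes>\<^bsub>G\<^esub> (val w \<otimes>\<^bsub>G\<^esub> (\<one>\<^bsub>G\<^esub> \<otimes>\<^bsub>G\<^esub> (val ?z \<otimes>\<^bsub>G\<^esub> fst st))) = val (?x @ w @ ?z) \<otimes>\<^bsub>G\<^esub> fst st"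
    using words st unfolding state_def
    by (simp only: val.h_append words_append val.N.m_assoc val.N.l_one val.h_closed val.N.m_closed)
  finally show ?thesis .
qed

text \<open>A prefix x v of the piece becomes v' x, and a prefix z^-1 v of its inverse becomes z'^-1
  v' x. In both, the free letter x occurs once and positively.\<close>

lemma block_u:
  assumes w: "w \<in> words (Y j)"
  shows "block ([gen (x j)] @ w @ [gen (z j)])" "block (inv_word ([gen (x j)] @ w @ [gen (z j)]))"
proof -
  let ?u = "[gen (x j)] @ w @ [gen (z j)]"
  have u: "?u \<in> words X" using xz_simps words_mono[OF w] Y_S[OF j(1)] by auto
  have pos_x: "pos (step (gen (x j)) st)" if "pos st" for st using pos_step_T xz_simps that by blast
  have pos_Y: "pos (act v st) \<longleftrightarrow> pos st" if "v \<in> words (Y j)" for v st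
    using that words_mono Y_S[OF j(1)] pos_act_non_S by blast
  have state_Y: "state (act v (step (gen (x j)) st))" if "v \<in> words (Y j)" "state st" for v st
    using that words_mono[of v "Y j" X] Y_S[OF j(1)] xz_simps by (auto intro!: state_act state_step)
  have "pos (qact p st)" if p: "prefix p ?u" and st: "state st" "pos st" for p st
  proof -
    consider "p = []" | "p = ?u" | v where "p = gen (x j) # v" "prefix v w"
      using p by (cases p) (auto simp: prefix_snoc)
    then show ?thesis
    proof cases
      case 3
      then have v: "v \<in> words (Y j)" using words_prefix w by blast
      then have "qact p st = act v (step (gen (x j)) st)"
        using 3 st state_Y by (simp add: qsi_z qact_Y step_x)
      then show ?thesis using pos_Y[OF v] pos_x st by simp
    qed (use st qact_u[OF w] in \<open>auto simp: pos_def\<close>)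
  qed
  then show "block ?u" using u qact_u[OF w] unfolding block_def by blast
  have inv: "qact (inv_word ?u) st = (val (inv_word ?u) \<otimes>\<^bsub>G\<^esub> fst st, snd st)" if "state st" for st
    using block_inv_word_val[OF u qact_u[OF w] that] .
  have "pos (qact p st)" if p: "prefix p (inv_word ?u)" and st: "state st" "pos st" for p st
  proof -
    consider "p = []" | "p = inv_word ?u" | v where "p = inv_letter (gen (z j)) # v" "prefix v (inv_word w)"
      using p by (cases p) (auto simp: prefix_snoc)
    then show ?thesis
    proof cases
      case 3
      then have v: "v \<in> words (Y j)" using words_prefix[of v "inv_word w" "Y j"] w by simp
      then have "qact p st = step (inv_letter (gen (z j))) (act v (step (gen (x j)) st))"
        using 3 st state_Y by (simp add: qsi_z qact_Y step_x)
      then show ?thesis using pos_Y[OF v, of "step (gen (x j)) st"] pos_x st xz_simps by (simp add: pos_def step_def)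
    qed (use st inv in \<open>auto simp: pos_def\<close>)
  qed
  then show "block (inv_word ?u)" using u inv unfolding block_def by (metis words_inv_word)
qed

end

lemma block_U:
  assumes "u \<in> U"
  shows "block u" "block (inv_word u)"
proof -
  obtain j w where j: "j \<in> {1..l}" "w \<in> W j" "u = [gen (x j)] @ w @ [gen (z j)]" using assms U by auto
  have w: "w \<in> words (Y j)" using W j by auto
  have "block u \<and> block (inv_word u)"
  proof (cases "x j = z j")
    case True
    have "w \<in> words (Xs j)" by (rule words_mono[OF w]) (use Y j in auto)
    then have "u \<in> words (Xs j)" using j Xs[OF j(1)] by auto
    then show ?thesis using block_Xs[OF j(1) True] by simp
  next
    case False
    then show ?thesis using block_u[OF j(1) False w] j by simp
  qed
  then show "block u" "block (inv_word u)" by auto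
qed

lemma block_r: "i \<in> I \<Longrightarrow> block (r i)"
proof -
  assume "i \<in> I"
  then obtain us where "us \<in> lists (U \<union> inv_word ` U)" "r i = concat us"
    using relator_concatenation by (auto simp: concatenations_def)
  then show ?thesis using block_U by (auto intro!: block_concat)
qed

section \<open>Units of the prefix monoid\<close>

definition PU where "PU = {g \<in> P. inv\<^bsub>G\<^esub> g \<in> P}"

lemma PU_closed: "g \<in> PU \<Longrightarrow> g \<in> carrier G"
  using P_closed by (auto simp: PU_def)

lemma PU_mult: "g \<in> PU \<Longrightarrow> h \<in> PU \<Longrightarrow> g \<otimes>\<^bsub>G\<^esub> h \<in> PU"
  using PU_closed[of g] PU_closed[of h] by (simp add: PU_def G.inv_mult_group P_mult)

lemma PU_inv: "g \<in> PU \<Longrightarrow> inv\<^bsub>G\<^esub> g \<in> PU"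
  using PU_closed[of g] by (simp add: PU_def)

lemma inv_mult_cancel:
  assumes "g \<in> carrier G" "h \<in> carrier G"
  shows "inv\<^bsub>G\<^esub> g \<otimes>\<^bsub>G\<^esub> (g \<otimes>\<^bsub>G\<^esub> h) = h"
  using assms by (simp add: val.N.m_assoc[symmetric])

lemma PU_one: "\<one>\<^bsub>G\<^esub> \<in> PU"
  using P_one by (simp add: PU_def)

lemma U_PU: "u \<in> U \<Longrightarrow> val u \<in> PU"
  using unit_prefix_P[of u u] unital U_words val_inv_word[of u] by (auto simp: PU_def)

lemma xz_PU:
  assumes "j \<in> {1..l}" "w \<in> W j"
  shows "val ([gen (x j)] @ w @ [gen (z j)]) \<in> PU"
  using assms by (intro U_PU) (auto simp: U)

lemma x_P: "j \<in> {1..l} \<Longrightarrow> val [gen (x j)] \<in> P"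
proof -
  assume j: "j \<in> {1..l}"
  have "[gen (x j)] @ [] @ [gen (z j)] \<in> U" unfolding U using j W_Nil[OF j] by blast
  then show "val [gen (x j)] \<in> P"
    using U_words by (intro unit_prefix_P(1)[OF _ unital]) auto
qed

lemma red_words: "w \<in> words X \<Longrightarrow> red w \<in> words X"
  by (induction w) (auto split: list.splits)

lemma val_red: "w \<in> words X \<Longrightarrow> val (red w) = val w"
proof (induction w)
  case (Cons a w)
  then have w: "w \<in> words X" "fst a \<in> X" "red w \<in> words X" using red_words by auto
  show ?case
  proof (cases "red w")
    case Nil
    then show ?thesis using Cons.IH w val_Cons[of a w] by simp
  next
    case (Cons b v)
    have bv: "fst b \<in> X" "v \<in> words X" using w Cons by auto
    have IH: "val w = val [b] \<otimes>\<^bsub>G\<^esub> val v" using Cons.IH w Cons bv val_Cons[of b v] by simp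
    have aw: "val (a # w) = val [a] \<otimes>\<^bsub>G\<^esub> (val [b] \<otimes>\<^bsub>G\<^esub> val v)" using val_Cons[of a w] w IH by simp
    show ?thesis
    proof (cases "b = inv_letter a")
      case True
      then show ?thesis using Cons aw w bv val_letter_inv[of a] by (simp add: val.N.m_assoc[symmetric])
    next
      case False
      then show ?thesis using Cons aw w bv val_Cons[of a "b # v"] val_Cons[of b v] by simp
    qed
  qed
qed simp

text \<open>For v in \<open>W j\<close>, x v x^-1 is the quotient of the pieces x v z and x z.
  Conjugation by x respects products and inverses, which covers all concatenations.\<close>

lemma conj_PU:
  assumes j: "j \<in> {1..l}" and w: "w \<in> concatenations (W j)"
  shows "w \<in> words X" "val [gen (x j)] \<otimes>\<^bsub>G\<^esub> (val w \<otimes>\<^bsub>G\<^esub> inv\<^bsub>G\<^esub> (val [gen (x j)])) \<in> PU"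
proof -
  let ?x = "val [gen (x j)]" and ?z = "val [gen (z j)]"
  have xz: "?x \<in> carrier G" "?z \<in> carrier G" using Xs[OF j] by auto
  have WX: "W j \<subseteq> words X" using W[OF j] Y_S[OF j] words_mono by blast
  have W1: "?x \<otimes>\<^bsub>G\<^esub> (val v \<otimes>\<^bsub>G\<^esub> inv\<^bsub>G\<^esub> ?x) \<in> PU" if v: "v \<in> W j" for v
  proof -
    have vX: "v \<in> words X" using v WX by auto
    have zx: "?z \<otimes>\<^bsub>G\<^esub> (inv\<^bsub>G\<^esub> ?z \<otimes>\<^bsub>G\<^esub> inv\<^bsub>G\<^esub> ?x) = inv\<^bsub>G\<^esub> ?x"
      using xz by (simp add: val.N.m_assoc[symmetric])
    have "val ([gen (x j)] @ v @ [gen (z j)]) \<otimes>\<^bsub>G\<^esub> inv\<^bsub>G\<^esub> (val ([gen (x j)] @ [] @ [gen (z j)])) \<in> PU"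
      using v W_Nil[OF j] by (intro PU_mult PU_inv xz_PU[OF j])
    also have "val ([gen (x j)] @ v @ [gen (z j)]) \<otimes>\<^bsub>G\<^esub> inv\<^bsub>G\<^esub> (val ([gen (x j)] @ [] @ [gen (z j)]))
       = ?x \<otimes>\<^bsub>G\<^esub> (val v \<otimes>\<^bsub>G\<^esub> inv\<^bsub>G\<^esub> ?x)"
      using vX xz zx Xs[OF j] val.h_append[of "[gen (x j)]" "[gen (z j)]"] val.h_append[of "[gen (x j)]" "v @ [gen (z j)]"]
      by (simp add: val.h_append[of v] G.inv_mult_group val.N.m_assoc subset_iff)
    finally show ?thesis .
  qed
  have W2: "?x \<otimes>\<^bsub>G\<^esub> (val v \<otimes>\<^bsub>G\<^esub> inv\<^bsub>G\<^esub> ?x) \<in> PU \<and> v \<in> words X" if v: "v \<in> W j \<union> inv_word ` W j" for v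
    using v
  proof
    assume "v \<in> inv_word ` W j"
    then obtain v' where v': "v' \<in> W j" "v = inv_word v'" by auto
    have X': "v' \<in> words X" using WX v' by auto
    have "inv\<^bsub>G\<^esub> (?x \<otimes>\<^bsub>G\<^esub> (val v' \<otimes>\<^bsub>G\<^esub> inv\<^bsub>G\<^esub> ?x)) = ?x \<otimes>\<^bsub>G\<^esub> (val v \<otimes>\<^bsub>G\<^esub> inv\<^bsub>G\<^esub> ?x)"
      using xz X' v' by (simp add: G.inv_mult_group val_inv_word val.N.m_assoc)
    with PU_inv[OF W1[OF v'(1)]] X' v' show ?thesis by simp
  qed (use W1 WX in auto)
  have "concat vs \<in> words X \<and> ?x \<otimes>\<^bsub>G\<^esub> (val (concat vs) \<otimes>\<^bsub>G\<^esub> inv\<^bsub>G\<^esub> ?x) \<in> PU"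
    if "vs \<in> lists (W j \<union> inv_word ` W j)" for vs
    using that
  proof (induction vs)
    case Nil
    show ?case using xz PU_one by simp
  next
    case (Cons v vs)
    let ?g = "val v" and ?h = "val (concat vs)"
    have words: "v \<in> words X" "concat vs \<in> words X" using W2 Cons by auto
    have "(?x \<otimes>\<^bsub>G\<^esub> (?g \<otimes>\<^bsub>G\<^esub> inv\<^bsub>G\<^esub> ?x)) \<otimes>\<^bsub>G\<^esub> (?x \<otimes>\<^bsub>G\<^esub> (?h \<otimes>\<^bsub>G\<^esub> inv\<^bsub>G\<^esub> ?x)) \<in> PU"
      using Cons W2 by (rule_tac PU_mult[of "_ \<otimes>\<^bsub>G\<^esub> _" "?x \<otimes>\<^bsub>G\<^esub> (?h \<otimes>\<^bsub>G\<^esub> _)"]) auto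
    also have "(?x \<otimes>\<^bsub>G\<^esub> (?g \<otimes>\<^bsub>G\<^esub> inv\<^bsub>G\<^esub> ?x)) \<otimes>\<^bsub>G\<^esub> (?x \<otimes>\<^bsub>G\<^esub> (?h \<otimes>\<^bsub>G\<^esub> inv\<^bsub>G\<^esub> ?x))
        = ?x \<otimes>\<^bsub>G\<^esub> (val (concat (v # vs)) \<otimes>\<^bsub>G\<^esub> inv\<^bsub>G\<^esub> ?x)"
      using xz words by (simp add: val.h_append val.N.m_assoc inv_mult_cancel)
    finally show ?case using words by simp
  qed
  then show "w \<in> words X" "?x \<otimes>\<^bsub>G\<^esub> (val w \<otimes>\<^bsub>G\<^esub> inv\<^bsub>G\<^esub> ?x) \<in> PU"
    using w by (auto simp: concatenations_def)
qed

text \<open>Free reduction does not change the value in G, so each y in \<open>Y j\<close> may be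
  replaced by a word to which \<open>conj_PU\<close> applies.\<close>

lemma psi_gen_PU:
  assumes "y \<in> X - S"
  shows "val (psi (gen y)) \<in> PU"
proof -
  obtain j where j: "j \<in> {1..l}" "y \<in> Xs j" using assms by (auto simp: S_def)
  let ?x = "val [gen (x j)]" and ?z = "val [gen (z j)]" and ?y = "val [gen y]"
  have xz: "x j \<in> X" "z j \<in> X" "?x \<in> carrier G" "?z \<in> carrier G" "?y \<in> carrier G"
    using Xs[OF j(1)] assms by auto
  have xzP: "val [gen (x j), gen (z j)] \<in> PU" using xz_PU[OF j(1) W_Nil[OF j(1)]] by simp
  have Y1: "?x \<otimes>\<^bsub>G\<^esub> (?y \<otimes>\<^bsub>G\<^esub> inv\<^bsub>G\<^esub> ?x) \<in> PU" if y: "y \<in> Y j"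
  proof -
    obtain w where w: "w \<in> concatenations (W j)" "[gen y] = red w" using W_red[OF j(1) y] by blast
    have "?y = val w" unfolding w(2) by (rule val_red) (rule conj_PU[OF j(1) w(1)])
    with conj_PU(2)[OF j(1) w(1)] show ?thesis by simp
  qed
  show ?thesis
  proof (cases "x j = z j")
    case True
    then have xx: "?x \<otimes>\<^bsub>G\<^esub> ?x \<in> PU" using xzP xz val.h_append[of "[gen (x j)]" "[gen (x j)]"] by simp
    \<comment> \<open>The inverse of x is the unit (x x)^-1 times x, where x lies in
      \<open>P\<close> as a prefix of the piece x x.\<close>
    have "inv\<^bsub>G\<^esub> (?x \<otimes>\<^bsub>G\<^esub> ?x) \<otimes>\<^bsub>G\<^esub> ?x \<in> P" using xx x_P[OF j(1)] by (auto simp: PU_def intro: P_mult)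
    also have "inv\<^bsub>G\<^esub> (?x \<otimes>\<^bsub>G\<^esub> ?x) \<otimes>\<^bsub>G\<^esub> ?x = inv\<^bsub>G\<^esub> ?x"
      using xz by (simp add: G.inv_mult_group val.N.m_assoc)
    finally have x: "?x \<in> PU" using x_P[OF j(1)] by (simp add: PU_def)
    have psi: "psi (gen y) = [gen y]" using A_eq[OF j] True by (simp add: psi_def)
    show ?thesis
    proof (cases "y = x j")
      case False
      then have "y \<in> Y j" using Y[OF j(1)] j True by simp
      from PU_mult[OF PU_inv[OF x] PU_mult[OF Y1[OF this] x]] show ?thesis
        using xz by (simp add: psi val.N.m_assoc inv_mult_cancel)
    qed (use x psi in simp)
  next
    case False
    have y: "y \<noteq> x j" using S_iff[OF j] False assms by auto
    show ?thesis
    proof (cases "y = z j")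
      case True
      then show ?thesis using xzP qsi_z(2)[OF j(1) False] by simp
    next
      case False': False
      then have "y \<in> Y j" using Y[OF j(1)] j y by simp
      moreover have "psi (gen y) = [gen (x j), gen y] @ inv_word [gen (x j)]"
        using A_eq[OF j] False False' y by (simp add: psi_def)
      ultimately show ?thesis
        using Y1 xz assms val.h_append[of "[gen (x j), gen y]" "inv_word [gen (x j)]"] val_Cons[of "gen (x j)" "[gen y]"]
          val_inv_word[of "[gen (x j)]"] by (simp add: val.N.m_assoc)
    qed
  qed
qed

sublocale free_factor_blocks X I r S T A B
proof
  show "block (r i)" if "i \<in> I" for i by (rule block_r[OF that])
  show "val (psi a) \<in> P" if "fst a \<in> X - S" for a
  proof -
    have 1: "val (psi (gen (fst a))) \<in> PU" by (rule psi_gen_PU) fact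
    have w: "psi (gen (fst a)) \<in> words X" using that by (intro psi_words) auto
    from gen_cases[of a] show ?thesis
    proof
      assume "a = gen (fst a)"
      then have "psi a = psi (gen (fst a))" by simp
      then show ?thesis using 1 by (simp add: PU_def)
    next
      assume "a = inv_letter (gen (fst a))"
      then have "psi a = inv_word (psi (gen (fst a)))" using psi_inv_letter[of "gen (fst a)"] by simp
      then show ?thesis using 1 w by (simp add: PU_def val_inv_word)
    qed
  qed
  show "val [gen s] \<in> P" if "s \<in> T" for s using that x_P by (auto simp: T_def)
qed

end

section \<open>Computing with codes of words\<close>

lemma recursive_Bex_finite:
  assumes "finite A" "\<And>a. a \<in> A \<Longrightarrow> recursive n (\<lambda>xs. of_bool (Q a xs))"
  shows "recursive n (\<lambda>xs. of_bool (\<exists>a\<in>A. Q a xs))"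
  using assms
proof (induction A)
  case empty
  show ?case using recursive_const[of n 0] by simp
next
  case (insert a A)
  then have "recursive n (\<lambda>xs. of_bool (Q a xs \<or> (\<exists>a\<in>A. Q a xs)))" by (intro recursive_disj) auto
  then show ?case by simp
qed

text \<open>A generator and its inverse have codes 2 m and 2 m + 1. The formula swaps them: c + 1
  for even c, c - 1 for odd c.\<close>

definition inv_code :: "nat \<Rightarrow> nat" where "inv_code c = Suc c - 2 * (c mod 2)"

lemma inv_code_letter_code: "inv_code (letter_code e a) = letter_code e (inv_letter a)"
  by (cases a) (auto simp: inv_code_def inv_letter_def mod_Suc)

lemma recursive_inv_code:
  assumes "recursive n F"
  shows "recursive n (\<lambda>xs. inv_code (F xs))"
proof -
  have "rec_nat 0 (\<lambda>m v. 1 - v) c = c mod 2" for c :: nat by (induction c) (auto simp: mod_Suc)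
  moreover have "recursive n (\<lambda>xs. rec_nat 0 (\<lambda>m v. (\<lambda>ys. 1 - ys ! 1) (m # v # xs)) (F xs))"
    by (rule recursive_rec_nat) (intro recursive_basic assms; simp)+
  ultimately have "recursive n (\<lambda>xs. F xs mod 2)" by simp
  then show ?thesis unfolding inv_code_def by (intro recursive_basic assms)
qed

definition cons_code :: "nat \<Rightarrow> nat \<Rightarrow> nat" where "cons_code a c = Suc (prod_encode (a, c))"

lemma cons_code_list_encode: "cons_code a (list_encode l) = list_encode (a # l)"
  by (simp add: cons_code_def)

lemma recursive_cons_code: "recursive n F \<Longrightarrow> recursive n G \<Longrightarrow> recursive n (\<lambda>xs. cons_code (F xs) (G xs))"
  unfolding cons_code_def by (intro recursive_Suc recursive_prod_encode)

text \<open>Reading from the left and consing inverted letters inverts a word. With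
  \<open>d = 0\<close> this is inversion, and applied to an inverted word it is
  concatenation.\<close>

definition inv_append_code :: "nat \<Rightarrow> nat \<Rightarrow> nat" where
  "inv_append_code c d = foldl (\<lambda>v a. cons_code (inv_code a) v) d (list_decode c)"

lemma recursive_inv_append_code:
  assumes "recursive n F" "recursive n G"
  shows "recursive n (\<lambda>xs. inv_append_code (F xs) (G xs))"
proof -
  have "recursive n (\<lambda>xs. foldl (\<lambda>v a. (\<lambda>ys. cons_code (inv_code (ys ! 1)) (ys ! 0)) (v # a # xs)) (G xs) (list_decode (F xs)))"
    by (rule recursive_foldl) (intro recursive_basic recursive_cons_code recursive_inv_code assms; simp)+
  then show ?thesis by (simp add: inv_append_code_def)
qed

lemma inv_append_code: "inv_append_code (word_code e v) (word_code e w) = word_code e (inv_word v @ w)"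
proof -
  have "foldl (\<lambda>v a. cons_code (inv_code a) v) (word_code e w) (map (letter_code e) v) = word_code e (inv_word v @ w)" for v w
  proof (induction v arbitrary: w)
    case (Cons a v)
    have "cons_code (inv_code (letter_code e a)) (word_code e w) = word_code e (inv_letter a # w)"
      by (simp add: word_code_def cons_code_list_encode inv_code_letter_code)
    then show ?case using Cons[of "inv_letter a # w"] by simp
  qed simp
  then show ?thesis by (simp add: inv_append_code_def word_code_def)
qed

text \<open>Folds over list codes run from the left, whereas a word acts on states from its last
  letter on; reversal mediates.\<close>

definition rev_code :: "nat \<Rightarrow> nat" where
  "rev_code c = foldl (\<lambda>v a. cons_code a v) 0 (list_decode c)"

lemma rev_code: "rev_code (list_encode l) = list_encode (rev l)"
proof -
  have "foldl (\<lambda>v a. cons_code a v) (list_encode k) l = list_encode (rev l @ k)" for k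
    by (induction l arbitrary: k) (simp_all add: cons_code_list_encode del: list_encode.simps)
  from this[of "[]"] show ?thesis by (simp add: rev_code_def)
qed

lemma recursive_rev_code:
  assumes "recursive n F"
  shows "recursive n (\<lambda>xs. rev_code (F xs))"
proof -
  have "recursive n (\<lambda>xs. foldl (\<lambda>v a. (\<lambda>ys. cons_code (ys ! 1) (ys ! 0)) (v # a # xs)) 0 (list_decode (F xs)))"
    by (rule recursive_foldl) (intro recursive_basic recursive_cons_code assms; simp)+
  then show ?thesis by (simp add: rev_code_def)
qed

text \<open>While reading from the left, the inverse of the prefix read so far is updated by consing
  a single letter. The accumulator pairs its code with a success flag. For this reason the tests on
  edges below are phrased with inverses of prefixes.\<close>

lemma recursive_Ex_prefix:
  assumes Q: "recursive (Suc (Suc n)) (\<lambda>ys. of_bool (Q ys))" and L: "recursive n L"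
  shows "recursive n (\<lambda>xs. of_bool (\<exists>p b. prefix (p @ [b]) (list_decode (L xs)) \<and>
    Q (list_encode (rev (map inv_code p)) # b # xs)))"
proof -
  define S where "S = (\<lambda>ys. prod_encode (cons_code (inv_code (ys ! 1)) (fst (prod_decode (ys ! 0))),
     of_bool (snd (prod_decode (ys ! 0)) = 1 \<or> Q (fst (prod_decode (ys ! 0)) # ys ! 1 # drop 2 ys))))"
  have "recursive (Suc (Suc n)) S"
    unfolding S_def
    by (intro recursive_prod_encode recursive_cons_code recursive_inv_code recursive_fst_decode
      recursive_snd_decode recursive_basic recursive_replace2[OF Q]; simp)
  then have 1: "recursive n (\<lambda>xs. snd (prod_decode (foldl (\<lambda>v a. S (v # a # xs)) (prod_encode (0, 0)) (list_decode (L xs)))))"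
    by (intro recursive_snd_decode recursive_foldl recursive_const L)
  have "foldl (\<lambda>v a. S (v # a # xs)) (prod_encode (0, 0)) l = prod_encode (list_encode (rev (map inv_code l)),
     of_bool (\<exists>p b. prefix (p @ [b]) l \<and> Q (list_encode (rev (map inv_code p)) # b # xs)))" for l xs
  proof (induction l rule: rev_induct)
    case (snoc c l)
    have "(\<exists>p b. prefix (p @ [b]) (l @ [c]) \<and> Q (list_encode (rev (map inv_code p)) # b # xs)) \<longleftrightarrow>
      (\<exists>p b. prefix (p @ [b]) l \<and> Q (list_encode (rev (map inv_code p)) # b # xs)) \<or>
      Q (list_encode (rev (map inv_code l)) # c # xs)"
      by auto
    with snoc show ?case
      by (simp add: S_def cons_code_list_encode del: list_encode.simps)
  qed simp
  with 1 show ?thesis by simp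
qed

lemma Ex_prefix_word_code:
  "(\<exists>p b. prefix (p @ [b]) (list_decode (word_code e w)) \<and> Q (list_encode (rev (map inv_code p))) b) \<longleftrightarrow>
   (\<exists>p b. prefix (p @ [b]) w \<and> Q (word_code e (inv_word p)) (letter_code e b))"
proof -
  have code: "list_encode (rev (map inv_code (map (letter_code e) p))) = word_code e (inv_word p)" for p
    by (simp add: word_code_def inv_word_def rev_map o_def inv_code_letter_code)
  have "(\<exists>p b. prefix (p @ [b]) (map (letter_code e) w) \<and> R p b) \<longleftrightarrow>
    (\<exists>p b. prefix (p @ [b]) w \<and> R (map (letter_code e) p) (letter_code e b))" for R
  proof
    assume "\<exists>p b. prefix (p @ [b]) (map (letter_code e) w) \<and> R p b"
    then obtain p b s where "map (letter_code e) w = (p @ [b]) @ s" "R p b" by (auto simp: prefix_def)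
    then obtain p' b' s' where "w = p' @ b' # s'" "R (map (letter_code e) p') (letter_code e b')"
      by (force simp: map_eq_append_conv simp del: letter_code.simps)
    then show "\<exists>p b. prefix (p @ [b]) w \<and> R (map (letter_code e) p) (letter_code e b)"
      by (intro exI[of _ p'] exI[of _ b']) simp
  next
    assume "\<exists>p b. prefix (p @ [b]) w \<and> R (map (letter_code e) p) (letter_code e b)"
    then obtain p b where "prefix (p @ [b]) w" "R (map (letter_code e) p) (letter_code e b)" by blast
    then show "\<exists>p b. prefix (p @ [b]) (map (letter_code e) w) \<and> R p b"
      using map_mono_prefix[of "p @ [b]" w "letter_code e"] by auto
  qed
  note this[of "\<lambda>p b. Q (list_encode (rev (map inv_code p))) b"]
  then show ?thesis unfolding code by (simp add: word_code_def)
qed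

locale coded_presentation = special_presentation X I r
  for X :: "'x set" and I :: "'i set" and r :: "'i \<Rightarrow> 'x word" +
  fixes e :: "'x \<Rightarrow> nat" and f :: "nat list \<Rightarrow> nat"
  assumes finite_X: "finite X" and inj_e: "inj_on e X" and f_recursive: "recursive 2 f"
    and f: "v \<in> words X \<Longrightarrow> w \<in> words X \<Longrightarrow> f [word_code e v, word_code e w] = (if val v = val w then 1 else 0)"
begin

abbreviation lc where "lc \<equiv> letter_code e"
abbreviation wc where "wc \<equiv> word_code e"

lemma lc_eq_iff: "fst a \<in> X \<Longrightarrow> fst b \<in> X \<Longrightarrow> lc a = lc b \<longleftrightarrow> a = b"
proof -
  assume ab: "fst a \<in> X" "fst b \<in> X"
  obtain y c y' c' where [simp]: "a = (y, c)" "b = (y', c')" by fastforce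
  have "lc a = lc b \<longleftrightarrow> e y = e y' \<and> c = c'" by (cases c; cases c') (simp_all, presburger+)
  then show ?thesis using ab inj_on_eq_iff[OF inj_e] by simp
qed

lemma wc_simps: "wc [] = 0" "cons_code (lc a) (wc w) = wc (a # w)"
  by (simp_all add: word_code_def cons_code_def)

lemma recursive_val_eq:
  assumes "recursive n F" "recursive n H"
  shows "recursive n (\<lambda>xs. of_bool (f [F xs, H xs] = 1))"
  by (rule recursive_eq[OF recursive_apply2[OF f_recursive assms] recursive_const])

end

context coded_presentation
begin

lemma recursive_append_const:
  "recursive n F \<Longrightarrow> recursive n (\<lambda>xs. foldr (\<lambda>a. cons_code (lc a)) p (F xs))"
  by (induction p) (auto intro: recursive_cons_code recursive_const)

lemma append_const: "foldr (\<lambda>a. cons_code (lc a)) p (wc w) = wc (p @ w)"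
  by (induction p) (auto simp: wc_simps)

end

subsection \<open>The prefix membership problem\<close>

locale coded_free_factor = free_factor_blocks X I r S T A B + coded_presentation X I r e f
  for X :: "'x set" and I :: "'i set" and r :: "'i \<Rightarrow> 'x word" and S T A B e f
begin

text \<open>\<open>step\<close> with elements of G replaced by representing words. These are not
  unique, but the only comparison made is that of the front component with 1.\<close>

definition word_step :: "'x letter \<Rightarrow> 'x word \<times> ('x letter \<times> 'x word) list \<Rightarrow> 'x word \<times> ('x letter \<times> 'x word) list" where
  "word_step a = (\<lambda>(k, l). if fst a \<in> S then
       (if l \<noteq> [] \<and> fst (hd l) = inv_letter a \<and> val k = \<one>\<^bsub>G\<^esub> then (snd (hd l), tl l) else ([], (a, k) # l))
     else (psi a @ k, l))"

definition word_state where
  "word_state = (\<lambda>(k, l). k \<in> words X \<and> (\<forall>(s, h)\<in>set l. fst s \<in> X \<and> h \<in> words X))"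

definition val_state where "val_state = (\<lambda>(k, l). (val k, map (\<lambda>(s, h). (s, val h)) l))"

definition pair_code where "pair_code = (\<lambda>(s, h). prod_encode (lc s, wc h))"

definition state_code where "state_code = (\<lambda>(k, l). prod_encode (wc k, list_encode (map pair_code l)))"

lemma word_state_step: "fst a \<in> X \<Longrightarrow> word_state ws \<Longrightarrow> word_state (word_step a ws)"
  using psi_words[of a]
  by (cases ws; cases "snd ws") (auto simp: word_state_def word_step_def)

lemma val_state_step:
  assumes "fst a \<in> X" "word_state ws"
  shows "val_state (word_step a ws) = step a (val_state ws)"
proof -
  obtain k l where ws: "ws = (k, l)" by fastforce
  show ?thesis
  proof (cases l)
    case Nil
    then show ?thesis using assms psi_words[OF assms(1)]
      by (simp add: ws word_state_def word_step_def val_state_def step_def val.h_append)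
  next
    case (Cons c l')
    obtain s h where "c = (s, h)" by fastforce
    then show ?thesis using Cons assms psi_words[OF assms(1)]
      by (simp add: ws word_state_def word_step_def val_state_def step_def val.h_append)
  qed
qed

text \<open>0 is the code of the empty word, so \<open>f [_, 0]\<close> asks whether the front
  component is 1 in G. It is also the code of the empty list of syllables, and subtracting 1 undoes
  the successor in the code of a nonempty one.\<close>

definition step_code :: "'x letter \<Rightarrow> nat \<Rightarrow> nat" where
  "step_code a c = (if fst a \<in> S then
      (if snd (prod_decode c) \<noteq> 0 \<and>
          fst (prod_decode (fst (prod_decode (snd (prod_decode c) - Suc 0)))) = lc (inv_letter a) \<and>
          f [fst (prod_decode c), 0] = 1
       then prod_encode (snd (prod_decode (fst (prod_decode (snd (prod_decode c) - Suc 0)))),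
          snd (prod_decode (snd (prod_decode c) - Suc 0)))
       else prod_encode (0, cons_code (prod_encode (lc a, fst (prod_decode c))) (snd (prod_decode c))))
    else prod_encode (foldr (\<lambda>a. cons_code (lc a)) (psi a) (fst (prod_decode c)), snd (prod_decode c)))"

lemma recursive_step_code:
  assumes "recursive n F"
  shows "recursive n (\<lambda>xs. step_code a (F xs))"
  unfolding step_code_def
  by (cases "fst a \<in> S"; simp only: if_True if_False;
      intro recursive_if recursive_conj recursive_not recursive_val_eq recursive_eq
        recursive_prod_encode recursive_cons_code
        recursive_append_const recursive_fst_decode recursive_snd_decode recursive_pred recursive_const assms)

lemma step_code:
  assumes a: "fst a \<in> X" and ws: "word_state ws"
  shows "step_code a (state_code ws) = state_code (word_step a ws)"
proof -
  obtain k l where kl: "ws = (k, l)" by fastforce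
  have k: "f [wc k, 0] = (if val k = \<one>\<^bsub>G\<^esub> then 1 else 0)"
    using f[of k "[]"] ws kl wc_simps by (simp add: word_state_def)
  show ?thesis
  proof (cases "fst a \<in> S")
    case False
    then show ?thesis by (simp add: kl step_code_def state_code_def word_step_def append_const)
  next
    case True
    show ?thesis
    proof (cases l)
      case Nil
      then show ?thesis using True
        by (simp add: kl step_code_def state_code_def word_step_def pair_code_def cons_code_def wc_simps)
    next
      case (Cons c l')
      obtain s h where c: "c = (s, h)" by fastforce
      have "lc s = lc (inv_letter a) \<longleftrightarrow> s = inv_letter a"
        using ws a kl Cons c by (intro lc_eq_iff) (auto simp: word_state_def)
      then show ?thesis using True k
        by (simp add: kl Cons c step_code_def state_code_def word_step_def pair_code_def cons_code_def wc_simps)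
    qed
  qed
qed

definition word_act where "word_act v = foldr word_step v"
definition act_code where "act_code v = foldr step_code v"

lemma word_act:
  assumes "v \<in> words X" "word_state ws"
  shows "word_state (word_act v ws)" "val_state (word_act v ws) = act v (val_state ws)"
    "act_code v (state_code ws) = state_code (word_act v ws)"
proof -
  have "word_state (word_act v ws) \<and> val_state (word_act v ws) = act v (val_state ws) \<and>
    act_code v (state_code ws) = state_code (word_act v ws)"
    using assms
    by (induction v) (auto simp: word_act_def act_code_def word_state_step val_state_step step_code)
  then show "word_state (word_act v ws)" "val_state (word_act v ws) = act v (val_state ws)"
    "act_code v (state_code ws) = state_code (word_act v ws)" by auto
qed

lemma recursive_act_code: "recursive n F \<Longrightarrow> recursive n (\<lambda>xs. act_code v (F xs))"
  by (induction v) (simp_all add: act_code_def recursive_step_code)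

definition word_qact where "word_qact w = foldr (\<lambda>a. word_act (qsi a)) w ([], [])"

lemma word_qact:
  assumes "w \<in> words X"
  shows "word_state (word_qact w)" "val_state (word_qact w) = qact w (\<one>\<^bsub>G\<^esub>, [])"
    "foldr (\<lambda>a. act_code (qsi a)) w 0 = state_code (word_qact w)"
proof -
  \<comment> \<open>Thus 0 codes the initial state, in which both components are empty.\<close>
  have "prod_encode (0, 0) = 0" by (simp add: prod_encode_def)
  then have "word_state (word_qact w) \<and> val_state (word_qact w) = qact w (\<one>\<^bsub>G\<^esub>, []) \<and>
    foldr (\<lambda>a. act_code (qsi a)) w 0 = state_code (word_qact w)"
    using assms
  proof (induction w)
    case Nil
    then show ?case by (simp add: word_qact_def word_state_def val_state_def state_code_def wc_simps)
  next
    case (Cons a w)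
    have "word_qact (a # w) = word_act (qsi a) (word_qact w)" by (simp add: word_qact_def)
    with Cons show ?case by (simp add: word_act qsi_words)
  qed
  then show "word_state (word_qact w)" "val_state (word_qact w) = qact w (\<one>\<^bsub>G\<^esub>, [])"
    "foldr (\<lambda>a. act_code (qsi a)) w 0 = state_code (word_qact w)" by auto
qed

lemma pos_val_state:
  assumes "word_state ws"
  shows "pos (val_state ws) \<longleftrightarrow> (\<forall>c\<in>set (list_decode (snd (prod_decode (state_code ws)))).
    \<exists>t\<in>(\<lambda>s. lc (gen s)) ` T. fst (prod_decode c) = t)"
proof -
  obtain k l where kl: "ws = (k, l)" by fastforce
  have TX: "T \<subseteq> X" using T_S S_X by blast
  have 1: "(fst s \<in> T \<and> snd s) \<longleftrightarrow> (\<exists>t\<in>(\<lambda>s. lc (gen s)) ` T. fst (prod_decode (pair_code (s, h))) = t)"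
    if "(s, h) \<in> set l" for s h
  proof -
    have "fst s \<in> X" using assms that by (auto simp: kl word_state_def)
    then have "(\<exists>t\<in>T. lc s = lc (gen t)) \<longleftrightarrow> (\<exists>t\<in>T. s = gen t)" using TX by (intro bex_cong refl lc_eq_iff) auto
    then show ?thesis by (cases s) (auto simp: pair_code_def)
  qed
  have "pos (val_state ws) \<longleftrightarrow> (\<forall>(s, h)\<in>set l. fst s \<in> T \<and> snd s)"
    by (auto simp: kl pos_def val_state_def split: prod.splits)
  also have "\<dots> \<longleftrightarrow> (\<forall>c\<in>set l. \<exists>t\<in>(\<lambda>s. lc (gen s)) ` T. fst (prod_decode (pair_code c)) = t)"
    using 1 by (intro ball_cong) (auto simp del: letter_code.simps)
  finally show ?thesis by (simp add: kl state_code_def)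
qed

lemma recursive_membership:
  obtains fP where "recursive 1 fP" "\<And>w. w \<in> words X \<Longrightarrow> fP [wc w] = (if val w \<in> P then 1 else 0)"
proof -
  let ?L = "X \<times> (UNIV :: bool set)"
  have inj: "inj_on lc ?L" using lc_eq_iff by (auto intro!: inj_onI simp del: letter_code.simps)
  \<comment> \<open>The letter is looked up by its code in a finite table. The third argument is the
    parameter that \<open>recursive_foldl\<close> hands on.\<close>
  obtain K where K: "recursive 3 K"
    "\<And>ys. ys ! 1 \<in> lc ` ?L \<Longrightarrow> K ys = act_code (qsi (inv_into ?L lc (ys ! 1))) (ys ! 0)"
  proof (rule recursive_finite_cases[of "lc ` ?L" 3 "\<lambda>c ys. act_code (qsi (inv_into ?L lc c)) (ys ! 0)" "\<lambda>ys. ys ! 1"])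
    show "finite (lc ` ?L)" using finite_X by simp
    show "recursive 3 (\<lambda>ys. act_code (qsi (inv_into ?L lc c)) (ys ! 0))" for c
      by (intro recursive_act_code rec_proj) simp
    show "recursive 3 (\<lambda>ys. ys ! 1)" by (rule rec_proj) simp
  qed auto
  define St where "St cw = foldl (\<lambda>v a. K (v # a # [cw])) 0 (list_decode (rev_code cw))" for cw
  define fP where "fP = (\<lambda>xs. foldl (\<lambda>v c. (\<lambda>ys. of_bool (ys ! 0 = 1 \<and> (\<exists>t\<in>(\<lambda>s. lc (gen s)) ` T. fst (prod_decode (ys ! 1)) = t)))
     (v # c # xs)) 1 (list_decode (snd (prod_decode (St (xs ! 0))))))"
  have "finite T" using finite_X T_S S_X finite_subset by metis
  have St: "recursive 1 (\<lambda>xs. St (xs ! 0))"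
  proof -
    have "recursive 1 (\<lambda>xs. foldl (\<lambda>v a. K (v # a # xs)) 0 (list_decode (rev_code (xs ! 0))))"
      by (rule recursive_foldl) (use K in \<open>auto intro!: recursive_rev_code recursive_const rec_proj simp: numeral_3_eq_3\<close>)
    then show ?thesis
      by (rule rec_cong) (auto simp: St_def length_Suc_conv)
  qed
  have "recursive 1 fP"
    unfolding fP_def
    by (intro recursive_foldl recursive_snd_decode St recursive_conj recursive_Bex_finite
      recursive_eq recursive_fst_decode recursive_const rec_proj) (use \<open>finite T\<close> in auto)
  moreover have "fP [wc w] = (if val w \<in> P then 1 else 0)" if w: "w \<in> words X" for w
  proof -
    have Ka: "K [v, lc a, c] = act_code (qsi a) v" if "fst a \<in> X" for a v c
    proof -
      have "a \<in> ?L" using that by (cases a) auto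
      with K(2)[of "[v, lc a, c]"] inj show ?thesis by simp
    qed
    have KW: "foldr (\<lambda>a v. K [v, a, c]) (map lc w) 0 = foldr (\<lambda>a. act_code (qsi a)) w 0" for c
      using w by (induction w) (simp_all add: Ka del: letter_code.simps)
    have "St (wc w) = foldr (\<lambda>a v. K [v, a, wc w]) (map lc w) 0"
      unfolding St_def word_code_def rev_code by (simp add: foldr_conv_foldl)
    then have StW: "St (wc w) = state_code (word_qact w)" using KW word_qact[OF w] by simp
    have fold: "foldl (\<lambda>v c. of_bool (v = 1 \<and> R c)) (of_bool b) l = (of_bool (b \<and> (\<forall>c\<in>set l. R c)) :: nat)"
      for R b and l :: "nat list"
    proof (induction l arbitrary: b)
      case (Cons c l)
      have "foldl (\<lambda>v c. of_bool (v = 1 \<and> R c)) (of_bool b) (c # l)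
          = (foldl (\<lambda>v c. of_bool (v = 1 \<and> R c)) (of_bool (b \<and> R c)) l :: nat)"
        by (cases b; cases "R c") simp_all
      then show ?case unfolding Cons by (simp only: list.set ball_simps conj_assoc)
    qed simp
    have "fP [wc w] = of_bool (pos (val_state (word_qact w)))"
      using fold[of _ True] by (simp add: fP_def StW pos_val_state[OF word_qact(1)[OF w]])
    then show ?thesis using val_in_P_iff_pos[OF w] word_qact[OF w] by simp
  qed
  ultimately show thesis by (rule that)
qed

end


subsection \<open>The word problem of the E-unitary image\<close>

context special_presentation
begin

text \<open>An entry records the label of an edge of a relator loop together with a word leading
  from the start of that edge back to the base of the loop. The second set contains the reversed
  edges, which start behind the letter.\<close>

definition relator_edges :: "('x word \<times> 'x letter) set" where
  "relator_edges = {(inv_word t, b) | t b. \<exists>i\<in>I. prefix (t @ [b]) (r i)} \<union>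
     {(inv_word (t @ [b]), inv_letter b) | t b. \<exists>i\<in>I. prefix (t @ [b]) (r i)}"

lemma finite_relator_edges:
  assumes "finite I"
  shows "finite relator_edges"
proof -
  have "{(t, b). \<exists>i\<in>I. prefix (t @ [b]) (r i)} \<subseteq>
    (\<Union>i\<in>I. (\<lambda>p. (butlast p, last p)) ` set (prefixes (r i)))"
    by (force simp: image_iff)
  then have fin: "finite {(t, b). \<exists>i\<in>I. prefix (t @ [b]) (r i)}"
    by (rule finite_subset) (use assms in auto)
  have "relator_edges = (\<lambda>(t, b). (inv_word t, b)) ` {(t, b). \<exists>i\<in>I. prefix (t @ [b]) (r i)} \<union>
    (\<lambda>(t, b). (inv_word (t @ [b]), inv_letter b)) ` {(t, b). \<exists>i\<in>I. prefix (t @ [b]) (r i)}"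
    by (force simp: relator_edges_def)
  then show ?thesis using fin by simp
qed

lemma relator_edges_words: "(s, b) \<in> relator_edges \<Longrightarrow> s \<in> words X \<and> fst b \<in> X"
  using relator_prefixD by (force simp: relator_edges_def)

lemma Ex_prefix_snoc:
  "(\<exists>p b. prefix (p @ [b]) (w @ [c]) \<and> Q p b) \<longleftrightarrow> (\<exists>p b. prefix (p @ [b]) w \<and> Q p b) \<or> Q w c"
  by (simp only: prefix_snoc append1_eq_conv) blast

text \<open>The prefixes \<open>p @ [b]\<close> account for the vertices in front of the letters;
  the final vertex needs a disjunct of its own. This is the form required by
  \<open>recursive_Ex_prefix\<close>.\<close>

lemma cells_edge_iff:
  assumes "w \<in> words X"
  shows "(g, Some a) \<in> cells w \<longleftrightarrow>
    (\<exists>p b. prefix (p @ [b]) w \<and> ((g, Some a) \<in> shift (val p) base_cells \<or> (g, Some a) \<in> shift (val p) (step_edges b))) \<or>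
    (g, Some a) \<in> shift (val w) base_cells"
  using assms
proof (induction w rule: rev_induct)
  case Nil
  then show ?case using base_cells_closed by (simp add: shift_one)
next
  case (snoc c w)
  then have w: "w \<in> words X" "fst c \<in> X" by auto
  have "shift (val w) (shift (val [c]) base_cells) = shift (val (w @ [c])) base_cells"
    using w base_cells_closed by (subst shift_shift) (auto simp: val.h_append)
  then have "cells (w @ [c]) = cells w \<union> (shift (val w) base_cells \<union> shift (val w) (step_edges c) \<union> shift (val (w @ [c])) base_cells)"
    using w by (simp add: cells_append shift_Un)
  then show ?case unfolding Ex_prefix_snoc using snoc.IH[OF w(1)] by blast
qed

lemma edge_shift_step_iff:
  assumes "p \<in> words X" "q \<in> words X" "fst a \<in> X" "fst b \<in> X"
  shows "(val q, Some a) \<in> shift (val p) (step_edges b) \<longleftrightarrow>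
    (a = b \<and> val (inv_word q) = val (inv_word p)) \<or>
    (a = inv_letter b \<and> val (inv_word (q @ [a])) = val (inv_word p))"
proof -
  have inv: "val (inv_word v) = val (inv_word w) \<longleftrightarrow> val v = val w" if "v \<in> words X" "w \<in> words X" for v w
    using that by (metis G.inv_inv val.h_closed val_inv_word)
  have "val q = val (p @ [b]) \<longleftrightarrow> val (q @ [inv_letter b]) = val p"
  proof -
    have "val (q @ [inv_letter b]) = val p \<longleftrightarrow> val q \<otimes>\<^bsub>G\<^esub> val [inv_letter b] \<otimes>\<^bsub>G\<^esub> val [b] = val p \<otimes>\<^bsub>G\<^esub> val [b]"
      using assms by (simp add: val.h_append)
    then show ?thesis
      using assms val_letter_inv[of "inv_letter b"] by (simp add: val.h_append val.N.m_assoc)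
  qed
  then show ?thesis
    using assms inv[of q p] inv[of "q @ [a]" p]
    by (auto simp: step_edges_def shift_insert shift_empty val.h_append[of p])
qed

text \<open>Translated by p^-1, the start of the edge must lead along s to the base of a loop, that
  is into \<open>P\<close>. This leaves one prefix membership question for each relator
  edge.\<close>

lemma edge_shift_base_iff:
  assumes "p \<in> words X" "q \<in> words X"
  shows "(val q, Some a) \<in> shift (val p) base_cells \<longleftrightarrow>
    (\<exists>(s, b)\<in>relator_edges. a = b \<and> val (inv_word p @ q @ s) \<in> P)"
proof -
  have move: "val q = val p \<otimes>\<^bsub>G\<^esub> (g \<otimes>\<^bsub>G\<^esub> val t) \<longleftrightarrow> val (inv_word p @ q @ inv_word t) = g"
    if "g \<in> P" "t \<in> words X" for g t
  proof -
    have g: "g \<in> carrier G" using that P_closed by auto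
    have "val q = val p \<otimes>\<^bsub>G\<^esub> (g \<otimes>\<^bsub>G\<^esub> val t) \<longleftrightarrow> inv\<^bsub>G\<^esub> (val p) \<otimes>\<^bsub>G\<^esub> val q = g \<otimes>\<^bsub>G\<^esub> val t"
      using assms that g G.inv_solve_left'[of "g \<otimes>\<^bsub>G\<^esub> val t" "val p" "val q"] by auto
    also have "\<dots> \<longleftrightarrow> inv\<^bsub>G\<^esub> (val p) \<otimes>\<^bsub>G\<^esub> val q \<otimes>\<^bsub>G\<^esub> inv\<^bsub>G\<^esub> (val t) = g"
      using assms that g G.inv_solve_right'[of g "inv\<^bsub>G\<^esub> (val p) \<otimes>\<^bsub>G\<^esub> val q" "val t"] by auto
    finally show ?thesis using assms that by (simp add: val.h_append val_inv_word val.N.m_assoc)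
  qed
  have "(val q, Some a) \<in> shift (val p) base_cells \<longleftrightarrow>
    (\<exists>g\<in>P. \<exists>i\<in>I. \<exists>t b. prefix (t @ [b]) (r i) \<and> (val q, Some a) \<in> shift (val p) (shift (g \<otimes>\<^bsub>G\<^esub> val t) (step_edges b)))"
    unfolding base_cells_def shift_Un shift_UN by (auto simp: shift_def[of _ "(\<lambda>g. (g, None)) ` P"])
  also have "\<dots> \<longleftrightarrow> (\<exists>g\<in>P. \<exists>i\<in>I. \<exists>t b. prefix (t @ [b]) (r i) \<and>
     (a = b \<and> val (inv_word p @ q @ inv_word t) = g \<or> a = inv_letter b \<and> val (inv_word p @ q @ inv_word (t @ [b])) = g))"
  proof -
    have "(val q, Some a) \<in> shift (val p) (shift (g \<otimes>\<^bsub>G\<^esub> val t) (step_edges b)) \<longleftrightarrow>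
      (a = b \<and> val (inv_word p @ q @ inv_word t) = g \<or> a = inv_letter b \<and> val (inv_word p @ q @ inv_word (t @ [b])) = g)"
      if "g \<in> P" "i \<in> I" "prefix (t @ [b]) (r i)" for g i t b
    proof -
      have t: "t \<in> words X" "fst b \<in> X" "g \<in> carrier G" using relator_prefixD[OF that(3,2)] that(1) P_closed by auto
      have "shift (val p) (shift (g \<otimes>\<^bsub>G\<^esub> val t) (step_edges b)) =
         {(val p \<otimes>\<^bsub>G\<^esub> (g \<otimes>\<^bsub>G\<^esub> val t), Some b), (val p \<otimes>\<^bsub>G\<^esub> (g \<otimes>\<^bsub>G\<^esub> val (t @ [b])), Some (inv_letter b))}"
        using t assms by (simp add: step_edges_def shift_insert shift_empty val.h_append val.N.m_assoc)
      then show ?thesis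
        using move[OF that(1) t(1)] move[OF that(1), of "t @ [b]"] t by auto
    qed
    then show ?thesis by (simp only: cong: bex_cong conj_cong)
  qed
  also have "\<dots> \<longleftrightarrow> (\<exists>i\<in>I. \<exists>t b. prefix (t @ [b]) (r i) \<and>
     (a = b \<and> val (inv_word p @ q @ inv_word t) \<in> P \<or> a = inv_letter b \<and> val (inv_word p @ q @ inv_word (t @ [b])) \<in> P))"
    by blast
  also have "\<dots> \<longleftrightarrow> (\<exists>(s, b)\<in>relator_edges. a = b \<and> val (inv_word p @ q @ s) \<in> P)"
  proof -
    have "(\<exists>i\<in>I. \<exists>t b. prefix (t @ [b]) (r i) \<and> (Q (inv_word t) b \<or> Q (inv_word (t @ [b])) (inv_letter b)))
        \<longleftrightarrow> (\<exists>(s, b)\<in>relator_edges. Q s b)" for Q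
    proof
      assume "\<exists>i\<in>I. \<exists>t b. prefix (t @ [b]) (r i) \<and> (Q (inv_word t) b \<or> Q (inv_word (t @ [b])) (inv_letter b))"
      then obtain i t b where "i \<in> I" "prefix (t @ [b]) (r i)" and Q: "Q (inv_word t) b \<or> Q (inv_word (t @ [b])) (inv_letter b)"
        by blast
      then have "(inv_word t, b) \<in> relator_edges" "(inv_word (t @ [b]), inv_letter b) \<in> relator_edges"
        unfolding relator_edges_def by blast+
      with Q show "\<exists>(s, b)\<in>relator_edges. Q s b" by blast
    next
      assume "\<exists>(s, b)\<in>relator_edges. Q s b"
      then obtain s b where "(s, b) \<in> relator_edges" "Q s b" by blast
      then show "\<exists>i\<in>I. \<exists>t b. prefix (t @ [b]) (r i) \<and> (Q (inv_word t) b \<or> Q (inv_word (t @ [b])) (inv_letter b))"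
        unfolding relator_edges_def by blast
    qed
    from this[of "\<lambda>s b. a = b \<and> val (inv_word p @ q @ s) \<in> P"] show ?thesis .
  qed
  finally show ?thesis .
qed

end

context coded_presentation
begin

lemma cell_cong_decidable:
  assumes "finite I" and fP_recursive: "recursive 1 fP"
    and fP: "\<And>w. w \<in> words X \<Longrightarrow> fP [wc w] = (if val w \<in> P then 1 else 0)"
  obtains h where "recursive 2 h"
    "\<And>v w. v \<in> words X \<Longrightarrow> w \<in> words X \<Longrightarrow> h [wc v, wc w] = (if (v, w) \<in> cell_cong then 1 else 0)"
proof -
  let ?C = "(\<lambda>(s, b). (wc s, lc b)) ` relator_edges"
  \<comment> \<open>The arguments are the codes of \<open>p\<^sup>-\<^sup>1\<close>, \<open>q\<^sup>-\<^sup>1\<close> and \<open>a\<close> in \<open>edge_shift_base_iff\<close>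
    and \<open>edge_shift_step_iff\<close>.\<close>
  define tb where "tb p' q' a \<longleftrightarrow> (\<exists>c\<in>?C. a = snd c \<and>
    fP [inv_append_code (inv_append_code p' 0) (inv_append_code q' (fst c))] = 1)" for p' q' a
  define te where "te p' q' a b \<longleftrightarrow> (a = b \<and> f [q', p'] = 1) \<or>
    (a = inv_code b \<and> f [cons_code (inv_code a) q', p'] = 1)" for p' q' a b
  have rec_tb: "recursive n (\<lambda>xs. of_bool (tb (F xs) (F' xs) (H xs)))"
    if "recursive n F" "recursive n F'" "recursive n H" for n F F' H
    unfolding tb_def
  proof (rule recursive_Bex_finite)
    show "finite ?C" using finite_relator_edges[OF assms(1)] by simp
    show "recursive n (\<lambda>xs. of_bool (H xs = snd c \<and>
        fP [inv_append_code (inv_append_code (F xs) 0) (inv_append_code (F' xs) (fst c))] = 1))" for c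
      by (rule recursive_conj[OF recursive_eq[OF that(3) recursive_const] recursive_eq[OF
            recursive_apply1[OF fP_recursive recursive_inv_append_code[OF
                recursive_inv_append_code[OF that(1) recursive_const] recursive_inv_append_code[OF that(2) recursive_const]]]
            recursive_const]])
  qed
  have rec_te: "recursive n (\<lambda>xs. of_bool (te (F xs) (F' xs) (H xs) (H' xs)))"
    if "recursive n F" "recursive n F'" "recursive n H" "recursive n H'" for n F F' H H'
    unfolding te_def
    by (rule recursive_disj[OF recursive_conj[OF recursive_eq[OF that(3,4)] recursive_val_eq[OF that(2,1)]]
          recursive_conj[OF recursive_eq[OF that(3) recursive_inv_code[OF that(4)]]
            recursive_val_eq[OF recursive_cons_code[OF recursive_inv_code[OF that(3)] that(2)] that(1)]]])
  have tb: "tb (wc (inv_word p)) (wc (inv_word q)) (lc a) \<longleftrightarrow> (val q, Some a) \<in> shift (val p) base_cells"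
    if "p \<in> words X" "q \<in> words X" "fst a \<in> X" for p q a
  proof -
    have app: "inv_append_code (inv_append_code (wc (inv_word p)) 0) (inv_append_code (wc (inv_word q)) (wc s))
      = wc (inv_word p @ q @ s)" for s
      using inv_append_code[of e "inv_word p" "[]"] by (simp add: wc_simps inv_append_code)
    have "tb (wc (inv_word p)) (wc (inv_word q)) (lc a) \<longleftrightarrow>
      (\<exists>(s, b)\<in>relator_edges. lc a = lc b \<and> fP [wc (inv_word p @ q @ s)] = 1)"
      unfolding tb_def bex_simps by (intro bex_cong refl) (clarsimp simp: app simp del: letter_code.simps)
    also have "\<dots> \<longleftrightarrow> (\<exists>(s, b)\<in>relator_edges. a = b \<and> val (inv_word p @ q @ s) \<in> P)"
      using that relator_edges_words fP lc_eq_iff[OF that(3)]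
      by (intro bex_cong refl) (clarsimp simp del: letter_code.simps)
    finally show ?thesis using edge_shift_base_iff[OF that(1,2)] by simp
  qed
  have te: "te (wc (inv_word p)) (wc (inv_word q)) (lc a) (lc b) \<longleftrightarrow> (val q, Some a) \<in> shift (val p) (step_edges b)"
    if "p \<in> words X" "q \<in> words X" "fst a \<in> X" "fst b \<in> X" for p q a b
    using that edge_shift_step_iff[OF that] lc_eq_iff[OF that(3,4)] lc_eq_iff[of a "inv_letter b"]
      f[of "inv_word q" "inv_word p"] f[of "inv_letter a # inv_word q" "inv_word p"]
    by (simp add: te_def inv_code_letter_code wc_simps del: letter_code.simps)
  define edge where "edge q' a cw \<longleftrightarrow> (\<exists>p b. prefix (p @ [b]) (list_decode cw) \<and>
      (tb (list_encode (rev (map inv_code p))) q' a \<or> te (list_encode (rev (map inv_code p))) q' a b)) \<or>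
    tb (inv_append_code cw 0) q' a" for q' a cw
  have edge: "edge (wc (inv_word q)) (lc a) (wc w) \<longleftrightarrow> (val q, Some a) \<in> cells w"
    if "q \<in> words X" "fst a \<in> X" "w \<in> words X" for q a w
  proof -
    have "edge (wc (inv_word q)) (lc a) (wc w) \<longleftrightarrow> (\<exists>p b. prefix (p @ [b]) w \<and>
       (tb (wc (inv_word p)) (wc (inv_word q)) (lc a) \<or> te (wc (inv_word p)) (wc (inv_word q)) (lc a) (lc b))) \<or>
       tb (wc (inv_word w)) (wc (inv_word q)) (lc a)"
      using inv_append_code[of e w "[]"] Ex_prefix_word_code[where e = e and w = w and
          Q = "\<lambda>p' b. tb p' (wc (inv_word q)) (lc a) \<or> te p' (wc (inv_word q)) (lc a) b"]
      unfolding edge_def by (simp only: wc_simps append_Nil2)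
    also have "\<dots> \<longleftrightarrow> (val q, Some a) \<in> cells w"
    proof -
      have "p \<in> words X" "fst b \<in> X" if "prefix (p @ [b]) w" for p b
        using words_prefix[OF that \<open>w \<in> words X\<close>] by auto
      with that show ?thesis
        unfolding cells_edge_iff[OF that(3)] by (simp add: tb te cong: conj_cong)
    qed
    finally show ?thesis .
  qed
  define incl where "incl cv cw \<longleftrightarrow> \<not> (\<exists>q a. prefix (q @ [a]) (list_decode cv) \<and>
    \<not> edge (list_encode (rev (map inv_code q))) a cw)" for cv cw
  have incl: "incl (wc v) (wc w) \<longleftrightarrow> (\<forall>q a. prefix (q @ [a]) v \<longrightarrow> (val q, Some a) \<in> cells w)"
    if "v \<in> words X" "w \<in> words X" for v w
  proof -
    have "q \<in> words X" "fst a \<in> X" if "prefix (q @ [a]) v" for q a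
      using words_prefix[OF that \<open>v \<in> words X\<close>] by auto
    then have "(prefix (q @ [a]) v \<longrightarrow> edge (wc (inv_word q)) (lc a) (wc w)) \<longleftrightarrow>
        (prefix (q @ [a]) v \<longrightarrow> (val q, Some a) \<in> cells w)" for q a
      using edge that by blast
    then show ?thesis
      unfolding incl_def
        Ex_prefix_word_code[where e = e and w = v and Q = "\<lambda>q' a. \<not> edge q' a (wc w)"] by blast
  qed
  \<comment> \<open>The four arguments are the codes of q^-1, of a and of the two words to be
    compared; j selects the word whose subgraph is searched.\<close>
  have rec_edge: "recursive 4 (\<lambda>ys. of_bool (\<not> edge (ys ! 0) (ys ! 1) (ys ! j)))" if "j < 4" for j
  proof -
    define Q where "Q = (\<lambda>zs :: nat list. tb (zs ! 0) (zs ! 2) (zs ! 3) \<or> te (zs ! 0) (zs ! 2) (zs ! 3) (zs ! 1))"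
    have "recursive (Suc (Suc 4)) (\<lambda>zs. of_bool (Q zs))"
      unfolding Q_def by (intro recursive_disj rec_tb rec_te rec_proj) auto
    then have ex: "recursive 4 (\<lambda>ys. of_bool (\<exists>p b. prefix (p @ [b]) (list_decode (ys ! j)) \<and>
        Q (list_encode (rev (map inv_code p)) # b # ys)))"
      by (rule recursive_Ex_prefix) (rule rec_proj[OF that])
    have "recursive 4 (\<lambda>ys. of_bool (\<not> ((\<exists>p b. prefix (p @ [b]) (list_decode (ys ! j)) \<and>
        Q (list_encode (rev (map inv_code p)) # b # ys)) \<or> tb (inv_append_code (ys ! j) 0) (ys ! 0) (ys ! 1))))"
      by (intro recursive_not recursive_disj ex rec_tb recursive_inv_append_code recursive_const rec_proj that) auto
    then show ?thesis by (simp add: edge_def Q_def numeral_2_eq_2 numeral_3_eq_3)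
  qed
  have rec_incl: "recursive 2 (\<lambda>xs. of_bool (incl (xs ! i) (xs ! j)))" if "i < 2" "j < 2" for i j
  proof -
    \<comment> \<open>The offset 2 skips the two arguments put in front by
      \<open>recursive_Ex_prefix\<close>.\<close>
    define Q where "Q = (\<lambda>ys :: nat list. \<not> edge (ys ! 0) (ys ! 1) (ys ! Suc (Suc j)))"
    have "recursive (Suc (Suc 2)) (\<lambda>ys. of_bool (Q ys))"
      using rec_edge[of "Suc (Suc j)"] that by (simp add: Q_def)
    then have "recursive 2 (\<lambda>xs. of_bool (\<exists>q a. prefix (q @ [a]) (list_decode (xs ! i)) \<and>
        Q (list_encode (rev (map inv_code q)) # a # xs)))"
      by (rule recursive_Ex_prefix) (rule rec_proj[OF that(1)])
    then show ?thesis
      unfolding incl_def by (rule recursive_not[THEN rec_cong]) (simp add: Q_def)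
  qed
  define h where "h = (\<lambda>xs :: nat list. of_bool (f [xs ! 0, xs ! 1] = 1 \<and> incl (xs ! 0) (xs ! 1) \<and> incl (xs ! 1) (xs ! 0)) :: nat)"
  have "recursive 2 h"
    unfolding h_def
    by (rule recursive_conj[OF recursive_val_eq[OF rec_proj rec_proj] recursive_conj[OF rec_incl rec_incl]]) auto
  moreover have "h [wc v, wc w] = (if (v, w) \<in> cell_cong then 1 else 0)" if "v \<in> words X" "w \<in> words X" for v w
    using cell_cong_iff_edges[OF that] incl[OF that] incl[OF that(2,1)] f[OF that] by (simp add: h_def)
  ultimately show thesis by (rule that)
qed

end

theorem theorem5p10:
  fixes X :: "'x set" and I :: "'i set" and r :: "'i \<Rightarrow> 'x word"
    and R :: "('x word \<times> 'x word) set"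
    and k l :: nat and u :: "nat \<Rightarrow> 'x word"
    and Xs Y :: "nat \<Rightarrow> 'x set" and x z :: "nat \<Rightarrow> 'x" and W :: "nat \<Rightarrow> 'x word set"
  assumes "finite X" and "finite I"
    and u_words: "\<forall>j\<in>{1..k}. u j \<in> words X"
    and factors: "factorisation (u ` {1..k}) I r"
    and R: "R = (\<lambda>i. (r i, [])) ` I"
    and unital: "\<forall>j\<in>{1..k}. Inv_val X R (u j) \<in> Units (Inv X R)"
    and G_dec: "decidable_word_problem X (Gp_val X R)"
    and Xs: "\<forall>j\<in>{1..l}. Xs j \<subseteq> X \<and> x j \<in> Xs j \<and> z j \<in> Xs j"
    and Y: "\<forall>j\<in>{1..l}. Y j = Xs j - {x j, z j}"
    and W: "\<forall>j\<in>{1..l}. W j \<subseteq> words (Y j)"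
    and c1: "\<forall>i\<in>{1..l}. \<forall>j\<in>{1..l}.
          (Xs i = Xs j \<longleftrightarrow> i = j) \<and> (i \<noteq> j \<longrightarrow> Xs i \<inter> Xs j = {})"
    and c2: "u ` {1..k} = (\<Union>j\<in>{1..l}. {[gen (x j)] @ w @ [gen (z j)] | w. w \<in> W j})"
    and c3: "\<forall>j\<in>{1..l}. [] \<in> W j"
    and c4: "\<forall>j\<in>{1..l}. \<forall>y\<in>Y j. \<exists>w\<in>concatenations (W j). [gen y] = red w"
  shows "decidable_membership X (Gp_val X R) (prefix_monoid X I r) \<and>
    decidable_word_problem X (EU_val X R) \<and>
    (E_unitary (Inv X R) \<longrightarrow> decidable_word_problem X (Inv_val X R))"
proof -
  let ?U = "u ` {1..k}"
  \<comment> \<open>The numbering of the generators that comes with the word problem of G serves for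
    all three conclusions.\<close>
  obtain e f where e: "inj_on e X" "recursive 2 f" and f: "\<forall>v\<in>words X. \<forall>w\<in>words X.
      f [word_code e v, word_code e w] = (if Gp_val X R v = Gp_val X R w then 1 else 0)"
    using G_dec unfolding decidable_word_problem_def by blast
  have concat: "r i \<in> concatenations ?U" if "i \<in> I" for i
    using factors that by (simp add: factorisation_def)
  interpret special_presentation X I r
  proof
    fix i assume "i \<in> I"
    then obtain us where us: "r i = concat us" "us \<in> lists (?U \<union> inv_word ` ?U)"
      using concat[of i] by (auto simp: concatenations_def)
    from us(2) have "concat us \<in> words X" using u_words by (induction us) auto
    with us show "r i \<in> words X" by simp
  qed
  have R': "R = relations" by (simp add: R relations_def)
  interpret marked_factorisation X I r ?U l Xs Y x z W
  proof
    show "?U \<subseteq> words X" using u_words by blast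
    show "r i \<in> concatenations ?U" if "i \<in> I" for i by (rule concat[OF that])
    show "mval v \<in> Units (Inv X relations)" if "v \<in> ?U" for v using that unital unfolding R' by blast
    show "?U = (\<Union>j\<in>{1..l}. {[gen (x j)] @ w @ [gen (z j)] | w. w \<in> W j})" by (rule c2)
    fix j assume j: "j \<in> {1..l}"
    show "Xs j \<subseteq> X \<and> x j \<in> Xs j \<and> z j \<in> Xs j" using Xs j by (rule bspec)
    show "Y j = Xs j - {x j, z j}" using Y j by (rule bspec)
    show "W j \<subseteq> words (Y j)" using W j by (rule bspec)
    show "[] \<in> W j" using c3 j by (rule bspec)
    show "Xs j \<inter> Xs j' = {}" if "j' \<in> {1..l}" "j \<noteq> j'" for j' using c1 j that by blast
    show "\<exists>w\<in>concatenations (W j). [gen y] = red w" if "y \<in> Y j" for y using c4 j that by blast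
  qed
  interpret coded_free_factor X I r S T A B e f
    by unfold_locales (use assms(1) e f in \<open>simp_all add: R'\<close>)
  obtain fP where fP: "recursive 1 fP" "\<And>w. w \<in> words X \<Longrightarrow> fP [wc w] = (if val w \<in> P then 1 else 0)"
    using recursive_membership by blast
  obtain h where h: "recursive 2 h"
    "\<And>v w. v \<in> words X \<Longrightarrow> w \<in> words X \<Longrightarrow> h [wc v, wc w] = (if (v, w) \<in> cell_cong then 1 else 0)"
    using cell_cong_decidable[OF assms(2) fP] by blast
  show ?thesis
    unfolding decidable_membership_def decidable_word_problem_def R'
  proof (intro conjI impI)
    show "\<exists>e f. inj_on e X \<and> recursive 1 f \<and> (\<forall>w\<in>words X. f [word_code e w] = (if val w \<in> P then 1 else 0))"
      using e(1) fP by blast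
    show "\<exists>e f. inj_on e X \<and> recursive 2 f \<and> (\<forall>v\<in>words X. \<forall>w\<in>words X. f [word_code e v, word_code e w]
        = (if EU_val X relations v = EU_val X relations w then 1 else 0))"
      using e(1) h EU_val_eq_iff_cell_cong by (intro exI[of _ e] exI[of _ h]) simp
    assume "E_unitary (Inv X relations)"
    then show "\<exists>e f. inj_on e X \<and> recursive 2 f \<and> (\<forall>v\<in>words X. \<forall>w\<in>words X. f [word_code e v, word_code e w]
        = (if mval v = mval w then 1 else 0))"
      using e(1) h mval_eq_iff_cell_cong by (intro exI[of _ e] exI[of _ h]) simp
  qed
qed

end
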